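(* Consider $x'=\frac{dx}{dt}=f(x,\mu)$, $x\in\mathbb{R}^n$, $\mu\in\mathbb{R}^k$, with a time-scale desingularization $d\tau/dt=T(x)$ and desingularized vector field $\dot x=\frac{dx}{d\tau}=T(x)^{-1}f(x,\mu)$ as in the context, with flow $\varphi^{des}_\mu$, and put $\Phi^{des}(\tau,x,\mu)=(\varphi^{des}_\mu(\tau,x),\mu)$. Let $K\subset\mathbb{R}^k$ be a compact set homeomorphic to $\overline{\mathbf{B}_{\tilde k}}$ with $\tilde k\le k$. Suppose the following. (1) $\{x_\ast(\mu)\}_{\mu\in K}$ is a family of degeneracy-inducing points which are equilibria of the desingularized vector field, and $N\subset\mathbb{R}^n$ is an isolating block for the desingularized vector field, for each $\mu\in K$, which contains $x_\ast(\mu)$ and on which the $M$-cone condition holds over $N\times K$. (2) There are $h$-sets $N_0,N_1,\dots,N_m\subset\mathbb{R}^n\times K$ whose projections to the parameter space equal $K$, and times $\tau_0,\dots,\tau_m>0$, such that the covering relations $$N_0\overset{\Phi^{des}(\tau_0,\cdot)}{\Longrightarrow}N_1\overset{\Phi^{des}(\tau_1,\cdot)}{\Longrightarrow}\cdots\overset{\Phi^{des}(\tau_{m-1},\cdot)}{\Longrightarrow}N_m\overset{\Phi^{des}(\tau_m,\cdot)}{\Longrightarrow}N\times K$$ hold. Let $\bar\tau=\sum_{j=0}^m\tau_j$. (3) For every $(x_0,\mu_0)\in N_0$ whose $\Phi^{des}$-orbit passes successively through $N_1,\dots,N_m$ at the times $\tau_0,\tau_0+\tau_1,\dots,\tau_0+\dots+\tau_{m-1}$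 and satisfies $\varphi^{des}_{\mu_0}(\bar\tau,x_0)\in W^s(x_\ast(\mu_0);\varphi^{des}_{\mu_0})\cap N$: $T$ has an identical sign along $\{\varphi^{des}_{\mu_0}(\tau,x_0)\mid\tau\in[0,\bar\tau]\}$ and on all points of $(W^s(x_\ast(\mu_0);\varphi^{des}_{\mu_0})\cap N)\setminus\{x_\ast(\mu_0)\}$, and $$t_{\max}:=\int_0^\infty\frac{d\tau}{T(\varphi^{des}_{\mu_0}(\tau,x_0))}<\infty.$$ Then there exist $(x_0,\mu_0)\in N_0$ and a solution $x(t)$ of $x'=f(x,\mu_0)$ on $[0,t_{\max})$ with $x(0)=x_0$ such that $x(t)\to x_\ast(\mu_0)$ as $t\to t_{\max}$, where $t_{\max}=\int_0^\infty\frac{d\tau}{T(\varphi^{des}_{\mu_0}(\tau,x_0))}<\infty$ for this $(x_0,\mu_0)$; that is, the trajectory reaches $x_\ast(\mu_0)$ at $t=t_{\max}$.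
   Context: Desingularization. $1/T:\mathbb{R}^n\to[0,\infty)$ is a continuous function; $T(x)$ is finite and positive exactly where $1/T(x)>0$, and "$T$ has an identical sign" on a set means that $T$ is finite and positive (i.e. $1/T>0$) there. The vector field $f$ is defined where $1/T>0$, may be singular at zeros of $1/T$, and $T(x)^{-1}f(x,\mu)$ extends to a smooth vector field on $\mathbb{R}^n\times\mathbb{R}^k$ whose flow for fixed $\mu$ is $\varphi^{des}_\mu$. A degeneracy-inducing point is a zero of $1/T$ where the original vector field degenerates; it need not be an equilibrium of $x'=f(x,\mu)$. Notation. $\overline{\mathbf{B}_d}$ is the closed unit ball in $\mathbb{R}^d$, $\|\cdot\|$ is Euclidean. An $h$-set is a compact $N\subset\mathbb{R}^D$ with integers $u(N),s(N)\ge0$, $u(N)+s(N)=\dim N\le D$, and a homeomorphism $c_N:E_N\to\mathbb{R}^{u(N)}\times\mathbb{R}^{s(N)}$ from a set $E_N\supset N$ in $\mathbb{R}^D$ with $c_N(N)=N_c:=\overline{\mathbf{B}_{u(N)}}\times\overline{\mathbf{B}_{s(N)}}$. Put $N_c^-=\partial\overline{\mathbf{B}_{u(N)}}\times\overline{\mathbf{B}_{s(N)}}$, $N_c^+=\overline{\mathbf{B}_{u(N)}}\times\partial\overline{\mathbf{B}_{s(N)}}$. Covering relation. For $h$-sets $N,M'$ with $u(N)=u(M')=u$ and continuous $F:N\to E_{M'}$, put $F_c=c_{M'}\circ F\circ c_N^{-1}:N_c\to\mathbb{R}^u\times\mathbb{R}^{s(M')}$. $N\overset{F}{\Longrightarrow}M'$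 means: there is a continuous homotopy $h:[0,1]\times N_c\to\mathbb{R}^u\times\mathbb{R}^{s(M')}$ with $h_0=F_c$, $h([0,1],N_c^-)\cap M'_c=\emptyset$, $h([0,1],N_c)\cap (M'_c)^+=\emptyset$, and a continuous $A:\mathbb{R}^u\to\mathbb{R}^u$ with $h_1(p,q)=(A(p),0)$, $A(\partial\mathbf{B}_u)\subset\mathbb{R}^u\setminus\overline{\mathbf{B}_u}$ and $\deg(A,\overline{\mathbf{B}_u},0)\ne0$. The block $N$. In coordinates $x=P_\mu(a,b)$, $P_\mu(0,0)=x_\ast(\mu)$, $(a,b)\in\mathbb{R}^{n_u}\times\mathbb{R}^{n_s}$, $n_u+n_s=n$, the desingularized system is $\dot a=f^a(a,b;\mu)$, $\dot b=f^b(a,b;\mu)$, and $N$ is an $h$-set with $c_N=P_\mu^{-1}$, $c_N(N)=\overline{\mathbf{B}_{n_u}}\times\overline{\mathbf{B}_{n_s}}$. $N\times K$ is regarded as an $h$-set with $u(N\times K)=n_u$, $s(N\times K)=n_s+\tilde k$, using the coordinates $(a;b,\kappa(\mu))$ with $\kappa:K\to\overline{\mathbf{B}_{\tilde k}}$ a homeomorphism; all $N_i$ have $u(N_i)=n_u$. Isolating block: compact $N$ with $\partial N=N^{\rm exit}\cup N^{\rm ent}$, $N^{\rm exit}$ closed in $\partial N$. A point $x\in\partial N$ is an exit (resp. entrance) point if for every solution $\sigma:[-\delta_1,\delta_2]\to\mathbb{R}^n$ with $\sigma(0)=x$, $\delta_1\ge0$, $\delta_2>0$, there are $0\le\epsilon_1\le\delta_1$,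 $0<\epsilon_2\le\delta_2$ with $\sigma(t)\notin N$ (resp. $\in{\rm int}\,N$) for $0<t\le\epsilon_2$ and $\sigma(t)\notin\partial N$ (resp. $\notin N$) for $-\epsilon_1\le t<0$. $M$-cone condition over $N\times K$, $M>1$: let $l(A)$ and $m_l(A)$ be the largest and smallest eigenvalues of $(A+A^T)/2$; with $\overrightarrow{\mu_s}=\sup_{N\times K}\{l(\partial f^b/\partial b)+M\|\partial f^b/\partial(a,\mu)\|\}$, $\overrightarrow{\xi_u}=\inf_{N\times K}m_l(\partial f^a/\partial a)-M\sup_{N\times K}\|\partial f^a/\partial(b,\mu)\|$, $\overrightarrow{\mu_{ss}}=\sup_{N\times K}\{l(\partial f^b/\partial b)+M^{-1}\|\partial f^b/\partial a\|\}$, $\overrightarrow{\xi_{su}}=\inf_{N\times K}m_l(\partial f^a/\partial a)-M^{-1}\sup_{N\times K}\|\partial f^a/\partial b\|$, one has $\overrightarrow{\mu_s}<0<\overrightarrow{\xi_u}$, $\overrightarrow{\mu_{ss}}<\overrightarrow{\xi_u}$, $\overrightarrow{\mu_s}<\overrightarrow{\xi_{su}}$. $W^s(x_\ast(\mu);\varphi^{des}_\mu)\cap N$ is the local stable manifold in $N$ (points whose forward orbit stays in $N$ and converges to $x_\ast(\mu)$). It is known that under (1) it is the graph $a=\sigma^s_\mu(b)$, $b\in\overline{\mathbf{B}_{n_s}}$, of a function with Lipschitz constant $1/M$ depending continuously on $\mu\in K$. *)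

theory Defs
  imports "HOL-Analysis.Analysis" "HOL-Homology.Homology"
begin

section \<open>Smooth maps\<close>

text \<open>\<open>Ck_on k S f\<close>: \<open>f\<close> is of class \<open>C^k\<close> on the open set \<open>S\<close>.\<close>

primrec Ck_on ::
  "nat \<Rightarrow> 'a::euclidean_space set \<Rightarrow> ('a \<Rightarrow> 'b::euclidean_space) \<Rightarrow> bool" where
  "Ck_on 0 S f \<longleftrightarrow> continuous_on S f"
| "Ck_on (Suc k) S f \<longleftrightarrow>
     (\<forall>x\<in>S. f differentiable at x) \<and> (\<forall>v. Ck_on k S (\<lambda>x. frechet_derivative f (at x) v))"

definition smooth_on :: "'a::euclidean_space set \<Rightarrow> ('a \<Rightarrow> 'b::euclidean_space) \<Rightarrow> bool" where
  "smooth_on S f \<longleftrightarrow> (\<forall>k. Ck_on k S f)"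


section \<open>Solutions and local flows\<close>

definition solves ::
  "('a \<Rightarrow> 'a) \<Rightarrow> (real \<Rightarrow> 'a::real_normed_vector) \<Rightarrow> real set \<Rightarrow> bool" where
  "solves X \<sigma> S \<longleftrightarrow> (\<forall>t\<in>S. (\<sigma> has_vector_derivative X (\<sigma> t)) (at t within S))"

text \<open>
  The flow of a smooth vector field on \<open>\<real>\<^sup>n\<close> need not be complete. \<open>flow_defined X \<tau> x\<close> says
  that the forward solution through \<open>x\<close> exists up to time \<open>\<tau>\<close>; only then is
  \<open>flow X \<tau> x\<close> meaningful. Only forward times are needed.
\<close>

definition flow_defined :: "('a \<Rightarrow> 'a) \<Rightarrow> real \<Rightarrow> 'a::real_normed_vector \<Rightarrow> bool" where
  "flow_defined X \<tau> x \<longleftrightarrow> 0 \<le> \<tau> \<and> (\<exists>\<sigma>. \<sigma> 0 = x \<and> solves X \<sigma> {0..\<tau>})"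

definition flow :: "('a \<Rightarrow> 'a) \<Rightarrow> real \<Rightarrow> 'a \<Rightarrow> 'a::real_normed_vector" where
  "flow X \<tau> x = (THE y. \<exists>\<sigma>. \<sigma> 0 = x \<and> solves X \<sigma> {0..\<tau>} \<and> \<sigma> \<tau> = y)"

definition local_stable_set ::
  "('a \<Rightarrow> 'a) \<Rightarrow> 'a set \<Rightarrow> 'a \<Rightarrow> 'a::real_normed_vector set" where
  "local_stable_set X N p =
     {x \<in> N. (\<forall>\<tau>\<ge>0. flow_defined X \<tau> x \<and> flow X \<tau> x \<in> N) \<and>
             ((\<lambda>\<tau>. flow X \<tau> x) \<longlongrightarrow> p) at_top}"


section \<open>Isolating blocks\<close>

definition exit_points :: "('a \<Rightarrow> 'a) \<Rightarrow> 'a set \<Rightarrow> 'a::real_normed_vector set" where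
  "exit_points X N = {x \<in> frontier N.
     \<forall>\<sigma> \<delta>1 \<delta>2. 0 \<le> \<delta>1 \<and> 0 < \<delta>2 \<and> solves X \<sigma> {-\<delta>1..\<delta>2} \<and> \<sigma> 0 = x \<longrightarrow>
       (\<exists>\<epsilon>1 \<epsilon>2. 0 \<le> \<epsilon>1 \<and> \<epsilon>1 \<le> \<delta>1 \<and> 0 < \<epsilon>2 \<and> \<epsilon>2 \<le> \<delta>2 \<and>
          (\<forall>t. 0 < t \<and> t \<le> \<epsilon>2 \<longrightarrow> \<sigma> t \<notin> N) \<and>
          (\<forall>t. -\<epsilon>1 \<le> t \<and> t < 0 \<longrightarrow> \<sigma> t \<notin> frontier N))}"

definition entrance_points :: "('a \<Rightarrow> 'a) \<Rightarrow> 'a set \<Rightarrow> 'a::real_normed_vector set" where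
  "entrance_points X N = {x \<in> frontier N.
     \<forall>\<sigma> \<delta>1 \<delta>2. 0 \<le> \<delta>1 \<and> 0 < \<delta>2 \<and> solves X \<sigma> {-\<delta>1..\<delta>2} \<and> \<sigma> 0 = x \<longrightarrow>
       (\<exists>\<epsilon>1 \<epsilon>2. 0 \<le> \<epsilon>1 \<and> \<epsilon>1 \<le> \<delta>1 \<and> 0 < \<epsilon>2 \<and> \<epsilon>2 \<le> \<delta>2 \<and>
          (\<forall>t. 0 < t \<and> t \<le> \<epsilon>2 \<longrightarrow> \<sigma> t \<in> interior N) \<and>
          (\<forall>t. -\<epsilon>1 \<le> t \<and> t < 0 \<longrightarrow> \<sigma> t \<notin> N))}"

definition isolating_block :: "('a \<Rightarrow> 'a) \<Rightarrow> 'a::real_normed_vector set \<Rightarrow> bool" where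
  "isolating_block X N \<longleftrightarrow>
     compact N \<and> frontier N = exit_points X N \<union> entrance_points X N \<and>
     closedin (top_of_set (frontier N)) (exit_points X N)"


section \<open>h-sets and covering relations\<close>

text \<open>
  Model spaces \<open>\<real>\<^sup>d\<close> for arbitrary \<open>d \<ge> 0\<close> are \<^const>\<open>Euclidean_space\<close> \<open>d\<close>, that is, the
  sequences vanishing from index \<open>d\<close> on.
\<close>

definition enorm :: "nat \<Rightarrow> (nat \<Rightarrow> real) \<Rightarrow> real" where
  "enorm d x = L2_set x {..<d}"

definition unit_ball :: "nat \<Rightarrow> (nat \<Rightarrow> real) set" where
  "unit_ball d = {x \<in> topspace (Euclidean_space d). enorm d x \<le> 1}"

definition unit_sphere :: "nat \<Rightarrow> (nat \<Rightarrow> real) set" where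
  "unit_sphere d = {x \<in> topspace (Euclidean_space d). enorm d x = 1}"

text \<open>
  The degree \<open>deg(A, B, 0)\<close> over the closed unit ball \<open>B\<close> of \<open>\<real>\<^sup>d\<close> of a continuous
  map \<open>A\<close> without zeros on the boundary, as the Brouwer degree of the self-map
  \<open>A / \<parallel>A\<parallel>\<close> of the unit sphere. For \<open>d = 0\<close> the ball is a point, \<open>A\<close> is the
  identity of \<open>\<real>\<^sup>0\<close>, and the degree is \<open>1\<close>.
\<close>

definition ball_degree :: "nat \<Rightarrow> ((nat \<Rightarrow> real) \<Rightarrow> (nat \<Rightarrow> real)) \<Rightarrow> int" where
  "ball_degree d A =
     (if d = 0 then 1 else Brouwer_degree2 (d - 1) (\<lambda>x i. A x i / enorm d (A x)))"

record 'a hset =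
  hsupp  :: "'a set"
  hdom   :: "'a set"
  hu     :: nat
  hs     :: nat
  hchart :: "'a \<Rightarrow> (nat \<Rightarrow> real) \<times> (nat \<Rightarrow> real)"

definition model :: "'a hset \<Rightarrow> ((nat \<Rightarrow> real) \<times> (nat \<Rightarrow> real)) set" where
  "model N = unit_ball (hu N) \<times> unit_ball (hs N)"

definition model_minus :: "'a hset \<Rightarrow> ((nat \<Rightarrow> real) \<times> (nat \<Rightarrow> real)) set" where
  "model_minus N = unit_sphere (hu N) \<times> unit_ball (hs N)"

definition model_plus :: "'a hset \<Rightarrow> ((nat \<Rightarrow> real) \<times> (nat \<Rightarrow> real)) set" where
  "model_plus N = unit_ball (hu N) \<times> unit_sphere (hs N)"

definition model_space :: "'a hset \<Rightarrow> ((nat \<Rightarrow> real) \<times> (nat \<Rightarrow> real)) topology" where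
  "model_space N = prod_topology (Euclidean_space (hu N)) (Euclidean_space (hs N))"

text \<open>
  The requirement \<open>u(N) + s(N) = dim N\<close> needs no separate clause: \<open>N\<close> is homeomorphic to a
  product of balls of dimensions \<open>u(N)\<close> and \<open>s(N)\<close>.
\<close>

definition is_hset :: "'a::euclidean_space hset \<Rightarrow> bool" where
  "is_hset N \<longleftrightarrow>
     compact (hsupp N) \<and> hsupp N \<subseteq> hdom N \<and> hu N + hs N \<le> DIM('a) \<and>
     homeomorphic_map (top_of_set (hdom N)) (model_space N) (hchart N) \<and>
     hchart N ` hsupp N = model N"

definition in_charts ::
  "'a hset \<Rightarrow> 'b hset \<Rightarrow> ('a \<Rightarrow> 'b) \<Rightarrow>
   (nat \<Rightarrow> real) \<times> (nat \<Rightarrow> real) \<Rightarrow> (nat \<Rightarrow> real) \<times> (nat \<Rightarrow> real)" where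
  "in_charts N M F = (\<lambda>w. hchart M (F (inv_into (hsupp N) (hchart N) w)))"

definition covers ::
  "('a::topological_space \<Rightarrow> 'b::topological_space) \<Rightarrow> 'a hset \<Rightarrow> 'b hset \<Rightarrow> bool" where
  "covers F N M \<longleftrightarrow>
     hu N = hu M \<and> continuous_on (hsupp N) F \<and> F ` hsupp N \<subseteq> hdom M \<and>
     (\<exists>h A.
        continuous_map
          (prod_topology (top_of_set {0..1::real}) (subtopology (model_space N) (model N)))
          (model_space M) h \<and>
        (\<forall>w\<in>model N. h (0, w) = in_charts N M F w) \<and>
        h ` ({0..1} \<times> model_minus N) \<inter> model M = {} \<and>
        h ` ({0..1} \<times> model N) \<inter> model_plus M = {} \<and>
        continuous_map (Euclidean_space (hu N)) (Euclidean_space (hu N)) A \<and>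
        (\<forall>p q. (p, q) \<in> model N \<longrightarrow> h (1, (p, q)) = (A p, (\<lambda>_. 0))) \<and>
        A ` unit_sphere (hu N) \<inter> unit_ball (hu N) = {} \<and>
        ball_degree (hu N) A \<noteq> 0)"


section \<open>Block coordinates\<close>

text \<open>
  A splitting \<open>\<real>\<^sup>n = \<real>\<^bsup>n\<^sub>u\<^esup> \<times> \<real>\<^bsup>n\<^sub>s\<^esup>\<close> is given by a set \<open>U\<close> of \<open>n\<^sub>u\<close> coordinate indices:
  a vector \<open>z = (a, b)\<close> has the components with index in \<open>U\<close> as \<open>a\<close> and the remaining
  ones as \<open>b\<close>. This allows \<open>n\<^sub>u = 0\<close> and \<open>n\<^sub>s = 0\<close>.
\<close>

definition part :: "'n set \<Rightarrow> real^'n \<Rightarrow> real^'n" where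
  "part S z = (\<chi> i. if i \<in> S then z $ i else 0)"

definition enum_part :: "'n::finite set \<Rightarrow> real^'n \<Rightarrow> (nat \<Rightarrow> real)" where
  "enum_part S z = (\<lambda>i. if i < card S then z $ from_nat_into S i else 0)"

definition box_ab :: "'n::finite set \<Rightarrow> (real^'n) set" where
  "box_ab U = {z. norm (part U z) \<le> 1 \<and> norm (part (- U) z) \<le> 1}"

text \<open>
  The vector field \<open>(f\<^sup>a, f\<^sup>b)\<close> that represents \<open>g(\<cdot>, \<mu>)\<close> in the coordinates \<open>x = P (z, \<mu>)\<close>.
\<close>

definition coord_field ::
  "((real^'n::finite) \<times> (real^'k::finite) \<Rightarrow> real^'n) \<Rightarrow>
   ((real^'n) \<times> (real^'k) \<Rightarrow> real^'n) \<Rightarrow> (real^'n) \<times> (real^'k) \<Rightarrow> real^'n" where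
  "coord_field P g = (\<lambda>(z, \<mu>).
     THE w. frechet_derivative (\<lambda>y. P (y, \<mu>)) (at z) w = g (P (z, \<mu>), \<mu>))"

text \<open>
  \<open>N \<times> K\<close> with coordinates \<open>(a; b, \<kappa>(\<mu>))\<close>. These coordinates map it onto a product of three
  balls; \<open>round_off\<close> is the radial homeomorphism of \<open>\<real>\<^bsup>s+k\<^esup>\<close> that carries the
  product of the unit balls of \<open>\<real>\<^sup>s\<close> and \<open>\<real>\<^sup>k\<close> to the round unit ball (and boundary to
  boundary), so that \<open>u = n\<^sub>u\<close> and \<open>s = n\<^sub>s + k\<close>. As \<open>\<kappa>\<close> is only given on \<open>K\<close>, the chart
  has domain \<open>\<Union>\<mu>\<in>K. range P\<^sub>\<mu> \<times> {\<mu>}\<close>.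
\<close>

definition join_coords :: "nat \<Rightarrow> (nat \<Rightarrow> real) \<Rightarrow> (nat \<Rightarrow> real) \<Rightarrow> (nat \<Rightarrow> real)" where
  "join_coords s y v = (\<lambda>i. if i < s then y i else v (i - s))"

definition round_off :: "nat \<Rightarrow> nat \<Rightarrow> (nat \<Rightarrow> real) \<Rightarrow> (nat \<Rightarrow> real) \<Rightarrow> (nat \<Rightarrow> real)" where
  "round_off s k y v = (\<lambda>i.
     max (enorm s y) (enorm k v) / sqrt ((enorm s y)\<^sup>2 + (enorm k v)\<^sup>2) * join_coords s y v i)"

definition block_times_params ::
  "'n::finite set \<Rightarrow> ((real^'n) \<times> (real^'k::finite) \<Rightarrow> real^'n) \<Rightarrow> (real^'n) set \<Rightarrow>
   (real^'k) set \<Rightarrow> nat \<Rightarrow> (real^'k \<Rightarrow> nat \<Rightarrow> real) \<Rightarrow> ((real^'n) \<times> (real^'k)) hset" where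
  "block_times_params U P N K kt \<kappa> =
     \<lparr> hsupp = N \<times> K,
       hdom = {(x, \<mu>). \<mu> \<in> K \<and> x \<in> range (\<lambda>z. P (z, \<mu>))},
       hu = card U,
       hs = card (- U) + kt,
       hchart = (\<lambda>(x, \<mu>).
         let z = inv_into UNIV (\<lambda>z. P (z, \<mu>)) x
         in (enum_part U z, round_off (card (- U)) kt (enum_part (- U) z) (\<kappa> \<mu>))) \<rparr>"


section \<open>Cone condition\<close>

definition jac_z ::
  "((real^'n::finite) \<times> (real^'k::finite) \<Rightarrow> real^'n) \<Rightarrow> (real^'n) \<times> (real^'k) \<Rightarrow> real^'n^'n" where
  "jac_z F w = (\<chi> i j. frechet_derivative F (at w) (axis j 1, 0) $ i)"

text \<open>The eigenvalues of \<open>(A + A\<^sup>T) / 2\<close>, \<open>A\<close> being the square block of \<open>J\<close> with index set \<open>S\<close>.\<close>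

definition sym_eigenvalues :: "'n::finite set \<Rightarrow> real^'n^'n \<Rightarrow> real set" where
  "sym_eigenvalues S J = {r. \<exists>v. v \<noteq> 0 \<and> (\<forall>i. i \<notin> S \<longrightarrow> v $ i = 0) \<and>
     (\<forall>i\<in>S. (\<Sum>j\<in>S. (J $ i $ j + J $ j $ i) / 2 * v $ j) = r * v $ i)}"

text \<open>
  Largest and smallest eigenvalue, as extended reals: for the empty block they are \<open>-\<infinity>\<close> and
  \<open>\<infinity>\<close>, so that conditions on an absent direction hold vacuously.
\<close>

definition l_max :: "'n::finite set \<Rightarrow> real^'n^'n \<Rightarrow> ereal" where
  "l_max S J = (SUP r\<in>sym_eigenvalues S J. ereal r)"

definition l_min :: "'n::finite set \<Rightarrow> real^'n^'n \<Rightarrow> ereal" where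
  "l_min S J = (INF r\<in>sym_eigenvalues S J. ereal r)"

text \<open>
  Operator norms of the blocks \<open>\<partial>f\<^sup>R/\<partial>z\<^sup>S\<close> and \<open>\<partial>f\<^sup>R/\<partial>(z\<^sup>S, \<mu>)\<close>, rows \<open>R\<close>, columns \<open>S\<close>.
\<close>

definition norm_dz ::
  "'n::finite set \<Rightarrow> 'n set \<Rightarrow> ((real^'n) \<times> (real^'k::finite) \<Rightarrow> real^'n) \<Rightarrow>
   (real^'n) \<times> (real^'k) \<Rightarrow> real" where
  "norm_dz R S F w = onorm (\<lambda>v. part R (frechet_derivative F (at w) (part S v, 0)))"

definition norm_dzmu ::
  "'n::finite set \<Rightarrow> 'n set \<Rightarrow> ((real^'n) \<times> (real^'k::finite) \<Rightarrow> real^'n) \<Rightarrow>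
   (real^'n) \<times> (real^'k) \<Rightarrow> real" where
  "norm_dzmu R S F w = onorm (\<lambda>(v, \<nu>). part R (frechet_derivative F (at w) (part S v, \<nu>)))"

text \<open>In the following, \<open>F = (f\<^sup>a, f\<^sup>b)\<close> and \<open>D\<close> is \<open>N \<times> K\<close> in the coordinates \<open>(a, b, \<mu>)\<close>.\<close>

definition mu_s ::
  "'n::finite set \<Rightarrow> real \<Rightarrow> ((real^'n) \<times> (real^'k::finite) \<Rightarrow> real^'n) \<Rightarrow>
   ((real^'n) \<times> (real^'k)) set \<Rightarrow> ereal" where
  "mu_s U M F D = (SUP w\<in>D. l_max (- U) (jac_z F w) + ereal (M * norm_dzmu (- U) U F w))"

definition xi_u ::
  "'n::finite set \<Rightarrow> real \<Rightarrow> ((real^'n) \<times> (real^'k::finite) \<Rightarrow> real^'n) \<Rightarrow>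
   ((real^'n) \<times> (real^'k)) set \<Rightarrow> ereal" where
  "xi_u U M F D =
     (INF w\<in>D. l_min U (jac_z F w)) - ereal M * (SUP w\<in>D. ereal (norm_dzmu U (- U) F w))"

definition mu_ss ::
  "'n::finite set \<Rightarrow> real \<Rightarrow> ((real^'n) \<times> (real^'k::finite) \<Rightarrow> real^'n) \<Rightarrow>
   ((real^'n) \<times> (real^'k)) set \<Rightarrow> ereal" where
  "mu_ss U M F D = (SUP w\<in>D. l_max (- U) (jac_z F w) + ereal (inverse M * norm_dz (- U) U F w))"

definition xi_su ::
  "'n::finite set \<Rightarrow> real \<Rightarrow> ((real^'n) \<times> (real^'k::finite) \<Rightarrow> real^'n) \<Rightarrow>
   ((real^'n) \<times> (real^'k)) set \<Rightarrow> ereal" where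
  "xi_su U M F D =
     (INF w\<in>D. l_min U (jac_z F w)) -
     ereal (inverse M) * (SUP w\<in>D. ereal (norm_dz U (- U) F w))"

definition cone_condition ::
  "'n::finite set \<Rightarrow> real \<Rightarrow> ((real^'n) \<times> (real^'k::finite) \<Rightarrow> real^'n) \<Rightarrow>
   ((real^'n) \<times> (real^'k)) set \<Rightarrow> bool" where
  "cone_condition U M F D \<longleftrightarrow>
     1 < M \<and> mu_s U M F D < 0 \<and> 0 < xi_u U M F D \<and>
     mu_ss U M F D < xi_u U M F D \<and> mu_s U M F D < xi_su U M F D"

end

theory Submission
  imports Defs
begin

text \<open>
  Passing from \<open>f\<close> to \<open>g\<close> only changes the speed along orbits. So it suffices to find one orbit of
  the desingularized field that follows the chain of h-sets and, once it has arrived in the block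
  \<open>N\<close>, stays there forever: the cone condition forces such an orbit to converge to the equilibrium
  (\<open>trapped_orbit_converges\<close>), hypothesis (3) makes \<open>1/T\<close> positive and integrable along it, and its
  clock can be turned back from \<open>\<tau>\<close> to \<open>t\<close> (\<open>time_change\<close>).

  The orbit comes from a degree argument. All chart coordinates along the chain are unknowns, and the
  equations say that the image of each point is the next point. This system has \<open>u\<close> fewer equations
  than unknowns, and the exit coordinate \<open>p\<close> of the last point supplies them. The covering homotopies
  deform the completed system, without zeros far out, to the decoupled system that is built from the
  maps \<open>A\<close> (\<open>reaches_step\<close>), and its degree is not \<open>0\<close> by multiplicativity and by invariance under
  suspension (\<open>Brouwer_degree2_suspension\<close>). Composing the maps of the chain instead would not do: a
  point may leave an h-set in the directions of \<open>s\<close> and its further images then mean nothing; only as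
  an unknown of its own can an intermediate point be kept in its h-set.

  The last \<open>u\<close> equations are then replaced by others. After the field has been extended by a
  retraction onto the block, the region \<open>|a| \<ge> 1\<close> is forward invariant and \<open>|b|\<close> stays at most \<open>1\<close>
  (\<open>block_flow\<close>). Hence the exit coordinate of the point after time \<open>T\<close> does not vanish if the point
  starts on the exit face, so that it may replace \<open>p\<close> (\<open>reaches_end\<close>), and where it vanishes the
  orbit has stayed in the block up to time \<open>T\<close> (\<open>trapped_crossing\<close>). Letting \<open>T\<close> tend to infinity,
  compactness gives a chain whose end point never leaves the block (\<open>chain_limit\<close>). In this way a
  point of the stable manifold is hit without constructing the manifold as a graph.

  Both uses of the cone condition go through two estimates (\<open>cone_estimates\<close>): \<open>|a|\<close> expands where
  \<open>|b| \<le> M |a|\<close>, and \<open>|b|\<close> contracts where \<open>|a| \<le> M |b|\<close>.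
\<close>

section \<open>Vectors in coordinate spaces\<close>

definition coord_space :: "nat \<Rightarrow> (nat \<Rightarrow> real) set" where
  "coord_space n = {x. \<forall>i\<ge>n. x i = 0}"

abbreviation zvec :: "nat \<Rightarrow> real" where
  "zvec \<equiv> (\<lambda>_. 0)"

lemma Euclidean_space_coord_space: "Euclidean_space n = top_of_set (coord_space n)"
  by (simp add: Euclidean_space_def coord_space_def euclidean_product_topology)

lemma topspace_Euclidean_coord_space: "topspace (Euclidean_space n) = coord_space n"
  by (simp add: Euclidean_space_coord_space)

lemma zvec_in_coord_space [simp]: "zvec \<in> coord_space n"
  by (simp add: coord_space_def)

lemma unit_sphere_iff: "x \<in> unit_sphere n \<longleftrightarrow> x \<in> coord_space n \<and> enorm n x = 1"
  by (simp add: unit_sphere_def topspace_Euclidean_coord_space)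

lemma unit_ball_iff: "x \<in> unit_ball n \<longleftrightarrow> x \<in> coord_space n \<and> enorm n x \<le> 1"
  by (simp add: unit_ball_def topspace_Euclidean_coord_space)

lemma enorm_nonneg [simp]: "0 \<le> enorm n x"
  by (simp add: enorm_def L2_set_nonneg)

lemma enorm_zvec [simp]: "enorm n zvec = 0"
  by (simp add: enorm_def L2_set_def)

lemma enorm_eq_0: "x \<in> coord_space n \<Longrightarrow> enorm n x = 0 \<longleftrightarrow> x = zvec"
  by (auto simp: enorm_def L2_set_eq_0_iff coord_space_def fun_eq_iff) (meson lessThan_iff not_le)

lemma enorm_scale: "enorm n (\<lambda>i. c * x i) = \<bar>c\<bar> * enorm n x"
  by (simp add: enorm_def L2_set_def power_mult_distrib sum_distrib_left[symmetric] real_sqrt_mult)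

lemma enorm_0_dim [simp]: "enorm 0 x = 0"
  by (simp add: enorm_def L2_set_def)

lemma enorm_square: "(enorm n x)\<^sup>2 = (\<Sum>i<n. (x i)\<^sup>2)"
  by (simp add: enorm_def L2_set_def sum_nonneg)

lemma coord_le_enorm: "x \<in> coord_space n \<Longrightarrow> \<bar>x i\<bar> \<le> enorm n x"
proof (cases "i < n")
  case True
  then have "(x i)\<^sup>2 \<le> (enorm n x)\<^sup>2"
    unfolding enorm_square by (intro member_le_sum) auto
  then show ?thesis using abs_le_square_iff[of "x i" "enorm n x"] by simp
qed (simp add: coord_space_def)

lemma coord_space_scale: "x \<in> coord_space n \<Longrightarrow> (\<lambda>i. c * x i) \<in> coord_space n"
  by (simp add: coord_space_def)

lemma coord_space_add:
  "x \<in> coord_space n \<Longrightarrow> y \<in> coord_space n \<Longrightarrow> (\<lambda>i. x i + y i) \<in> coord_space n"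
  by (simp add: coord_space_def)

lemma coord_space_diff:
  "x \<in> coord_space n \<Longrightarrow> y \<in> coord_space n \<Longrightarrow> (\<lambda>i. x i - y i) \<in> coord_space n"
  by (simp add: coord_space_def)

lemma continuous_on_coord:
  fixes f :: "'a::topological_space \<Rightarrow> nat \<Rightarrow> real"
  shows "continuous_on S f \<Longrightarrow> continuous_on S (\<lambda>x. f x i)"
  by (rule continuous_on_product_then_coordinatewise)

lemma continuous_on_vec:
  fixes f :: "'a::topological_space \<Rightarrow> nat \<Rightarrow> real"
  shows "(\<And>i. continuous_on S (\<lambda>x. f x i)) \<Longrightarrow> continuous_on S f"
  by (rule continuous_on_coordinatewise_then_product)

lemma continuous_on_enorm:
  fixes f :: "'a::topological_space \<Rightarrow> nat \<Rightarrow> real"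
  assumes "continuous_on S f" shows "continuous_on S (\<lambda>x. enorm n (f x))"
  unfolding enorm_def L2_set_def
  by (intro continuous_intros continuous_on_coord[OF assms])

lemma continuous_on_scale_vec:
  fixes f :: "'a::topological_space \<Rightarrow> nat \<Rightarrow> real"
  assumes "continuous_on S c" "continuous_on S f"
  shows "continuous_on S (\<lambda>z i. c z * f z i)"
  by (rule continuous_on_vec) (intro continuous_on_mult assms continuous_on_coord[OF assms(2)])

lemma continuous_on_add_vec:
  fixes f :: "'a::topological_space \<Rightarrow> nat \<Rightarrow> real"
  assumes "continuous_on S g" "continuous_on S f"
  shows "continuous_on S (\<lambda>z i. g z i + f z i)"
  by (rule continuous_on_vec) (intro continuous_on_add continuous_on_coord[OF assms(1)] continuous_on_coord[OF assms(2)])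

lemma continuous_on_diff_vec:
  fixes f :: "'a::topological_space \<Rightarrow> nat \<Rightarrow> real"
  assumes "continuous_on S g" "continuous_on S f"
  shows "continuous_on S (\<lambda>z i. g z i - f z i)"
  by (rule continuous_on_vec) (intro continuous_on_diff continuous_on_coord[OF assms(1)] continuous_on_coord[OF assms(2)])

definition normalize_vec :: "nat \<Rightarrow> (nat \<Rightarrow> real) \<Rightarrow> nat \<Rightarrow> real" where
  "normalize_vec n x = (\<lambda>i. x i / enorm n x)"

lemma normalize_vec_unit_sphere:
  "x \<in> coord_space n \<Longrightarrow> x \<noteq> zvec \<Longrightarrow> normalize_vec n x \<in> unit_sphere n"
  using enorm_scale[of n "inverse (enorm n x)" x] enorm_eq_0[of x n]
  by (simp add: unit_sphere_iff normalize_vec_def coord_space_def divide_inverse mult.commute)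

lemma normalize_vec_scale:
  assumes "c > 0"
  shows "normalize_vec n (\<lambda>i. c * x i) = normalize_vec n x"
  using assms by (simp add: normalize_vec_def enorm_scale fun_eq_iff)

lemma continuous_on_normalize_vec:
  assumes "continuous_on S f" "\<And>x. x \<in> S \<Longrightarrow> f x \<in> coord_space n \<and> f x \<noteq> zvec"
  shows "continuous_on S (\<lambda>x. normalize_vec n (f x))"
proof (rule continuous_on_vec)
  fix i
  have "enorm n (f x) \<noteq> 0" if "x \<in> S" for x
    using assms(2)[OF that] enorm_eq_0 by blast
  then show "continuous_on S (\<lambda>x. normalize_vec n (f x) i)"
    unfolding normalize_vec_def
    by (intro continuous_on_divide continuous_on_coord[OF assms(1)] continuous_on_enorm[OF assms(1)]) auto
qed

lemma nsphere_unit_sphere: "nsphere k = top_of_set (unit_sphere (Suc k))"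
proof -
  have "unit_sphere (Suc k) = coord_space (Suc k) \<inter> {x. (\<Sum>i\<le>k. x i ^ 2) = 1}"
    by (auto simp: unit_sphere_iff enorm_def L2_set_def lessThan_Suc_atMost)
  then show ?thesis
    by (simp add: nsphere_def Euclidean_space_coord_space subtopology_subtopology)
qed

lemma unit_sphere_nonzero: "x \<in> unit_sphere n \<Longrightarrow> x \<noteq> zvec"
  by (auto simp: unit_sphere_iff)

section \<open>The degree of a field on the unit sphere\<close>

text \<open>
  The field is not required to be normalized, so that a homotopy only has to avoid zero.
\<close>

definition field_degree :: "nat \<Rightarrow> ((nat \<Rightarrow> real) \<Rightarrow> nat \<Rightarrow> real) \<Rightarrow> int" where
  "field_degree n G = Brouwer_degree2 (n - 1) (\<lambda>x. normalize_vec n (G x))"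

lemma field_degree_homotopy:
  assumes n: "0 < n" and cont: "continuous_on ({0..1::real} \<times> unit_sphere n) (\<lambda>(t, x). H t x)"
    and H: "\<And>t x. 0 \<le> t \<Longrightarrow> t \<le> 1 \<Longrightarrow> x \<in> unit_sphere n \<Longrightarrow> H t x \<in> coord_space n \<and> H t x \<noteq> zvec"
  shows "field_degree n (H 0) = field_degree n (H 1)"
  unfolding field_degree_def
proof (rule Brouwer_degree2_homotopic)
  have c: "continuous_on ({0..1::real} \<times> unit_sphere n) (\<lambda>z. normalize_vec n (case z of (t, x) \<Rightarrow> H t x))"
    by (rule continuous_on_normalize_vec[OF cont]) (use H in auto)
  have ns: "nsphere (n - 1) = top_of_set (unit_sphere n)"
    using n nsphere_unit_sphere[of "n - 1"] by simp
  show "homotopic_with (\<lambda>x. True) (nsphere (n - 1)) (nsphere (n - 1))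
         (\<lambda>x. normalize_vec n (H 0 x)) (\<lambda>x. normalize_vec n (H 1 x))"
    unfolding homotopic_with_def ns
  proof (intro exI conjI)
    show "continuous_map (prod_topology (top_of_set {0..1}) (top_of_set (unit_sphere n)))
           (top_of_set (unit_sphere n)) (\<lambda>z. normalize_vec n (case z of (t, x) \<Rightarrow> H t x))"
      using c by (auto simp: continuous_map_in_subtopology intro!: normalize_vec_unit_sphere dest!: H)
  qed auto
qed

lemma field_degree_cong:
  assumes "0 < n" "\<And>x. x \<in> unit_sphere n \<Longrightarrow> normalize_vec n (F x) = normalize_vec n (G x)"
  shows "field_degree n F = field_degree n G"
  unfolding field_degree_def using assms nsphere_unit_sphere[of "n - 1"]
  by (intro Brouwer_degree2_eq) auto

lemma field_degree_id: "0 < n \<Longrightarrow> field_degree n (\<lambda>x. x) = 1"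
proof -
  assume n: "0 < n"
  have "field_degree n (\<lambda>x. x) = Brouwer_degree2 (n - 1) id"
    unfolding field_degree_def using n nsphere_unit_sphere[of "n - 1"]
    by (intro Brouwer_degree2_eq) (auto simp: normalize_vec_def unit_sphere_iff)
  then show ?thesis by simp
qed

text \<open>
  Homogeneity of \<open>B\<close> lets the normalization of \<open>F\<close> pass through \<open>B\<close>, which turns the composite of the
  fields into the composite of the two self-maps of the sphere.
\<close>

lemma field_degree_compose:
  assumes n: "0 < n"
    and F: "continuous_on (unit_sphere n) F" "\<And>x. x \<in> unit_sphere n \<Longrightarrow> F x \<in> coord_space n \<and> F x \<noteq> zvec"
    and B: "continuous_on (unit_sphere n) B" "\<And>x. x \<in> unit_sphere n \<Longrightarrow> B x \<in> coord_space n \<and> B x \<noteq> zvec"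
    and hom: "\<And>c x. 0 < c \<Longrightarrow> x \<in> coord_space n \<Longrightarrow> B (\<lambda>i. c * x i) = (\<lambda>i. c * B x i)"
  shows "field_degree n (\<lambda>x. B (F x)) = field_degree n B * field_degree n F"
proof -
  have ns: "nsphere (n - 1) = top_of_set (unit_sphere n)"
    using n nsphere_unit_sphere[of "n - 1"] by simp
  have "normalize_vec n (B (F x)) = normalize_vec n (B (normalize_vec n (F x)))"
    if "x \<in> unit_sphere n" for x
  proof -
    have e: "enorm n (F x) > 0"
      using F(2)[OF that] enorm_eq_0[of "F x" n] enorm_nonneg[of n "F x"] by linarith
    have "F x = (\<lambda>i. enorm n (F x) * normalize_vec n (F x) i)"
      using e by (simp add: normalize_vec_def)
    then have "B (F x) = (\<lambda>i. enorm n (F x) * B (normalize_vec n (F x)) i)"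
      using hom[OF e, of "normalize_vec n (F x)"] normalize_vec_unit_sphere[of "F x" n] F(2)[OF that]
      by (metis unit_sphere_iff)
    then show ?thesis
      using normalize_vec_scale[OF e] by metis
  qed
  then have "field_degree n (\<lambda>x. B (F x)) = field_degree n (\<lambda>x. B (normalize_vec n (F x)))"
    by (intro field_degree_cong n) auto
  also have "\<dots> = Brouwer_degree2 (n - 1) ((\<lambda>x. normalize_vec n (B x)) \<circ> (\<lambda>x. normalize_vec n (F x)))"
    by (simp add: field_degree_def o_def)
  also have "\<dots> = field_degree n B * field_degree n F"
    unfolding field_degree_def
    by (rule Brouwer_degree2_compose)
       (use F B in \<open>auto simp: ns[simplified] continuous_map_in_subtopology intro!: continuous_on_normalize_vec normalize_vec_unit_sphere\<close>)
  finally show ?thesis .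
qed

lemma field_degree_const: "field_degree n (\<lambda>x. a) = 0"
  unfolding field_degree_def by (rule Brouwer_degree2_const)

section \<open>Suspension\<close>

text \<open>
  The isomorphisms \<open>H\<^sub>n\<^sub>+\<^sub>1(S\<^sup>n\<^sup>+\<^sup>1) \<cong> H\<^sub>n\<^sub>+\<^sub>1(S\<^sup>n\<^sup>+\<^sup>1, lower) \<cong> H\<^sub>n\<^sub>+\<^sub>1(upper, equator) \<cong> H\<^sub>n(S\<^sup>n)\<close> are natural for
  \<open>r\<close>, because \<open>r\<close> preserves both hemispheres. So \<open>r\<close> acts on both ends by the same multiple.
\<close>

lemma Brouwer_degree2_suspension_aux:
  assumes cmr: "continuous_map (nsphere (Suc n)) (nsphere (Suc n)) r"
    and up: "r \<in> {x. 0 \<le> x (Suc n)} \<rightarrow> {x. 0 \<le> x (Suc n)}"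
    and low: "r \<in> {x. x (Suc n) \<le> 0} \<rightarrow> {x. x (Suc n) \<le> 0}"
  shows "Brouwer_degree2 (Suc n) r = Brouwer_degree2 n r"
proof -
  define d where "d = Brouwer_degree2 n r"
  let ?U = "{x::nat\<Rightarrow>real. 0 \<le> x (Suc n)}" and ?L = "{x::nat\<Rightarrow>real. x (Suc n) \<le> 0}"
    and ?E = "{x::nat\<Rightarrow>real. x (Suc n) = 0}"
  have eq: "r \<in> ?E \<rightarrow> ?E"
  proof
    fix x assume "x \<in> ?E"
    then have "0 \<le> r x (Suc n)" "r x (Suc n) \<le> 0" using up low by auto
    then show "r x \<in> ?E" by simp
  qed
  let ?S = "nsphere (Suc n)"
  have id2: "id \<in> ?E \<rightarrow> ?L" by auto
  have id1: "continuous_map (subtopology ?S ?U) ?S id" by (rule continuous_map_id_subt)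
  let ?sub = "subtopology ?S ?U"
  let ?G = "reduced_homology_group (int n) (nsphere n)"
  let ?G1 = "reduced_homology_group (1 + int n) ?S"
  let ?G2 = "relative_homology_group (1 + int n) ?sub ?E"
  let ?H2 = "relative_homology_group (1 + int n) ?S ?L"
  let ?b = "hom_boundary (1 + int n) ?sub ?E"
  let ?i = "hom_induced (1 + int n) ?sub ?E ?S ?L id"
  let ?j = "hom_induced (1 + int n) ?S {} ?S ?L id"
  let ?r = "hom_induced (int n) (nsphere n) {} (nsphere n) {} r"
  let ?r1 = "hom_induced (1 + int n) ?S {} ?S {} r"
  let ?r2 = "hom_induced (1 + int n) ?sub ?E ?sub ?E r"
  let ?s2 = "hom_induced (1 + int n) ?S ?L ?S ?L r"
  have b: "?b \<in> iso ?G2 ?G"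
    using iso_upper_hemisphere_reduced_homology_group[of "int n" n] by simp
  have i: "?i \<in> iso ?G2 ?H2"
    by (rule iso_relative_homology_group_upper_hemisphere)
  have j: "?j \<in> iso ?G1 ?H2"
    by (rule iso_reduced_homology_group_lower_hemisphere) simp
  interpret gb: group_hom ?G2 ?G ?b
    using b by (simp add: group_hom_def group_hom_axioms_def iso_imp_homomorphism)
  interpret gi: group_hom ?G2 ?H2 ?i
    using i by (simp add: group_hom_def group_hom_axioms_def iso_imp_homomorphism)
  interpret gj: group_hom ?G1 ?H2 ?j
    using j by (simp add: group_hom_def group_hom_axioms_def iso_imp_homomorphism)
  have injb: "inj_on ?b (carrier ?G2)" and injj: "inj_on ?j (carrier ?G1)"
    and suri: "?i ` carrier ?G2 = carrier ?H2"
    using b i j by (auto simp: iso_def bij_betw_def)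
  have cmrs: "continuous_map ?sub ?sub r"
    using cmr up by (auto simp: continuous_map_in_subtopology Pi_iff intro: continuous_map_from_subtopology)
  have eqs: "nsphere n = subtopology ?sub ?E"
  proof -
    have "?U \<inter> ?E = ?E" by auto
    then show ?thesis
      by (simp add: subtopology_nsphere_equator subtopology_subtopology)
  qed
  have nat_b: "?r (?b e) = ?b (?r2 e)" for e
    using naturality_hom_induced [OF cmrs eq, of "1 + int n"]
    by (simp only: eqs[symmetric] o_def fun_eq_iff) simp
  have nat_i: "?s2 (?i e) = ?i (?r2 e)" for e
  proof -
    have "?s2 (?i e) = hom_induced (1 + int n) ?sub ?E ?S ?L (r \<circ> id) e"
      by (rule hom_induced_compose'[OF id1 id2 cmr low])
    also have "\<dots> = hom_induced (1 + int n) ?sub ?E ?S ?L (id \<circ> r) e"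
      by (simp only: id_comp comp_id)
    also have "\<dots> = ?i (?r2 e)"
      by (rule hom_induced_compose'[OF cmrs eq id1 id2, symmetric])
    finally show ?thesis .
  qed
  have nat_j: "?s2 (?j c) = ?j (?r1 c)" for c
    using low by (simp add: hom_induced_compose' cmr)
  have "?r1 c = c [^]\<^bsub>?G1\<^esub> d" if c: "c \<in> carrier ?G1" for c
  proof -
    have "?j c \<in> ?i ` carrier ?G2" unfolding suri by (rule gj.hom_closed[OF c])
    then obtain e where e: "e \<in> carrier ?G2" "?j c = ?i e" by (elim imageE)
    have r2e: "?r2 e \<in> carrier ?G2" using hom_induced_carrier by blast
    have "?b (?r2 e) = ?b e [^]\<^bsub>?G\<^esub> d"
      using Brouwer_degree2[of "?b e" n r] e by (simp add: nat_b[symmetric] d_def)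
    also have "\<dots> = ?b (e [^]\<^bsub>?G2\<^esub> d)"
      using e by (simp add: gb.hom_int_pow)
    finally have "?r2 e = e [^]\<^bsub>?G2\<^esub> d"
      using injb r2e e by (auto simp: inj_on_def)
    then have "?s2 (?i e) = ?i e [^]\<^bsub>?H2\<^esub> d"
      using e by (simp add: nat_i gi.hom_int_pow)
    then have "?j (?r1 c) = ?j (c [^]\<^bsub>?G1\<^esub> d)"
      using c e by (simp add: nat_j[symmetric] gj.hom_int_pow)
    moreover have "?r1 c \<in> carrier ?G1" using c hom_induced_reduced by blast
    ultimately show ?thesis
      using injj c by (auto simp: inj_on_def)
  qed
  then show ?thesis
    unfolding d_def[symmetric]
    by (intro Brouwer_degree2_unique[OF cmr]) simp
qed

text \<open>
  Only the values on the sphere matter, and setting \<open>r\<close> to zero elsewhere makes it preserve the two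
  half spaces everywhere.
\<close>

lemma Brouwer_degree2_suspension:
  assumes cmr: "continuous_map (nsphere (Suc n)) (nsphere (Suc n)) r"
    and up: "\<And>x. x \<in> topspace (nsphere (Suc n)) \<Longrightarrow> 0 \<le> x (Suc n) \<Longrightarrow> 0 \<le> r x (Suc n)"
    and low: "\<And>x. x \<in> topspace (nsphere (Suc n)) \<Longrightarrow> x (Suc n) \<le> 0 \<Longrightarrow> r x (Suc n) \<le> 0"
  shows "Brouwer_degree2 (Suc n) r = Brouwer_degree2 n r"
proof -
  define r' where "r' x = (if x \<in> topspace (nsphere (Suc n)) then r x else zvec)" for x
  have sub: "x \<in> topspace (nsphere (Suc n))" if "x \<in> topspace (nsphere n)" for x
    using that subtopology_nsphere_equator[of n] by (metis Int_iff topspace_subtopology)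
  have "Brouwer_degree2 (Suc n) r = Brouwer_degree2 (Suc n) r'"
    by (rule Brouwer_degree2_eq) (simp add: r'_def)
  also have "\<dots> = Brouwer_degree2 n r'"
    by (rule Brouwer_degree2_suspension_aux)
       (use up low in \<open>auto simp: r'_def intro: continuous_map_eq[OF cmr]\<close>)
  also have "\<dots> = Brouwer_degree2 n r"
    by (rule Brouwer_degree2_eq) (simp add: r'_def sub)
  finally show ?thesis .
qed

lemma field_degree_suspension:
  assumes n: "0 < n" and F: "continuous_on (unit_sphere (Suc n)) F"
      "\<And>x. x \<in> unit_sphere (Suc n) \<Longrightarrow> F x \<in> coord_space (Suc n) \<and> F x \<noteq> zvec"
    and up: "\<And>x. x \<in> unit_sphere (Suc n) \<Longrightarrow> 0 \<le> x n \<Longrightarrow> 0 \<le> F x n"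
    and low: "\<And>x. x \<in> unit_sphere (Suc n) \<Longrightarrow> x n \<le> 0 \<Longrightarrow> F x n \<le> 0"
  shows "field_degree (Suc n) F = field_degree n F"
proof -
  obtain k where k: "n = Suc k" using n gr0_implies_Suc by blast
  have nsk: "nsphere n = top_of_set (unit_sphere (Suc n))" by (rule nsphere_unit_sphere)
  have ns: "nsphere k = top_of_set (unit_sphere n)"
    using k nsphere_unit_sphere[of k] by simp
  have "field_degree (Suc n) F = Brouwer_degree2 (Suc k) (\<lambda>x. normalize_vec (Suc n) (F x))"
    by (simp add: field_degree_def k)
  also have "\<dots> = Brouwer_degree2 k (\<lambda>x. normalize_vec (Suc n) (F x))"
  proof (rule Brouwer_degree2_suspension; (unfold k[symmetric] nsk)?)
    show "continuous_map (top_of_set (unit_sphere (Suc n))) (top_of_set (unit_sphere (Suc n)))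
            (\<lambda>x. normalize_vec (Suc n) (F x))"
      using F by (auto simp: continuous_map_in_subtopology intro!: continuous_on_normalize_vec normalize_vec_unit_sphere)
  qed (use up low in \<open>auto simp: normalize_vec_def zero_le_divide_iff divide_le_0_iff\<close>)
  also have "\<dots> = Brouwer_degree2 k (\<lambda>x. normalize_vec n (F x))"
  proof (rule Brouwer_degree2_eq)
    fix x assume "x \<in> topspace (nsphere k)"
    then have x: "x \<in> unit_sphere n" by (simp add: ns)
    have xS: "x \<in> unit_sphere (Suc n)" and xn: "x n = 0"
      using x by (auto simp: unit_sphere_iff coord_space_def enorm_def L2_set_def)
    have "F x n = 0" using up[OF xS] low[OF xS] xn by force
    then show "normalize_vec (Suc n) (F x) = normalize_vec n (F x)"
      by (simp add: normalize_vec_def enorm_def L2_set_def)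
  qed
  finally show ?thesis by (simp add: field_degree_def k)
qed

section \<open>Joining and splitting vectors\<close>

definition take_vec :: "nat \<Rightarrow> (nat \<Rightarrow> real) \<Rightarrow> nat \<Rightarrow> real" where
  "take_vec n x = (\<lambda>i. if i < n then x i else 0)"

definition drop_vec :: "nat \<Rightarrow> (nat \<Rightarrow> real) \<Rightarrow> nat \<Rightarrow> real" where
  "drop_vec n x = (\<lambda>i. x (n + i))"

lemma continuous_on_join_coords:
  fixes f :: "'a::topological_space \<Rightarrow> nat \<Rightarrow> real"
  assumes "continuous_on S f" "continuous_on S g"
  shows "continuous_on S (\<lambda>z. join_coords n (f z) (g z))"
proof (rule continuous_on_vec)
  fix i show "continuous_on S (\<lambda>z. join_coords n (f z) (g z) i)"
    using continuous_on_coord[OF assms(1), of i] continuous_on_coord[OF assms(2), of "i - n"]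
    by (cases "i < n") (simp_all add: join_coords_def)
qed

lemma continuous_on_take_vec:
  fixes f :: "'a::topological_space \<Rightarrow> nat \<Rightarrow> real"
  assumes "continuous_on S f" shows "continuous_on S (\<lambda>z. take_vec n (f z))"
proof (rule continuous_on_vec)
  fix i show "continuous_on S (\<lambda>z. take_vec n (f z) i)"
    using continuous_on_coord[OF assms(1), of i] by (cases "i < n") (simp_all add: take_vec_def)
qed

lemma continuous_on_drop_vec:
  fixes f :: "'a::topological_space \<Rightarrow> nat \<Rightarrow> real"
  assumes "continuous_on S f" shows "continuous_on S (\<lambda>z. drop_vec n (f z))"
  by (rule continuous_on_vec) (simp add: drop_vec_def continuous_on_coord[OF assms(1)])

lemma take_vec_coord_space [simp]: "take_vec n x \<in> coord_space n"
  by (simp add: take_vec_def coord_space_def)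

lemma drop_vec_coord_space: "x \<in> coord_space (n + k) \<Longrightarrow> drop_vec n x \<in> coord_space k"
  by (simp add: drop_vec_def coord_space_def)

lemma join_coords_coord_space: "y \<in> coord_space k \<Longrightarrow> join_coords n x y \<in> coord_space (n + k)"
  by (auto simp: join_coords_def coord_space_def)

lemma join_coords_take_drop [simp]: "join_coords n (take_vec n x) (drop_vec n x) = x"
  by (auto simp: join_coords_def take_vec_def drop_vec_def)

lemma drop_join_coords [simp]: "drop_vec n (join_coords n x y) = y"
  by (auto simp: join_coords_def drop_vec_def)

lemma take_join_coords: "x \<in> coord_space n \<Longrightarrow> take_vec n (join_coords n x y) = x"
  by (auto simp: join_coords_def take_vec_def coord_space_def)

lemma join_coords_eq_zvec:
  assumes x: "x \<in> coord_space n"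
  shows "join_coords n x y = zvec \<longleftrightarrow> x = zvec \<and> y = zvec"
proof
  assume "join_coords n x y = zvec"
  then show "x = zvec \<and> y = zvec"
    using take_join_coords[OF x, of y] drop_join_coords[of n x y]
    by (auto simp: take_vec_def drop_vec_def)
qed (simp add: join_coords_def)

lemma join_coords_scale:
  "join_coords n (\<lambda>i. c * x i) (\<lambda>i. c * y i) = (\<lambda>i. c * join_coords n x y i)"
  by (auto simp: join_coords_def)

lemma enorm_join_coords: "(enorm (n + k) (join_coords n x y))\<^sup>2 = (enorm n x)\<^sup>2 + (enorm k y)\<^sup>2"
proof -
  have "{..<n + k} = {..<n} \<union> ((+) n) ` {..<k}"
  proof (intro equalityI subsetI)
    fix i assume "i \<in> {..<n + k}"
    then show "i \<in> {..<n} \<union> ((+) n) ` {..<k}"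
      by (cases "i < n") (auto intro!: image_eqI[of _ _ "i - n"])
  qed auto
  then have "(\<Sum>i<n + k. (join_coords n x y i)\<^sup>2)
      = (\<Sum>i<n. (join_coords n x y i)\<^sup>2) + (\<Sum>i\<in>((+) n) ` {..<k}. (join_coords n x y i)\<^sup>2)"
    by (simp only:) (rule sum.union_disjoint, auto)
  also have "\<dots> = (\<Sum>i<n. (x i)\<^sup>2) + (\<Sum>i<k. (y i)\<^sup>2)"
    by (subst sum.reindex) (auto simp: join_coords_def)
  finally show ?thesis by (simp add: enorm_square)
qed

lemma enorm_join_coords_le: "enorm (n + k) (join_coords n x y) \<le> enorm n x + enorm k y"
  by (rule power2_le_imp_le) (simp_all add: enorm_join_coords power2_sum)

section \<open>Essential fields\<close>

text \<open>
  This stands for \<open>deg(G, D, 0) \<noteq> 0\<close> with any bounded \<open>D\<close> that contains all zeros of \<open>G\<close>. Quantifying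
  over large spheres leaves no domain to keep track of when fields are suspended, joined or composed.
\<close>

definition essential :: "nat \<Rightarrow> ((nat \<Rightarrow> real) \<Rightarrow> nat \<Rightarrow> real) \<Rightarrow> bool" where
  "essential n G \<longleftrightarrow> 0 < n \<and> continuous_on (coord_space n) G \<and> G ` coord_space n \<subseteq> coord_space n \<and>
     (\<exists>R>0. (\<forall>x\<in>coord_space n. G x = zvec \<longrightarrow> enorm n x < R) \<and>
        field_degree n (\<lambda>x. G (\<lambda>i. R * x i)) \<noteq> 0)"

text \<open>
  On a sphere beyond \<open>R\<close> and beyond the zeros of \<open>H 0\<close> all fields of the family are without zeros;
  enlarging the radius does not change the degree of \<open>H 0\<close>.
\<close>

lemma essential_homotopy:
  assumes ess: "essential n (H 0)"
    and cont: "continuous_on ({0..1::real} \<times> coord_space n) (\<lambda>(t, x). H t x)"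
    and H: "\<And>t x. 0 \<le> t \<Longrightarrow> t \<le> 1 \<Longrightarrow> x \<in> coord_space n \<Longrightarrow> H t x \<in> coord_space n"
    and bd: "\<And>t x. 0 \<le> t \<Longrightarrow> t \<le> 1 \<Longrightarrow> x \<in> coord_space n \<Longrightarrow> H t x = zvec \<Longrightarrow> enorm n x \<le> R"
  shows "essential n (H 1)"
proof -
  from ess obtain R0 where n: "0 < n" and R0: "R0 > 0"
    "\<forall>x\<in>coord_space n. H 0 x = zvec \<longrightarrow> enorm n x < R0"
    "field_degree n (\<lambda>x. H 0 (\<lambda>i. R0 * x i)) \<noteq> 0"
    by (auto simp: essential_def)
  define R1 where "R1 = max R0 R + 1"
  have R1: "R1 > 0" "R1 > R" "R1 \<ge> R0" using R0 by (auto simp: R1_def)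
  have cs: "(\<lambda>i. c * x i) \<in> coord_space n" if "x \<in> unit_sphere n" for c x
    using that by (auto simp: unit_sphere_iff coord_space_scale)
  have comp: "continuous_on ({0..1::real} \<times> unit_sphere n) (\<lambda>(t, x). H (\<alpha> t) (\<lambda>i. \<beta> t * x i))"
    if "continuous_on {0..1} \<alpha>" "continuous_on {0..1} \<beta>" "\<alpha> ` {0..1} \<subseteq> {0..1}" for \<alpha> \<beta> :: "real \<Rightarrow> real"
  proof -
    have "continuous_on ({0..1::real} \<times> unit_sphere n) (\<lambda>z. (\<alpha> (fst z), \<lambda>i. \<beta> (fst z) * snd z i))"
      by (rule continuous_on_Pair[OF continuous_on_compose2[OF that(1)]
            continuous_on_scale_vec[OF continuous_on_compose2[OF that(2)]]];
          (rule continuous_on_fst continuous_on_snd continuous_on_id)?) auto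
    moreover have "(\<lambda>z. (\<alpha> (fst z), \<lambda>i. \<beta> (fst z) * snd z i)) ` ({0..1} \<times> unit_sphere n) \<subseteq> {0..1} \<times> coord_space n"
    proof (rule image_subsetI)
      fix z assume "z \<in> {0..1::real} \<times> unit_sphere n"
      then have "fst z \<in> {0..1}" "snd z \<in> unit_sphere n" by auto
      then show "(\<alpha> (fst z), \<lambda>i. \<beta> (fst z) * snd z i) \<in> {0..1} \<times> coord_space n"
        using that(3) cs[of "snd z" "\<beta> (fst z)"] by blast
    qed
    ultimately have "continuous_on ({0..1::real} \<times> unit_sphere n)
        (\<lambda>z. (\<lambda>(t, x). H t x) (\<alpha> (fst z), \<lambda>i. \<beta> (fst z) * snd z i))"
      by (rule continuous_on_compose2[OF cont])
    then show ?thesis by (simp add: case_prod_unfold)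
  qed
  have "field_degree n (\<lambda>x. H 0 (\<lambda>i. ((1 - 0) * R0 + 0 * R1) * x i))
      = field_degree n (\<lambda>x. H 0 (\<lambda>i. ((1 - 1) * R0 + 1 * R1) * x i))"
  proof (rule field_degree_homotopy[OF n, where H = "\<lambda>t x. H 0 (\<lambda>i. ((1 - t) * R0 + t * R1) * x i)"])
    show "continuous_on ({0..1} \<times> unit_sphere n) (\<lambda>(t, x). H 0 (\<lambda>i. ((1 - t) * R0 + t * R1) * x i))"
      by (rule comp[of "\<lambda>_. 0" "\<lambda>t. (1 - t) * R0 + t * R1"])
         (auto simp: continuous_on_add continuous_on_mult continuous_on_diff continuous_on_id)
    fix t :: real and x assume t: "0 \<le> t" "t \<le> 1" and x: "x \<in> unit_sphere n"
    have "R0 + t * (R1 - R0) \<ge> R0" using t R1 by simp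
    then have "(1 - t) * R0 + t * R1 \<ge> R0" by (simp add: algebra_simps)
    then have "enorm n (\<lambda>i. ((1 - t) * R0 + t * R1) * x i) \<ge> R0"
      using x by (auto simp: enorm_scale unit_sphere_iff)
    then show "H 0 (\<lambda>i. ((1 - t) * R0 + t * R1) * x i) \<in> coord_space n
       \<and> H 0 (\<lambda>i. ((1 - t) * R0 + t * R1) * x i) \<noteq> zvec"
      using H[OF _ _ cs[OF x], of 0] R0(2) cs[OF x] by force
  qed
  moreover have "field_degree n (\<lambda>x. H 0 (\<lambda>i. R1 * x i)) = field_degree n (\<lambda>x. H 1 (\<lambda>i. R1 * x i))"
  proof (rule field_degree_homotopy[OF n, where H = "\<lambda>t x. H t (\<lambda>i. R1 * x i)"])
    show "continuous_on ({0..1} \<times> unit_sphere n) (\<lambda>(t, x). H t (\<lambda>i. R1 * x i))"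
      by (rule comp[of "\<lambda>t. t" "\<lambda>_. R1"]) (simp_all add: continuous_on_id)
    fix t :: real and x assume t: "0 \<le> t" "t \<le> 1" and x: "x \<in> unit_sphere n"
    have "enorm n (\<lambda>i. R1 * x i) = R1"
      using x R1 by (auto simp: enorm_scale unit_sphere_iff)
    then show "H t (\<lambda>i. R1 * x i) \<in> coord_space n \<and> H t (\<lambda>i. R1 * x i) \<noteq> zvec"
      using H[OF t cs[OF x]] bd[OF t cs[OF x]] R1 by force
  qed
  ultimately have "field_degree n (\<lambda>x. H 1 (\<lambda>i. R1 * x i)) \<noteq> 0"
    using R0 by simp
  moreover have "continuous_on (coord_space n) (H 1)"
  proof -
    have "Pair 1 ` coord_space n \<subseteq> {0..1::real} \<times> coord_space n" by auto
    from continuous_on_compose2[OF cont continuous_on_Pair[OF continuous_on_const continuous_on_id] this]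
    show ?thesis by simp
  qed
  moreover have "\<forall>x\<in>coord_space n. H 1 x = zvec \<longrightarrow> enorm n x < R1"
    using bd[of 1] R1 by force
  ultimately show ?thesis
    using n R1 H[of 1] by (auto simp: essential_def)
qed

lemma essential_id: "0 < n \<Longrightarrow> essential n (\<lambda>x. x)"
proof -
  assume n: "0 < n"
  then have "field_degree n (\<lambda>x i. 1 * x i) = 1" by (simp add: field_degree_id)
  then show ?thesis using n unfolding essential_def
    by (intro conjI exI[of _ 1]) auto
qed

text \<open>
  Without zeros, shrinking the radius to \<open>0\<close> deforms the field to a constant.
\<close>

lemma essential_has_zero:
  assumes "essential n G" shows "\<exists>x\<in>coord_space n. G x = zvec"
proof (rule ccontr)
  assume nz: "\<not> ?thesis"
  from assms obtain R where n: "0 < n" and G: "continuous_on (coord_space n) G" "G ` coord_space n \<subseteq> coord_space n"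
    and R: "field_degree n (\<lambda>x. G (\<lambda>i. R * x i)) \<noteq> 0"
    by (auto simp: essential_def)
  have cs: "(\<lambda>i. c * x i) \<in> coord_space n" if "x \<in> unit_sphere n" for c x
    using that by (auto simp: unit_sphere_iff coord_space_scale)
  have "field_degree n (\<lambda>x. G (\<lambda>i. (0 * R) * x i)) = field_degree n (\<lambda>x. G (\<lambda>i. (1 * R) * x i))"
  proof (rule field_degree_homotopy[OF n, where H = "\<lambda>t x. G (\<lambda>i. (t * R) * x i)"])
    have "continuous_on ({0..1::real} \<times> unit_sphere n) (\<lambda>z i. (fst z * R) * snd z i)"
      by (rule continuous_on_scale_vec[OF continuous_on_mult continuous_on_snd[OF continuous_on_id]])
         (simp_all add: continuous_on_fst continuous_on_id)
    moreover have "(\<lambda>z i. (fst z * R) * snd z i) ` ({0..1::real} \<times> unit_sphere n) \<subseteq> coord_space n"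
      using cs by (intro image_subsetI) auto
    ultimately have "continuous_on ({0..1::real} \<times> unit_sphere n) (\<lambda>z. G (\<lambda>i. (fst z * R) * snd z i))"
      by (rule continuous_on_compose2[OF G(1)])
    then show "continuous_on ({0..1} \<times> unit_sphere n) (\<lambda>(t, x). G (\<lambda>i. t * R * x i))"
      by (simp add: case_prod_unfold)
  qed (use G cs nz in blast)
  then show False using R field_degree_const[of n "G zvec"] by simp
qed

text \<open>
  One coordinate at a time: the new last coordinate is left alone, so each hemisphere is preserved.
\<close>

lemma essential_suspension:
  assumes "essential n G"
  shows "essential (n + k) (\<lambda>x. join_coords n (G (take_vec n x)) (drop_vec n x))"
proof -
  let ?S = "\<lambda>x. join_coords n (G (take_vec n x)) (drop_vec n x)"
  from assms obtain R where n: "0 < n" and R: "R > 0"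
    "\<forall>x\<in>coord_space n. G x = zvec \<longrightarrow> enorm n x < R"
    "field_degree n (\<lambda>x. G (\<lambda>i. R * x i)) \<noteq> 0"
    and G: "continuous_on (coord_space n) G" "G ` coord_space n \<subseteq> coord_space n"
    by (auto simp: essential_def)
  have range: "?S x \<in> coord_space (n + k)" if "x \<in> coord_space (n + k)" for x k
    using that by (intro join_coords_coord_space drop_vec_coord_space)
  have cont: "continuous_on A ?S" for A
    by (rule continuous_on_join_coords[OF continuous_on_compose2[OF G(1) continuous_on_take_vec]
        continuous_on_drop_vec]) (auto intro: continuous_on_id)
  have bd: "enorm (n + k) x < R" if "x \<in> coord_space (n + k)" "?S x = zvec" for x k
  proof -
    have "G (take_vec n x) = zvec" "drop_vec n x = zvec"
      using that G(2) join_coords_eq_zvec[of "G (take_vec n x)" n "drop_vec n x"]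
      by (auto simp: image_subset_iff)
    then have "enorm n (take_vec n x) < R" using R by simp
    moreover have "enorm (n + k) x \<le> enorm n (take_vec n x) + enorm k (drop_vec n x)"
      using enorm_join_coords_le[of n k "take_vec n x" "drop_vec n x"] by simp
    ultimately show ?thesis using \<open>drop_vec n x = zvec\<close> by simp
  qed
  have "field_degree (n + k) (\<lambda>x. ?S (\<lambda>i. R * x i)) \<noteq> 0"
  proof (induction k)
    case 0
    have "field_degree (n + 0) (\<lambda>x. ?S (\<lambda>i. R * x i)) = field_degree n (\<lambda>x. G (\<lambda>i. R * x i))"
      unfolding add_0_right
    proof (rule field_degree_cong[OF n])
      fix x assume "x \<in> unit_sphere n"
      then have x: "(\<lambda>i. R * x i) \<in> coord_space n" by (simp add: coord_space_scale unit_sphere_iff)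
      have "take_vec n (\<lambda>i. R * x i) = (\<lambda>i. R * x i)" "drop_vec n (\<lambda>i. R * x i) = zvec"
        using x by (auto simp: take_vec_def drop_vec_def coord_space_def fun_eq_iff)
      moreover have "join_coords n (G (\<lambda>i. R * x i)) zvec = G (\<lambda>i. R * x i)"
        using G x by (auto simp: join_coords_def coord_space_def fun_eq_iff image_subset_iff)
      ultimately show "normalize_vec n (?S (\<lambda>i. R * x i)) = normalize_vec n (G (\<lambda>i. R * x i))" by simp
    qed
    then show ?case using R by simp
  next
    case (Suc k)
    have "field_degree (Suc (n + k)) (\<lambda>x. ?S (\<lambda>i. R * x i)) = field_degree (n + k) (\<lambda>x. ?S (\<lambda>i. R * x i))"
    proof (rule field_degree_suspension)
      show "0 < n + k" using n by simp
      show "continuous_on (unit_sphere (Suc (n + k))) (\<lambda>x. ?S (\<lambda>i. R * x i))"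
        by (rule continuous_on_compose2[OF cont[of UNIV] continuous_on_scale_vec[OF continuous_on_const continuous_on_id]]) auto
    next
      fix x assume x: "x \<in> unit_sphere (Suc (n + k))"
      then have x': "(\<lambda>i. R * x i) \<in> coord_space (n + Suc k)" by (simp add: coord_space_scale unit_sphere_iff)
      have "enorm (n + Suc k) (\<lambda>i. R * x i) = R"
        using x R by (simp add: enorm_scale unit_sphere_iff)
      then show "?S (\<lambda>i. R * x i) \<in> coord_space (Suc (n + k)) \<and> ?S (\<lambda>i. R * x i) \<noteq> zvec"
        using range[OF x'] bd[OF x'] by auto
    qed (use R in \<open>auto simp: join_coords_def drop_vec_def mult_le_0_iff\<close>)
    then show ?case using Suc by simp
  qed
  then show ?thesis
    unfolding essential_def using n cont range[of _ k] bd[of _ k] R(1) by auto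
qed

lemma essential_homogeneous_iff:
  assumes n: "0 < n" and B: "continuous_on (coord_space n) B" "B ` coord_space n \<subseteq> coord_space n"
    and nz: "\<And>x. x \<in> coord_space n \<Longrightarrow> B x = zvec \<Longrightarrow> x = zvec"
    and hom: "\<And>c x. 0 < c \<Longrightarrow> x \<in> coord_space n \<Longrightarrow> B (\<lambda>i. c * x i) = (\<lambda>i. c * B x i)"
  shows "essential n B \<longleftrightarrow> field_degree n B \<noteq> 0"
proof -
  have "field_degree n (\<lambda>x. B (\<lambda>i. R * x i)) = field_degree n B" if "R > 0" for R
    using that by (intro field_degree_cong n) (simp add: hom normalize_vec_scale unit_sphere_iff)
  moreover have "\<forall>x\<in>coord_space n. B x = zvec \<longrightarrow> enorm n x < 1"
    using nz enorm_zvec[of n] zero_less_one by metis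
  ultimately show ?thesis
    using n B unfolding essential_def by (metis zero_less_one)
qed

lemma essential_compose_homogeneous:
  assumes G: "essential n G" and ess: "essential n B"
    and nz: "\<And>x. x \<in> coord_space n \<Longrightarrow> B x = zvec \<Longrightarrow> x = zvec"
    and hom: "\<And>c x. 0 < c \<Longrightarrow> x \<in> coord_space n \<Longrightarrow> B (\<lambda>i. c * x i) = (\<lambda>i. c * B x i)"
  shows "essential n (\<lambda>x. B (G x))"
proof -
  from G obtain R where n: "0 < n" and R: "R > 0"
    "\<forall>x\<in>coord_space n. G x = zvec \<longrightarrow> enorm n x < R"
    "field_degree n (\<lambda>x. G (\<lambda>i. R * x i)) \<noteq> 0"
    and G: "continuous_on (coord_space n) G" "G ` coord_space n \<subseteq> coord_space n"
    by (auto simp: essential_def)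
  from ess have B: "continuous_on (coord_space n) B" "B ` coord_space n \<subseteq> coord_space n"
    by (auto simp: essential_def)
  have dB: "field_degree n B \<noteq> 0"
    using essential_homogeneous_iff[OF n B nz hom] ess by simp
  have sub: "unit_sphere n \<subseteq> coord_space n" by (auto simp: unit_sphere_iff)
  have F: "continuous_on (unit_sphere n) (\<lambda>x. G (\<lambda>i. R * x i))"
    by (rule continuous_on_compose2[OF G(1)])
       (auto simp: coord_space_scale unit_sphere_iff intro!: continuous_on_scale_vec[OF continuous_on_const continuous_on_id])
  have F2: "G (\<lambda>i. R * x i) \<in> coord_space n \<and> G (\<lambda>i. R * x i) \<noteq> zvec" if "x \<in> unit_sphere n" for x
  proof -
    have "(\<lambda>i. R * x i) \<in> coord_space n" "enorm n (\<lambda>i. R * x i) = R"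
      using that R by (auto simp: coord_space_scale enorm_scale unit_sphere_iff)
    then show ?thesis using R G by auto
  qed
  have B2: "B x \<in> coord_space n \<and> B x \<noteq> zvec" if "x \<in> unit_sphere n" for x
    using that B nz sub unit_sphere_nonzero by blast
  have "field_degree n (\<lambda>x. B (G (\<lambda>i. R * x i)))
      = field_degree n B * field_degree n (\<lambda>x. G (\<lambda>i. R * x i))"
    by (rule field_degree_compose[OF n F F2 continuous_on_subset[OF B(1) sub] B2 hom])
  then have "field_degree n (\<lambda>x. B (G (\<lambda>i. R * x i))) \<noteq> 0"
    using dB R(3) by simp
  moreover have "\<forall>x\<in>coord_space n. B (G x) = zvec \<longrightarrow> enorm n x < R"
  proof (intro ballI impI)
    fix x assume "x \<in> coord_space n" "B (G x) = zvec"
    then show "enorm n x < R" using nz[of "G x"] G(2) R(2) by auto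
  qed
  moreover have "continuous_on (coord_space n) (\<lambda>x. B (G x))"
    by (rule continuous_on_compose2[OF B(1) G(1)]) (use G in auto)
  ultimately show ?thesis
    using n R(1) G(2) B(2) unfolding essential_def by (intro conjI exI[of _ R]) auto
qed

text \<open>
  The inverse is a rotation of the same kind, and the two degrees multiply to the degree of the
  identity.
\<close>

lemma essential_rotation:
  assumes n: "0 < n + k"
  shows "essential (n + k) (\<lambda>x. join_coords k (drop_vec n x) (take_vec n x))"
proof -
  let ?C = "\<lambda>n k x. join_coords k (drop_vec n x) (take_vec n x)"
  have cont: "continuous_on A (?C n k)" for A n k
    by (rule continuous_on_join_coords[OF continuous_on_drop_vec[OF continuous_on_id] continuous_on_take_vec[OF continuous_on_id]])
  have range: "?C n k x \<in> coord_space (n + k)" for x n k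
    using join_coords_coord_space[of "take_vec n x" n k] by (simp add: add.commute)
  have inv: "?C k n (?C n k x) = x" if "x \<in> coord_space (n + k)" for x n k
    using that by (simp add: take_join_coords drop_vec_coord_space)
  have nz: "x = zvec" if "x \<in> coord_space (n + k)" "?C n k x = zvec" for x n k
  proof -
    have "x = ?C k n zvec" using inv[OF that(1)] by (simp only: that(2))
    also have "\<dots> = zvec" by (simp add: join_coords_def take_vec_def drop_vec_def)
    finally show ?thesis .
  qed
  have hom: "?C n k (\<lambda>i. c * x i) = (\<lambda>i. c * ?C n k x i)" for n k c x
    by (auto simp: join_coords_def take_vec_def drop_vec_def)
  have sub: "unit_sphere (n + k) \<subseteq> coord_space (n + k)" by (auto simp: unit_sphere_iff)
  have "field_degree (n + k) (\<lambda>x. ?C k n (?C n k x)) = field_degree (n + k) (?C k n) * field_degree (n + k) (?C n k)"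
  proof (rule field_degree_compose[OF n cont])
    fix x assume "x \<in> unit_sphere (n + k)"
    then have x: "x \<in> coord_space (n + k)" "x \<noteq> zvec" using sub unit_sphere_nonzero by auto
    show "?C n k x \<in> coord_space (n + k) \<and> ?C n k x \<noteq> zvec" using range nz x by blast
    show "?C k n x \<in> coord_space (n + k) \<and> ?C k n x \<noteq> zvec"
      using range[where x = x and n = k and k = n] nz[where x = x and n = k and k = n] x unfolding add.commute[of k n] by blast
  qed (rule cont, rule hom)
  moreover have "field_degree (n + k) (\<lambda>x. ?C k n (?C n k x)) = field_degree (n + k) (\<lambda>x. x)"
    by (rule field_degree_cong[OF n]) (use inv sub in auto)
  ultimately have "field_degree (n + k) (?C n k) \<noteq> 0"
    using field_degree_id[OF n] by auto
  moreover have "essential (n + k) (?C n k) \<longleftrightarrow> field_degree (n + k) (?C n k) \<noteq> 0"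
    by (rule essential_homogeneous_iff[OF n cont]) (use range nz hom in auto)
  ultimately show ?thesis by simp
qed

section \<open>Retraction to the ball and homogeneous extension\<close>

definition ball_retract :: "nat \<Rightarrow> (nat \<Rightarrow> real) \<Rightarrow> nat \<Rightarrow> real" where
  "ball_retract n x = (\<lambda>i. inverse (max 1 (enorm n x)) * x i)"

lemma continuous_on_ball_retract:
  fixes f :: "'a::topological_space \<Rightarrow> nat \<Rightarrow> real"
  assumes "continuous_on S f" shows "continuous_on S (\<lambda>z. ball_retract n (f z))"
  unfolding ball_retract_def
  by (rule continuous_on_scale_vec[OF continuous_on_inverse[OF continuous_on_max[OF continuous_on_const continuous_on_enorm[OF assms]]] assms])
     (auto simp: max_def)

lemma enorm_ball_retract: "enorm n (ball_retract n x) = min 1 (enorm n x)"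
  by (auto simp: ball_retract_def enorm_scale max_def min_def)

lemma ball_retract_unit_ball: "x \<in> coord_space n \<Longrightarrow> ball_retract n x \<in> unit_ball n"
  by (simp add: unit_ball_iff enorm_ball_retract) (simp add: ball_retract_def coord_space_scale)

lemma ball_retract_unit_sphere: "x \<in> coord_space n \<Longrightarrow> 1 \<le> enorm n x \<Longrightarrow> ball_retract n x \<in> unit_sphere n"
  by (simp add: unit_sphere_iff enorm_ball_retract) (simp add: ball_retract_def coord_space_scale)

lemma ball_retract_id: "enorm n x \<le> 1 \<Longrightarrow> ball_retract n x = x"
  by (simp add: ball_retract_def max_def)

lemma ball_retract_zvec [simp]: "ball_retract n zvec = zvec"
  by (simp add: ball_retract_def)

text \<open>
  The bound takes care of the origin, where radially defined functions are given by a quotient with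
  denominator \<open>0\<close>.
\<close>

lemma continuous_on_zero_extension:
  fixes f :: "(nat \<Rightarrow> real) \<Rightarrow> real"
  assumes c: "continuous_on (coord_space n - {zvec}) f"
    and bound: "\<And>x. x \<in> coord_space n \<Longrightarrow> \<bar>f x\<bar> \<le> enorm n x"
  shows "continuous_on (coord_space n) f"
  unfolding continuous_on_eq_continuous_within
proof
  fix x assume x: "x \<in> coord_space n"
  show "continuous (at x within coord_space n) f"
  proof (cases "x = zvec")
    case False
    have "at x within coord_space n = at x within (coord_space n - {zvec})"
      by (rule at_within_nhd[of x "- {zvec}"]) (use False in auto)
    then show ?thesis
      using c x False by (simp add: continuous_on_eq_continuous_within)
  next
    case True
    have "filterlim (enorm n) (nhds 0) (at zvec within coord_space n)"
      using continuous_on_enorm[OF continuous_on_id, of "coord_space n" n]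
      by (simp add: continuous_on_def) (metis enorm_zvec zvec_in_coord_space)
    then have "filterlim f (nhds 0) (at zvec within coord_space n)"
      by (rule Lim_null_comparison[rotated])
         (use bound in \<open>auto simp: eventually_at_topological intro!: exI[of _ UNIV]\<close>)
    moreover have "f zvec = 0" using bound[of zvec] by simp
    ultimately show ?thesis using True by (simp add: continuous_within)
  qed
qed

text \<open>
  The radial extension of the direction of \<open>A\<close> on the sphere; it makes \<open>A\<close> a possible outer factor of
  \<open>essential_compose_homogeneous\<close>.
\<close>

definition homogeneous_ext :: "nat \<Rightarrow> ((nat \<Rightarrow> real) \<Rightarrow> nat \<Rightarrow> real) \<Rightarrow> (nat \<Rightarrow> real) \<Rightarrow> nat \<Rightarrow> real" where
  "homogeneous_ext n A x =
     (if x = zvec then zvec else (\<lambda>i. enorm n x * normalize_vec n (A (normalize_vec n x)) i))"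

lemma homogeneous_ext_range:
  assumes A: "\<And>x. x \<in> unit_sphere n \<Longrightarrow> A x \<in> coord_space n \<and> A x \<noteq> zvec" and x: "x \<in> coord_space n"
  shows "homogeneous_ext n A x \<in> coord_space n" "enorm n (homogeneous_ext n A x) = enorm n x"
proof -
  have *: "normalize_vec n (A (normalize_vec n x)) \<in> unit_sphere n" if "x \<noteq> zvec"
    using normalize_vec_unit_sphere A normalize_vec_unit_sphere[OF x that] by blast
  show "homogeneous_ext n A x \<in> coord_space n"
    using * by (auto simp: homogeneous_ext_def unit_sphere_iff coord_space_scale)
  show "enorm n (homogeneous_ext n A x) = enorm n x"
    using * by (auto simp: homogeneous_ext_def unit_sphere_iff enorm_scale)
qed

lemma continuous_on_homogeneous_ext:
  assumes cA: "continuous_on (unit_sphere n) A"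
    and A: "\<And>x. x \<in> unit_sphere n \<Longrightarrow> A x \<in> coord_space n \<and> A x \<noteq> zvec"
  shows "continuous_on (coord_space n) (homogeneous_ext n A)"
proof (rule continuous_on_vec, rule continuous_on_zero_extension)
  fix i
  have 1: "continuous_on (coord_space n - {zvec}) (normalize_vec n)"
    by (rule continuous_on_normalize_vec[OF continuous_on_id]) auto
  have 2: "continuous_on (coord_space n - {zvec}) (\<lambda>x. A (normalize_vec n x))"
    by (rule continuous_on_compose2[OF cA 1]) (auto intro: normalize_vec_unit_sphere)
  have 3: "continuous_on (coord_space n - {zvec}) (\<lambda>x. normalize_vec n (A (normalize_vec n x)))"
    by (rule continuous_on_normalize_vec[OF 2]) (use A normalize_vec_unit_sphere in auto)
  have "continuous_on (coord_space n - {zvec}) (\<lambda>x. enorm n x * normalize_vec n (A (normalize_vec n x)) i)"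
    by (intro continuous_on_mult continuous_on_enorm[OF continuous_on_id] continuous_on_coord[OF 3])
  then show "continuous_on (coord_space n - {zvec}) (\<lambda>x. homogeneous_ext n A x i)"
    by (rule continuous_on_eq) (auto simp: homogeneous_ext_def)
  fix x assume "x \<in> coord_space n"
  then show "\<bar>homogeneous_ext n A x i\<bar> \<le> enorm n x"
    using coord_le_enorm[OF homogeneous_ext_range(1)[where A = A, OF A]]
      homogeneous_ext_range(2)[where A = A, OF A] by auto
qed

lemma homogeneous_ext_homogeneous:
  assumes "0 < c" shows "homogeneous_ext n A (\<lambda>i. c * x i) = (\<lambda>i. c * homogeneous_ext n A x i)"
proof -
  have "(\<lambda>i. c * x i) = zvec \<longleftrightarrow> x = zvec" using assms by (auto simp: fun_eq_iff)
  then show ?thesis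
    using assms by (simp add: homogeneous_ext_def normalize_vec_scale enorm_scale mult.assoc)
qed

lemma essential_homogeneous_ext:
  assumes n: "0 < n" and cA: "continuous_on (unit_sphere n) A"
    and A: "\<And>x. x \<in> unit_sphere n \<Longrightarrow> A x \<in> coord_space n \<and> A x \<noteq> zvec"
    and deg: "field_degree n A \<noteq> 0"
  shows "essential n (homogeneous_ext n A)"
proof -
  have "field_degree n (homogeneous_ext n A) = field_degree n A"
  proof (rule field_degree_cong[OF n])
    fix x assume x: "x \<in> unit_sphere n"
    then have "normalize_vec n x = x" "enorm n x = 1" "x \<noteq> zvec"
      using unit_sphere_nonzero by (auto simp: unit_sphere_iff normalize_vec_def)
    then have "homogeneous_ext n A x = normalize_vec n (A x)"
      by (simp add: homogeneous_ext_def)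
    moreover have "enorm n (normalize_vec n (A x)) = 1"
      using normalize_vec_unit_sphere A[OF x] by (auto simp: unit_sphere_iff)
    ultimately show "normalize_vec n (homogeneous_ext n A x) = normalize_vec n (A x)"
      by (simp add: normalize_vec_def)
  qed
  moreover have "essential n (homogeneous_ext n A) \<longleftrightarrow> field_degree n (homogeneous_ext n A) \<noteq> 0"
  proof (rule essential_homogeneous_iff[OF n continuous_on_homogeneous_ext[OF cA A]])
    show "x = zvec" if "x \<in> coord_space n" "homogeneous_ext n A x = zvec" for x
      using homogeneous_ext_range(2)[where A = A, OF A that(1)] that enorm_eq_0[of x n] by simp
  qed (use homogeneous_ext_range(1)[where A = A, OF A] homogeneous_ext_homogeneous in auto)
  ultimately show ?thesis using deg by simp
qed

lemma join_coords_assoc: "join_coords (m + n) (join_coords m x y) z = join_coords m x (join_coords n y z)"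
  by (auto simp: join_coords_def fun_eq_iff)

lemma join_coords_0 [simp]: "join_coords 0 x y = y"
  by (simp add: join_coords_def)

text \<open>
  For \<open>u = 0\<close> the block of \<open>A\<close> is empty and the map is the identity, so no
  degree of \<open>A\<close> is asked for.
\<close>

lemma essential_block_compose:
  assumes G: "essential (u + e) G" and cA: "continuous_on (unit_sphere u) A"
    and A: "\<And>x. x \<in> unit_sphere u \<Longrightarrow> A x \<in> coord_space u \<and> A x \<noteq> zvec"
    and deg: "u = 0 \<or> field_degree u A \<noteq> 0"
  shows "essential (u + e) (\<lambda>x. join_coords u (homogeneous_ext u A (take_vec u (G x))) (drop_vec u (G x)))"
proof (cases "u = 0")
  case True
  then show ?thesis using G by (simp add: drop_vec_def)
next
  case False
  let ?B = "\<lambda>y. join_coords u (homogeneous_ext u A (take_vec u y)) (drop_vec u y)"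
  have "essential (u + e) ?B"
    by (rule essential_suspension[OF essential_homogeneous_ext[OF _ cA A]]) (use False deg in auto)
  moreover have "x = zvec" if "x \<in> coord_space (u + e)" "?B x = zvec" for x
  proof -
    have "homogeneous_ext u A (take_vec u x) = zvec" "drop_vec u x = zvec"
      using that(2) join_coords_eq_zvec[OF homogeneous_ext_range(1)[where A = A, OF A take_vec_coord_space]] by auto
    then have "take_vec u x = zvec"
      using homogeneous_ext_range(2)[where A = A, OF A take_vec_coord_space, of x] enorm_eq_0[OF take_vec_coord_space, of u x] by simp
    then have "join_coords u (take_vec u x) (drop_vec u x) = zvec"
      using \<open>drop_vec u x = zvec\<close> by (simp only:) (simp add: join_coords_def)
    then show ?thesis by simp
  qed
  moreover have "?B (\<lambda>i. c * x i) = (\<lambda>i. c * ?B x i)" if "0 < c" for c x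
  proof -
    have "take_vec u (\<lambda>i. c * x i) = (\<lambda>i. c * take_vec u x i)" "drop_vec u (\<lambda>i. c * x i) = (\<lambda>i. c * drop_vec u x i)"
      by (auto simp: take_vec_def drop_vec_def)
    then show ?thesis
      by (simp only: homogeneous_ext_homogeneous[OF that] join_coords_scale)
  qed
  ultimately show ?thesis by (rule essential_compose_homogeneous[OF G]) 
qed

lemma essential_cong:
  assumes F: "essential n F" and eq: "\<And>x. x \<in> coord_space n \<Longrightarrow> F x = G x"
  shows "essential n G"
proof -
  have "field_degree n (\<lambda>x. F (\<lambda>i. R * x i)) = field_degree n (\<lambda>x. G (\<lambda>i. R * x i))" if "0 < n" for R
    by (rule field_degree_cong[OF that]) (simp add: eq unit_sphere_iff coord_space_scale)
  moreover have "continuous_on (coord_space n) F = continuous_on (coord_space n) G"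
    using eq by (intro continuous_on_cong) auto
  moreover have "F ` coord_space n = G ` coord_space n"
    using eq by (intro image_cong) auto
  ultimately show ?thesis using F eq unfolding essential_def by auto
qed

lemma ball_degree_field_degree: "ball_degree n A = (if n = 0 then 1 else field_degree n A)"
  by (simp add: ball_degree_def field_degree_def normalize_vec_def)

section \<open>Chains of covering relations\<close>

text \<open>
  The chain so far, as equations \<open>E x = 0\<close> for an unknown \<open>x\<close> in \<open>u + e\<close> dimensions. The maps \<open>pp\<close> and
  \<open>qq\<close> read off the chart coordinates of the last point. A zero \<open>x\<close> of \<open>E\<close> with \<open>|pp x| \<le> 1\<close> is
  an actual chain, whose last point satisfies \<open>Q\<close>. The last clause says that the \<open>e\<close> equations
  together with the \<open>u\<close> further ones \<open>pp x = 0\<close> have nonzero degree.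
\<close>

definition crossing_system ::
  "nat \<Rightarrow> nat \<Rightarrow> ((nat \<Rightarrow> real) \<Rightarrow> (nat \<Rightarrow> real) \<Rightarrow> bool) \<Rightarrow> nat \<Rightarrow> real \<Rightarrow>
   ((nat \<Rightarrow> real) \<Rightarrow> nat \<Rightarrow> real) \<Rightarrow> ((nat \<Rightarrow> real) \<Rightarrow> nat \<Rightarrow> real) \<Rightarrow>
   ((nat \<Rightarrow> real) \<Rightarrow> nat \<Rightarrow> real) \<Rightarrow> bool" where
  "crossing_system u s Q e R E pp qq \<longleftrightarrow>
     continuous_on (coord_space (u + e)) pp \<and> pp ` coord_space (u + e) \<subseteq> coord_space u \<and>
     continuous_on (coord_space (u + e)) qq \<and> qq ` coord_space (u + e) \<subseteq> coord_space s \<and>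
     continuous_on (coord_space (u + e)) E \<and> E ` coord_space (u + e) \<subseteq> coord_space e \<and>
     (\<forall>x\<in>coord_space (u + e). E x = zvec \<and> enorm u (pp x) \<le> 1 \<longrightarrow>
        enorm (u + e) x \<le> R \<and> enorm s (qq x) \<le> 1 \<and> Q (pp x) (qq x)) \<and>
     essential (u + e) (\<lambda>x. join_coords u (pp x) (E x))"

definition reaches :: "nat \<Rightarrow> nat \<Rightarrow> ((nat \<Rightarrow> real) \<Rightarrow> (nat \<Rightarrow> real) \<Rightarrow> bool) \<Rightarrow> bool" where
  "reaches u s Q \<longleftrightarrow> (\<exists>e R E pp qq. crossing_system u s Q e R E pp qq)"

text \<open>
  The horizontal disk: the equation is \<open>q = 0\<close>. A dummy unknown with equation \<open>0\<close>, hence \<open>e = s + 1\<close>,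
  keeps the dimension positive when \<open>u = s = 0\<close>.
\<close>

lemma reaches_start:
  assumes "\<And>p. p \<in> unit_ball u \<Longrightarrow> Q p zvec"
  shows "reaches u s Q"
  unfolding reaches_def crossing_system_def
proof (intro exI conjI ballI impI)
  let ?e = "s + 1"
  show "continuous_on (coord_space (u + ?e)) (take_vec u)"
    by (rule continuous_on_take_vec[OF continuous_on_id])
  show "continuous_on (coord_space (u + ?e)) (\<lambda>x. take_vec s (drop_vec u x))"
    by (rule continuous_on_take_vec[OF continuous_on_drop_vec[OF continuous_on_id]])
  show "continuous_on (coord_space (u + ?e)) (drop_vec u)"
    by (rule continuous_on_drop_vec[OF continuous_on_id])
  show "essential (u + ?e) (\<lambda>x. join_coords u (take_vec u x) (drop_vec u x))"
    by (simp add: essential_id)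
  fix x assume x: "x \<in> coord_space (u + ?e)" "drop_vec u x = zvec \<and> enorm u (take_vec u x) \<le> 1"
  have "enorm (u + ?e) x \<le> enorm u (take_vec u x) + enorm ?e (drop_vec u x)"
    using enorm_join_coords_le[of u ?e "take_vec u x" "drop_vec u x"] by simp
  then show "enorm (u + ?e) x \<le> 1" using x by simp
  have z: "take_vec s (drop_vec u x) = zvec"
    using x by (simp add: take_vec_def)
  show "enorm s (take_vec s (drop_vec u x)) \<le> 1" by (simp only: z enorm_zvec)
  show "Q (take_vec u x) (take_vec s (drop_vec u x))"
    unfolding z using assms x by (simp add: unit_ball_iff)
qed (auto simp: drop_vec_coord_space)

text \<open>
  The equations \<open>pp x = 0\<close> may be exchanged for \<open>\<alpha> 1 (pp x) (qq x) = 0\<close>, since along the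
  family \<open>\<alpha>\<close> no zero crosses the sphere \<open>|pp x| = 1\<close>.
\<close>

lemma reaches_end:
  assumes "reaches u s Q"
    and cont: "continuous_on ({0..1::real} \<times> (unit_ball u \<times> unit_ball s)) (\<lambda>(t, p, q). \<alpha> t p q)"
    and \<alpha>: "\<And>t p q. 0 \<le> t \<Longrightarrow> t \<le> 1 \<Longrightarrow> p \<in> unit_ball u \<Longrightarrow> q \<in> unit_ball s \<Longrightarrow> \<alpha> t p q \<in> coord_space u"
    and \<alpha>0: "\<And>p q. p \<in> unit_ball u \<Longrightarrow> q \<in> unit_ball s \<Longrightarrow> \<alpha> 0 p q = p"
    and nz: "\<And>t p q. 0 \<le> t \<Longrightarrow> t \<le> 1 \<Longrightarrow> p \<in> unit_sphere u \<Longrightarrow> q \<in> unit_ball s \<Longrightarrow> \<alpha> t p q \<noteq> zvec"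
  shows "\<exists>p\<in>unit_ball u. \<exists>q\<in>unit_ball s. Q p q \<and> \<alpha> 1 p q = zvec"
proof -
  obtain e R E pp qq where sys: "crossing_system u s Q e R E pp qq"
    using assms(1) unfolding reaches_def by blast
  then have pp: "continuous_on (coord_space (u + e)) pp" "pp ` coord_space (u + e) \<subseteq> coord_space u"
    and qq: "continuous_on (coord_space (u + e)) qq" "qq ` coord_space (u + e) \<subseteq> coord_space s"
    and E: "continuous_on (coord_space (u + e)) E" "E ` coord_space (u + e) \<subseteq> coord_space e"
    and ess: "essential (u + e) (\<lambda>x. join_coords u (pp x) (E x))"
    by (simp_all add: crossing_system_def)
  have zero: "enorm (u + e) x \<le> R \<and> enorm s (qq x) \<le> 1 \<and> Q (pp x) (qq x)"
    if "x \<in> coord_space (u + e)" "E x = zvec" "enorm u (pp x) \<le> 1" for x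
    using sys that by (simp add: crossing_system_def)
  let ?n = "u + e"
  let ?r = "\<lambda>x. ball_retract u (pp x)" and ?q = "\<lambda>x. ball_retract s (qq x)"
  have rp: "?r x \<in> unit_ball u" "?q x \<in> unit_ball s" if "x \<in> coord_space ?n" for x
    using that pp qq by (auto intro: ball_retract_unit_ball)
  have scoord: "unit_ball k \<subseteq> coord_space k" for k by (auto simp: unit_ball_iff)
  have fs: "continuous_on ({0..1::real} \<times> coord_space ?n) fst"
    by (intro continuous_on_fst continuous_on_id)
  have lift: "continuous_on ({0..1::real} \<times> coord_space ?n) (\<lambda>z. f (snd z))"
    if "continuous_on (coord_space ?n) f" for f :: "_ \<Rightarrow> nat \<Rightarrow> real"
    by (rule continuous_on_compose2[OF that continuous_on_snd[OF continuous_on_id]]) auto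
  define H where "H t x = join_coords u (\<lambda>i. (1 - t) * pp x i + t * ?r x i) (E x)" for t x
  have "essential ?n (H 1)"
  proof (rule essential_homotopy)
    show "essential ?n (H 0)" using ess by (simp add: H_def[abs_def])
    show "continuous_on ({0..1} \<times> coord_space ?n) (\<lambda>(t, x). H t x)"
      unfolding H_def case_prod_unfold
      by (rule continuous_on_join_coords[OF continuous_on_add_vec[OF
           continuous_on_scale_vec[OF continuous_on_diff[OF continuous_on_const fs] lift[OF pp(1)]]
           continuous_on_scale_vec[OF fs lift[OF continuous_on_ball_retract[OF pp(1)]]]] lift[OF E(1)]])
    fix t :: real and x assume t: "0 \<le> t" "t \<le> 1" and x: "x \<in> coord_space ?n"
    have ppx: "pp x \<in> coord_space u" "E x \<in> coord_space e" using pp E x by auto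
    have v: "(\<lambda>i. (1 - t) * pp x i + t * ?r x i) = (\<lambda>i. ((1 - t) + t * inverse (max 1 (enorm u (pp x)))) * pp x i)"
      by (simp add: ball_retract_def algebra_simps)
    have vc: "(\<lambda>i. (1 - t) * pp x i + t * ?r x i) \<in> coord_space u"
      unfolding v using ppx by (simp add: coord_space_scale)
    show "H t x \<in> coord_space ?n" unfolding H_def by (rule join_coords_coord_space[OF ppx(2)])
    assume "H t x = zvec"
    then have "(\<lambda>i. (1 - t) * pp x i + t * ?r x i) = zvec" and Ez: "E x = zvec"
      using join_coords_eq_zvec[OF vc, of "E x"] by (auto simp: H_def)
    moreover have "(1 - t) + t * inverse (max 1 (enorm u (pp x))) \<noteq> 0"
    proof (cases "t = 1")
      case False
      then have "1 - t > 0" "t * inverse (max 1 (enorm u (pp x))) \<ge> 0" using t by auto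
      then show ?thesis by linarith
    qed auto
    ultimately have "pp x = zvec" unfolding v by (auto simp: fun_eq_iff)
    then show "enorm ?n x \<le> R" using zero[OF x Ez] by simp
  qed
  moreover define H2 where "H2 t x = join_coords u (\<alpha> t (?r x) (?q x)) (E x)" for t x
  have small: "enorm u (pp x) \<le> 1 \<and> \<alpha> t (?r x) (?q x) = zvec \<and> E x = zvec"
    if "0 \<le> t" "t \<le> 1" and x: "x \<in> coord_space ?n" and z: "H2 t x = zvec" for t x
  proof -
    have z2: "\<alpha> t (?r x) (?q x) = zvec" "E x = zvec"
      using join_coords_eq_zvec[OF \<alpha>[OF that(1,2) rp[OF x]], of "E x"] z by (auto simp: H2_def)
    have "\<not> 1 \<le> enorm u (pp x)"
    proof
      assume "1 \<le> enorm u (pp x)"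
      then have "?r x \<in> unit_sphere u" using pp x by (auto intro: ball_retract_unit_sphere)
      then show False using nz[OF that(1,2) _ rp(2)[OF x]] z2 by blast
    qed
    then show ?thesis using z2 by auto
  qed
  have "essential ?n (H2 1)"
  proof (rule essential_homotopy)
    show "essential ?n (H2 0)"
      by (rule essential_cong[OF \<open>essential ?n (H 1)\<close>]) (simp add: H_def H2_def \<alpha>0 rp)
    show "continuous_on ({0..1} \<times> coord_space ?n) (\<lambda>(t, x). H2 t x)"
    proof -
      have "continuous_on ({0..1::real} \<times> coord_space ?n) (\<lambda>z. (fst z, ?r (snd z), ?q (snd z)))"
        by (rule continuous_on_Pair[OF fs continuous_on_Pair[OF
              lift[OF continuous_on_ball_retract[OF pp(1)]] lift[OF continuous_on_ball_retract[OF qq(1)]]]])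
      then have "continuous_on ({0..1::real} \<times> coord_space ?n)
         (\<lambda>z. (\<lambda>(t, p, q). \<alpha> t p q) (fst z, ?r (snd z), ?q (snd z)))"
        by (rule continuous_on_compose2[OF cont]) (use rp in auto)
      then have "continuous_on ({0..1::real} \<times> coord_space ?n) (\<lambda>z. join_coords u (\<alpha> (fst z) (?r (snd z)) (?q (snd z))) (E (snd z)))"
        by (intro continuous_on_join_coords[OF _ lift[OF E(1)]]) simp
      then show ?thesis by (simp add: H2_def case_prod_unfold)
    qed
    fix t :: real and x assume t: "0 \<le> t" "t \<le> 1" and x: "x \<in> coord_space ?n"
    show "H2 t x \<in> coord_space ?n"
      unfolding H2_def using E x by (intro join_coords_coord_space) auto
    assume "H2 t x = zvec"
    from small[OF t x this] zero[OF x] show "enorm ?n x \<le> R" by blast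
  qed
  then obtain x where x: "x \<in> coord_space ?n" "H2 1 x = zvec" using essential_has_zero by blast
  from small[OF _ _ x] have s: "enorm u (pp x) \<le> 1" "\<alpha> 1 (?r x) (?q x) = zvec" "E x = zvec" by auto
  with zero[OF x(1)] have q: "enorm s (qq x) \<le> 1" "Q (pp x) (qq x)" by auto
  show ?thesis
    using s q rp[OF x(1)] by (auto simp: ball_retract_id)
qed

text \<open>
  The coordinates \<open>(p, q)\<close> of the next point become new unknowns, with the new equations that the image
  of the old last point is \<open>(p, q)\<close>. Retractions to the unit balls make all maps defined everywhere.
  They create no spurious zeros: \<open>h_minus\<close> keeps the old point inside its ball, \<open>h_plus\<close> keeps \<open>q\<close>
  inside, and \<open>p\<close> is only ever used when \<open>|p| \<le> 1\<close>. Following \<open>h\<close> to its end and setting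
  \<open>p = 0\<close> decouples the equations.
\<close>

lemma reaches_step:
  assumes "reaches u s Q"
    and h: "continuous_on ({0..1::real} \<times> (unit_ball u \<times> unit_ball s)) h"
    and h_range: "\<And>t w. 0 \<le> t \<Longrightarrow> t \<le> 1 \<Longrightarrow> w \<in> unit_ball u \<times> unit_ball s \<Longrightarrow>
      h (t, w) \<in> coord_space u \<times> coord_space s'"
    and h_minus: "\<And>t w. 0 \<le> t \<Longrightarrow> t \<le> 1 \<Longrightarrow> w \<in> unit_sphere u \<times> unit_ball s \<Longrightarrow>
      h (t, w) \<notin> unit_ball u \<times> unit_ball s'"
    and h_plus: "\<And>t w. 0 \<le> t \<Longrightarrow> t \<le> 1 \<Longrightarrow> w \<in> unit_ball u \<times> unit_ball s \<Longrightarrow>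
      h (t, w) \<notin> unit_ball u \<times> unit_sphere s'"
    and A: "continuous_on (coord_space u) A" "A ` coord_space u \<subseteq> coord_space u"
    and h1: "\<And>p q. p \<in> unit_ball u \<Longrightarrow> q \<in> unit_ball s \<Longrightarrow> h (1, (p, q)) = (A p, zvec)"
    and A_out: "A ` unit_sphere u \<inter> unit_ball u = {}"
    and deg: "ball_degree u A \<noteq> 0"
  shows "reaches u s' (\<lambda>p' q'. \<exists>p\<in>unit_ball u. \<exists>q\<in>unit_ball s. Q p q \<and> h (0, (p, q)) = (p', q'))"
proof -
  obtain e R E pp qq where sys: "crossing_system u s Q e R E pp qq"
    using assms(1) unfolding reaches_def by blast
  then have pp: "continuous_on (coord_space (u + e)) pp" "pp ` coord_space (u + e) \<subseteq> coord_space u"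
    and qq: "continuous_on (coord_space (u + e)) qq" "qq ` coord_space (u + e) \<subseteq> coord_space s"
    and E: "continuous_on (coord_space (u + e)) E" "E ` coord_space (u + e) \<subseteq> coord_space e"
    and ess: "essential (u + e) (\<lambda>x. join_coords u (pp x) (E x))"
    by (simp_all add: crossing_system_def)
  have zero: "enorm (u + e) x \<le> R \<and> enorm s (qq x) \<le> 1 \<and> Q (pp x) (qq x)"
    if "x \<in> coord_space (u + e)" "E x = zvec" "enorm u (pp x) \<le> 1" for x
    using sys that by (simp add: crossing_system_def)
  define N where "N = u + e"
  define e' where "e' = u + (e + s')"
  let ?D = "u + e'"
  have D: "?D = N + (s' + u)" by (simp add: N_def e'_def)
  \<comment> \<open>the new unknown is \<open>[X | q | p]\<close>: the old unknown, then the coordinates of the next point\<close>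
  define X where "X x = take_vec N x" for x
  define q where "q x = take_vec s' (drop_vec N x)" for x
  define p where "p x = drop_vec s' (drop_vec N x)" for x
  define rw where "rw x = (ball_retract u (pp (X x)), ball_retract s (qq (X x)))" for x
  have X_sp: "X x \<in> coord_space (u + e)" for x by (simp add: X_def N_def)
  have q_sp: "q x \<in> coord_space s'" for x by (simp add: q_def)
  have p_sp: "p x \<in> coord_space u" if "x \<in> coord_space ?D" for x
    using that unfolding D p_def by (intro drop_vec_coord_space)
  have E_sp: "E (X x) \<in> coord_space e" and pp_sp: "pp (X x) \<in> coord_space u"
    and qq_sp: "qq (X x) \<in> coord_space s" for x using E pp qq X_sp by auto
  have x_eq: "x = join_coords N (X x) (join_coords s' (q x) (p x))" for x
    by (simp add: X_def q_def p_def)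
  have x_norm: "enorm ?D x \<le> enorm N (X x) + (enorm s' (q x) + enorm u (p x))" for x
    using enorm_join_coords_le[of N "s' + u" "X x" "join_coords s' (q x) (p x)"]
      enorm_join_coords_le[of s' u "q x" "p x"] unfolding x_eq[of x, symmetric] D by linarith
  have rw: "rw x \<in> unit_ball u \<times> unit_ball s" for x
    using pp_sp qq_sp by (auto simp: rw_def intro: ball_retract_unit_ball)
  have small: "enorm u (pp (X x)) < 1"
    if t: "0 \<le> t" "t \<le> 1" and hb: "h (t, rw x) \<in> unit_ball u \<times> unit_ball s'" for t x
  proof (rule ccontr)
    assume "\<not> enorm u (pp (X x)) < 1"
    then have "rw x \<in> unit_sphere u \<times> unit_ball s"
      using rw[of x] pp_sp[of x] ball_retract_unit_sphere[of "pp (X x)" u] by (auto simp: rw_def)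
    from h_minus[OF t this] hb show False by contradiction
  qed
  have cX: "continuous_on S X" for S
    unfolding X_def by (rule continuous_on_take_vec[OF continuous_on_id])
  have cq: "continuous_on S q" for S
    unfolding q_def by (rule continuous_on_take_vec[OF continuous_on_drop_vec[OF continuous_on_id]])
  have cp: "continuous_on S p" for S
    unfolding p_def by (rule continuous_on_drop_vec[OF continuous_on_drop_vec[OF continuous_on_id]])
  have cE: "continuous_on S (\<lambda>x. E (X x))" for S
    by (rule continuous_on_compose2[OF E(1) cX]) (use X_sp in auto)
  have cpp: "continuous_on S (\<lambda>x. pp (X x))" for S
    by (rule continuous_on_compose2[OF pp(1) cX]) (use X_sp in auto)
  have cqq: "continuous_on S (\<lambda>x. qq (X x))" for S
    by (rule continuous_on_compose2[OF qq(1) cX]) (use X_sp in auto)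
  have crw: "continuous_on S rw" for S
    unfolding rw_def
    by (rule continuous_on_Pair[OF continuous_on_ball_retract[OF cpp] continuous_on_ball_retract[OF cqq]])
  have crp: "continuous_on S (\<lambda>x. ball_retract u (p x))" for S
    by (rule continuous_on_ball_retract[OF cp])
  have crq: "continuous_on S (\<lambda>x. ball_retract s' (q x))" for S
    by (rule continuous_on_ball_retract[OF cq])
  let ?T = "{0..1::real} \<times> coord_space ?D"
  have fs: "continuous_on ?T fst" by (rule continuous_on_fst[OF continuous_on_id])
  have fs1: "continuous_on ?T (\<lambda>z. 1 - fst z)" by (rule continuous_on_diff[OF continuous_on_const fs])
  have lift: "continuous_on ?T (\<lambda>z. f (snd z))" if "\<And>S. continuous_on S f" for f :: "_ \<Rightarrow> nat \<Rightarrow> real"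
    by (rule continuous_on_compose2[OF that[of UNIV] continuous_on_snd[OF continuous_on_id]]) auto
  have ch: "continuous_on ?T (\<lambda>z. h (1 - fst z, rw (snd z)))"
  proof (rule continuous_on_compose2[OF h continuous_on_Pair[OF fs1]])
    show "continuous_on ?T (\<lambda>z. rw (snd z))"
      by (rule continuous_on_compose2[OF crw[of UNIV] continuous_on_snd[OF continuous_on_id]]) auto
    show "(\<lambda>z. (1 - fst z, rw (snd z))) ` ?T \<subseteq> {0..1} \<times> (unit_ball u \<times> unit_ball s)"
    proof (rule image_subsetI)
      fix z assume "z \<in> ?T"
      then have "1 - fst z \<in> {0..1}" by auto
      then show "(1 - fst z, rw (snd z)) \<in> {0..1} \<times> (unit_ball u \<times> unit_ball s)"
        using rw[of "snd z"] by blast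
    qed
  qed
  \<comment> \<open>every field below is \<open>[p | a | E | d]\<close>; only the blocks \<open>a\<close> and \<open>d\<close> get deformed\<close>
  define J where "J x a d = join_coords u (p x) (join_coords u a (join_coords e (E (X x)) d))" for x a d
  have J_sp: "J x a d \<in> coord_space ?D" if "d \<in> coord_space s'" for x a d
    unfolding J_def e'_def by (intro join_coords_coord_space that)
  have J_zero: "p x = zvec \<and> a = zvec \<and> E (X x) = zvec \<and> d = zvec"
    if "J x a d = zvec" "x \<in> coord_space ?D" "a \<in> coord_space u" for x a d
    using that(1) unfolding J_def join_coords_eq_zvec[OF p_sp[OF that(2)]] join_coords_eq_zvec[OF that(3)]
      join_coords_eq_zvec[OF E_sp] by simp
  have cJ: "continuous_on ?T (\<lambda>z. J (snd z) (a z) (d z))" if "continuous_on ?T a" "continuous_on ?T d" for a d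
    unfolding J_def
    by (rule continuous_on_join_coords[OF lift[OF cp] continuous_on_join_coords[OF that(1)
          continuous_on_join_coords[OF lift[OF cE] that(2)]]])
  have A_nz: "A y \<in> coord_space u \<and> A y \<noteq> zvec" if "y \<in> unit_sphere u" for y
  proof -
    have "zvec \<in> unit_ball u" by (simp add: unit_ball_iff)
    then show ?thesis using that A A_out by (fastforce simp: unit_sphere_iff)
  qed
  have sub: "unit_sphere u \<subseteq> coord_space u" by (auto simp: unit_sphere_iff)
  note A_s = continuous_on_subset[OF A(1) sub]
  let ?Ah = "homogeneous_ext u A"
  have Ah_sp: "?Ah y \<in> coord_space u" and Ah_norm: "enorm u (?Ah y) = enorm u y" if "y \<in> coord_space u" for y
    using homogeneous_ext_range[where A = A, OF A_nz that] by auto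
  \<comment> \<open>With \<open>a\<close> the homogeneous extension of \<open>A\<close> and \<open>d = q\<close>, the field is the suspended old field,
    followed by the block map of \<open>A\<close> and by the rotation that brings \<open>p\<close> to the front.\<close>
  have "essential ?D (\<lambda>x. J x (?Ah (pp (X x))) (q x))"
  proof -
    let ?G = "\<lambda>x. join_coords u (pp x) (E x)"
    let ?S = "\<lambda>x. join_coords N (?G (take_vec N x)) (drop_vec N x)"
    have "essential (N + (s' + u)) ?S"
      by (rule essential_suspension) (use ess in \<open>simp add: N_def\<close>)
    then have "essential ?D ?S" by (simp only: D)
    then have "essential ?D (\<lambda>x. join_coords u (?Ah (take_vec u (?S x))) (drop_vec u (?S x)))"
      by (rule essential_block_compose[OF _ A_s A_nz])
         (use deg in \<open>auto simp: ball_degree_field_degree split: if_splits\<close>)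
    moreover have "join_coords u (?Ah (take_vec u (?S x))) (drop_vec u (?S x))
        = join_coords (u + (e + s')) (join_coords u (?Ah (pp (X x))) (join_coords e (E (X x)) (q x))) (p x)" for x
    proof -
      have "?S x = join_coords u (pp (X x)) (join_coords e (E (X x)) (drop_vec N x))"
        unfolding N_def join_coords_assoc by (simp add: X_def N_def)
      then have "take_vec u (?S x) = pp (X x)" "drop_vec u (?S x) = join_coords e (E (X x)) (drop_vec N x)"
        using take_join_coords[OF pp_sp] by auto
      moreover have "drop_vec N x = join_coords s' (q x) (p x)" by (simp add: q_def p_def)
      ultimately show ?thesis unfolding join_coords_assoc by simp
    qed
    ultimately have G1: "essential ((u + (e + s')) + u) (\<lambda>x.
        join_coords (u + (e + s')) (join_coords u (?Ah (pp (X x))) (join_coords e (E (X x)) (q x))) (p x))"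
      (is "essential _ ?G1")
      by (simp add: e'_def add.commute add.left_commute)
    let ?C = "\<lambda>x. join_coords u (drop_vec (u + (e + s')) x) (take_vec (u + (e + s')) x)"
    have C_nz: "x = zvec" if "x \<in> coord_space ((u + (e + s')) + u)" "?C x = zvec" for x
    proof -
      have "drop_vec (u + (e + s')) x = zvec" "take_vec (u + (e + s')) x = zvec"
        using join_coords_eq_zvec[OF drop_vec_coord_space[OF that(1)]] that(2) by auto
      then have "join_coords (u + (e + s')) (take_vec (u + (e + s')) x) (drop_vec (u + (e + s')) x) = zvec"
        by (simp only:) (simp add: join_coords_def)
      then show ?thesis by simp
    qed
    have pos: "0 < (u + (e + s')) + u"
      using ess unfolding essential_def by linarith
    have "essential ((u + (e + s')) + u) (\<lambda>x. ?C (?G1 x))"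
      by (rule essential_compose_homogeneous[OF G1 essential_rotation[OF pos] C_nz])
         (auto simp: join_coords_def take_vec_def drop_vec_def)
    moreover have "?C (?G1 x) = J x (?Ah (pp (X x))) (q x)" for x
    proof -
      have "join_coords u (?Ah (pp (X x))) (join_coords e (E (X x)) (q x)) \<in> coord_space (u + (e + s'))"
        by (intro join_coords_coord_space q_sp)
      then show ?thesis by (simp add: take_join_coords J_def)
    qed
    ultimately show ?thesis by (simp add: e'_def add.commute)
  qed
  \<comment> \<open>Deform the homogeneous extension to \<open>A\<close> on the ball and insert the retractions. Outside the ball
    both values of \<open>A\<close> point in the same direction, so no zeros come in from there.\<close>
  moreover define a1 where "a1 t x = (\<lambda>i. (1 - t) * ?Ah (pp (X x)) i + t * (\<lambda>i. A (fst (rw x)) i - ball_retract u (p x) i) i)" for t x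
  define d1 where "d1 t x = (\<lambda>i. (1 - t) * q x i + t * ball_retract s' (q x) i)" for t x
  have "essential ?D (\<lambda>x. J x (a1 1 x) (d1 1 x))"
  proof (rule essential_homotopy[where H = "\<lambda>t x. J x (a1 t x) (d1 t x)" and R = R])
    show "essential ?D (\<lambda>x. J x (a1 0 x) (d1 0 x))"
      using calculation by (simp add: a1_def d1_def)
    have "continuous_on ?T (\<lambda>z. ?Ah (pp (X (snd z))))"
      by (rule continuous_on_compose2[OF continuous_on_homogeneous_ext[OF A_s A_nz] lift[OF cpp]])
         (use pp_sp in auto)
    moreover have "continuous_on ?T (\<lambda>z. A (fst (rw (snd z))))"
    proof (rule continuous_on_compose2[OF A(1)])
      show "continuous_on ?T (\<lambda>z. fst (rw (snd z)))" by (rule lift[OF continuous_on_fst[OF crw]])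
      show "(\<lambda>z. fst (rw (snd z))) ` ?T \<subseteq> coord_space u"
        using rw by (auto simp: mem_Times_iff unit_ball_iff)
    qed
    ultimately have "continuous_on ?T (\<lambda>z. a1 (fst z) (snd z))"
      unfolding a1_def
      by (rule continuous_on_add_vec[OF continuous_on_scale_vec[OF fs1]
          continuous_on_scale_vec[OF fs continuous_on_diff_vec[OF _ lift[OF crp]]]])
    moreover have "continuous_on ?T (\<lambda>z. d1 (fst z) (snd z))"
      unfolding d1_def
      by (rule continuous_on_add_vec[OF continuous_on_scale_vec[OF fs1 lift[OF cq]]
          continuous_on_scale_vec[OF fs lift[OF crq]]])
    ultimately show "continuous_on ?T (\<lambda>(t, x). J x (a1 t x) (d1 t x))"
      using cJ by (simp add: case_prod_unfold)
    fix t :: real and x assume t: "0 \<le> t" "t \<le> 1" and x: "x \<in> coord_space ?D"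
    have d1: "d1 t x \<in> coord_space s'"
      unfolding d1_def ball_retract_def by (intro coord_space_add coord_space_scale q_sp)
    then show "J x (a1 t x) (d1 t x) \<in> coord_space ?D" by (rule J_sp)
    have a1: "a1 t x \<in> coord_space u"
      unfolding a1_def ball_retract_def
      using rw[of x] A(2) by (intro coord_space_add coord_space_scale coord_space_diff Ah_sp pp_sp p_sp x)
        (auto simp: mem_Times_iff unit_ball_iff)
    assume "J x (a1 t x) (d1 t x) = zvec"
    from J_zero[OF this x a1] have z: "p x = zvec" "a1 t x = zvec" "E (X x) = zvec" "d1 t x = zvec" by auto
    have qz: "q x = zvec"
    proof -
      define c where "c = (1 - t) + t * inverse (max 1 (enorm s' (q x)))"
      have "d1 t x = (\<lambda>i. c * q x i)" by (simp add: d1_def c_def ball_retract_def algebra_simps)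
      moreover have "c \<noteq> 0"
      proof (cases "t = 1")
        case False
        then have "1 - t > 0" "t * inverse (max 1 (enorm s' (q x))) \<ge> 0" using t by auto
        then show ?thesis unfolding c_def by linarith
      qed (auto simp: c_def)
      ultimately show ?thesis using z(4) by (auto simp: fun_eq_iff)
    qed
    have "enorm u (pp (X x)) < 1"
    proof (rule ccontr)
      assume "\<not> enorm u (pp (X x)) < 1"
      then have ge: "1 \<le> enorm u (pp (X x))" by simp
      then have nzp: "pp (X x) \<noteq> zvec" by auto
      have n: "ball_retract u (pp (X x)) = normalize_vec u (pp (X x))"
        using ge by (simp add: ball_retract_def normalize_vec_def max_def divide_inverse mult.commute)
      define y where "y = A (normalize_vec u (pp (X x)))"
      have y: "y \<in> coord_space u" "y \<noteq> zvec"
        unfolding y_def using A_nz[OF normalize_vec_unit_sphere[OF pp_sp nzp]] by auto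
      define c where "c = (1 - t) * (enorm u (pp (X x)) / enorm u y) + t"
      have "a1 t x = (\<lambda>i. c * y i)"
        using nzp z(1) n
        by (simp add: a1_def rw_def homogeneous_ext_def y_def[symmetric] c_def algebra_simps)
           (simp add: normalize_vec_def algebra_simps diff_divide_distrib)
      moreover have "c \<noteq> 0"
      proof -
        have "enorm u y > 0" using y enorm_eq_0[of y u] enorm_nonneg[of u y] by linarith
        then have "enorm u (pp (X x)) / enorm u y > 0" using ge by simp
        then have "t \<noteq> 1 \<Longrightarrow> (1 - t) * (enorm u (pp (X x)) / enorm u y) > 0"
          using t by (intro mult_pos_pos) auto
        then show ?thesis
          using t unfolding c_def by (cases "t = 1") auto
      qed
      ultimately have "y = zvec" using z(2) by (auto simp: fun_eq_iff)
      then show False using y by simp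
    qed
    then show "enorm ?D x \<le> R"
      using x_norm[of x] zero[OF X_sp z(3)] z(1) qz by (simp add: N_def)
  qed
  \<comment> \<open>Run the covering homotopy backwards, from \<open>(A, 0)\<close> to the map itself.\<close>
  moreover define a2 where "a2 t x = (\<lambda>i. fst (h (1 - t, rw x)) i - ball_retract u (p x) i)" for t x
  define d2 where "d2 t x = (\<lambda>i. ball_retract s' (q x) i - snd (h (1 - t, rw x)) i)" for t x
  have h_sp: "fst (h (1 - t, rw x)) \<in> coord_space u \<and> snd (h (1 - t, rw x)) \<in> coord_space s'"
    if "0 \<le> t" "t \<le> 1" for t x
    using h_range[of "1 - t" "rw x"] rw[of x] that by (simp add: mem_Times_iff)
  have br_sp: "ball_retract u (p x) \<in> unit_ball u" "ball_retract s' (q x) \<in> unit_ball s'" if "x \<in> coord_space ?D" for x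
    using p_sp[OF that] q_sp by (auto intro: ball_retract_unit_ball)
  have a2: "a2 t x \<in> coord_space u" and d2: "d2 t x \<in> coord_space s'"
    if "0 \<le> t" "t \<le> 1" "x \<in> coord_space ?D" for t x
    using h_sp[OF that(1,2), of x] br_sp[OF that(3)] unfolding a2_def d2_def
    by (auto intro!: coord_space_diff simp: unit_ball_iff)
  have key: "h (1 - t, rw x) = (ball_retract u (p x), ball_retract s' (q x)) \<and> enorm u (pp (X x)) < 1 \<and> enorm s' (q x) < 1"
    if t: "0 \<le> t" "t \<le> 1" and x: "x \<in> coord_space ?D" and z: "a2 t x = zvec" "d2 t x = zvec" for t x
  proof -
    have eq: "h (1 - t, rw x) = (ball_retract u (p x), ball_retract s' (q x))"
      using z by (auto simp: a2_def d2_def fun_eq_iff prod_eq_iff)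
    then have "h (1 - t, rw x) \<in> unit_ball u \<times> unit_ball s'"
      using br_sp[OF x] by simp
    then have "enorm u (pp (X x)) < 1" using small[of "1 - t" x] t by auto
    moreover have "enorm s' (q x) < 1"
    proof (rule ccontr)
      assume "\<not> enorm s' (q x) < 1"
      then have "ball_retract s' (q x) \<in> unit_sphere s'" using q_sp by (intro ball_retract_unit_sphere) auto
      then show False using h_plus[of "1 - t" "rw x"] rw[of x] t br_sp[OF x] eq by auto
    qed
    ultimately show ?thesis using eq by blast
  qed
  have "essential ?D (\<lambda>x. J x (a2 1 x) (d2 1 x))"
  proof (rule essential_homotopy[where H = "\<lambda>t x. J x (a2 t x) (d2 t x)" and R = "R + 1"])
    show "essential ?D (\<lambda>x. J x (a2 0 x) (d2 0 x))"
    proof (rule essential_cong[OF calculation(2)])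
      fix x
      have "h (1, rw x) = (A (fst (rw x)), zvec)"
        using h1[of "fst (rw x)" "snd (rw x)"] rw[of x] by (auto simp: mem_Times_iff)
      then show "J x (a1 1 x) (d1 1 x) = J x (a2 0 x) (d2 0 x)"
        by (simp add: a1_def a2_def d1_def d2_def)
    qed
    have "continuous_on ?T (\<lambda>z. a2 (fst z) (snd z))" "continuous_on ?T (\<lambda>z. d2 (fst z) (snd z))"
      unfolding a2_def d2_def
      by (rule continuous_on_diff_vec[OF continuous_on_fst[OF ch] lift[OF crp]]
          continuous_on_diff_vec[OF lift[OF crq] continuous_on_snd[OF ch]])+
    then show "continuous_on ?T (\<lambda>(t, x). J x (a2 t x) (d2 t x))"
      using cJ by (simp add: case_prod_unfold)
    fix t :: real and x assume t: "0 \<le> t" "t \<le> 1" and x: "x \<in> coord_space ?D"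
    show "J x (a2 t x) (d2 t x) \<in> coord_space ?D" by (rule J_sp[OF d2[OF t x]])
    assume "J x (a2 t x) (d2 t x) = zvec"
    from J_zero[OF this x a2[OF t x]] have z: "p x = zvec" "a2 t x = zvec" "E (X x) = zvec" "d2 t x = zvec" by auto
    from key[OF t x z(2,4)] have "enorm u (pp (X x)) < 1" "enorm s' (q x) < 1" by auto
    then show "enorm ?D x \<le> R + 1"
      using x_norm[of x] zero[OF X_sp z(3)] z(1) by (simp add: N_def)
  qed
  moreover define E' where "E' x = join_coords u (a2 1 x) (join_coords e (E (X x)) (d2 1 x))" for x
  ultimately have ess': "essential ?D (\<lambda>x. join_coords u (p x) (E' x))"
    by (simp add: J_def)
  show ?thesis
    unfolding reaches_def crossing_system_def
  proof (intro exI conjI ballI impI)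
    show "essential (u + e') (\<lambda>x. join_coords u (p x) (E' x))" by (rule ess')
    show "continuous_on (coord_space (u + e')) p" "continuous_on (coord_space (u + e')) q" by (rule cp cq)+
    show "p ` coord_space (u + e') \<subseteq> coord_space u" "q ` coord_space (u + e') \<subseteq> coord_space s'"
      using p_sp q_sp by auto
    show "E' ` coord_space (u + e') \<subseteq> coord_space e'"
      unfolding E'_def e'_def using d2[of 1] by (auto intro!: join_coords_coord_space simp: e'_def)
    have ch0: "continuous_on (coord_space ?D) (\<lambda>x. h (1 - 1, rw x))"
    proof (rule continuous_on_compose2[OF h continuous_on_Pair[OF continuous_on_const crw]], rule image_subsetI)
      fix x show "(1 - 1, rw x) \<in> {0..1::real} \<times> (unit_ball u \<times> unit_ball s)"
        using rw[of x] by simp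
    qed
    have "continuous_on (coord_space ?D) (a2 1)" "continuous_on (coord_space ?D) (d2 1)"
      unfolding a2_def d2_def
      by (rule continuous_on_diff_vec[OF continuous_on_fst[OF ch0] crp]
          continuous_on_diff_vec[OF crq continuous_on_snd[OF ch0]])+
    then show "continuous_on (coord_space (u + e')) E'"
      unfolding E'_def by (rule continuous_on_join_coords[OF _ continuous_on_join_coords[OF cE]])
    fix x assume x: "x \<in> coord_space (u + e')" and *: "E' x = zvec \<and> enorm u (p x) \<le> 1"
    then have z: "a2 1 x = zvec" "E (X x) = zvec" "d2 1 x = zvec"
      unfolding E'_def join_coords_eq_zvec[OF a2[OF zero_le_one order_refl x]] join_coords_eq_zvec[OF E_sp] by auto
    from key[OF zero_le_one order_refl x z(1,3)]
    have k: "h (0, rw x) = (ball_retract u (p x), ball_retract s' (q x))" "enorm u (pp (X x)) < 1" "enorm s' (q x) < 1"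
      by auto
    from zero[OF X_sp z(2)] k have zz: "enorm N (X x) \<le> R" "enorm s (qq (X x)) \<le> 1" "Q (pp (X x)) (qq (X x))"
      by (auto simp: N_def)
    show "enorm (u + e') x \<le> R + 2" using x_norm[of x] zz k * by simp
    show "enorm s' (q x) \<le> 1" using k by simp
    show "\<exists>pa\<in>unit_ball u. \<exists>qa\<in>unit_ball s. Q pa qa \<and> h (0, pa, qa) = (p x, q x)"
      using rw[of x] k zz * by (auto simp: rw_def ball_retract_id)
  qed
qed

lemma reaches_mono:
  assumes "reaches u s Q"
    and "\<And>p q. p \<in> unit_ball u \<Longrightarrow> q \<in> unit_ball s \<Longrightarrow> Q p q \<Longrightarrow> Q' p q"
  shows "reaches u s Q'"
proof -
  obtain e R E pp qq where sys: "crossing_system u s Q e R E pp qq"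
    using assms(1) unfolding reaches_def by blast
  have "Q' (pp x) (qq x)" if "x \<in> coord_space (u + e)" "E x = zvec" "enorm u (pp x) \<le> 1" for x
    using sys that by (intro assms(2)) (auto simp: crossing_system_def unit_ball_iff)
  with sys have "crossing_system u s Q' e R E pp qq"
    unfolding crossing_system_def by simp
  then show ?thesis unfolding reaches_def by blast
qed

lemma model_space_top_of_set: "model_space N = top_of_set (coord_space (hu N) \<times> coord_space (hs N))"
  by (simp add: model_space_def Euclidean_space_coord_space)

lemma model_subset: "model N \<subseteq> coord_space (hu N) \<times> coord_space (hs N)"
  by (auto simp: model_def unit_ball_iff)

lemma is_hset_inj_on: "is_hset N \<Longrightarrow> inj_on (hchart N) (hdom N)"
  by (auto simp: is_hset_def dest!: homeomorphic_imp_injective_map)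

text \<open>
  Only the chart coordinates of the image are recorded: that the image lies in \<open>M\<close>, and not merely
  its coordinates in the model, depends on the injectivity of the chart of \<open>M\<close>.
\<close>

lemma reaches_covers:
  assumes cov: "covers F N M" and N: "inj_on (hchart N) (hsupp N)" "hchart N ` hsupp N = model N"
    and Q: "reaches (hu N) (hs N) (\<lambda>p q. \<exists>x\<in>hsupp N. hchart N x = (p, q) \<and> S x)"
  shows "reaches (hu M) (hs M) (\<lambda>p q. \<exists>x\<in>hsupp N. S x \<and> hchart M (F x) = (p, q))"
proof -
  have hu: "hu N = hu M" using cov unfolding covers_def by (elim conjE)
  from cov[unfolded covers_def, THEN conjunct2, THEN conjunct2, THEN conjunct2]
  obtain h A where hA: "continuous_map (prod_topology (top_of_set {0..1::real}) (subtopology (model_space N) (model N)))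
          (model_space M) h \<and>
      (\<forall>w\<in>model N. h (0, w) = in_charts N M F w) \<and>
      h ` ({0..1} \<times> model_minus N) \<inter> model M = {} \<and>
      h ` ({0..1} \<times> model N) \<inter> model_plus M = {} \<and>
      continuous_map (Euclidean_space (hu N)) (Euclidean_space (hu N)) A \<and>
      (\<forall>p q. (p, q) \<in> model N \<longrightarrow> h (1, (p, q)) = (A p, (\<lambda>_. 0))) \<and>
      A ` unit_sphere (hu N) \<inter> unit_ball (hu N) = {} \<and>
      ball_degree (hu N) A \<noteq> 0"
    by (elim exE) (rule that)
  then have h: "continuous_map (prod_topology (top_of_set {0..1::real}) (subtopology (model_space N) (model N)))
          (model_space M) h"
    and h0: "\<forall>w\<in>model N. h (0, w) = in_charts N M F w"
    and hm: "h ` ({0..1} \<times> model_minus N) \<inter> model M = {}"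
    and hp: "h ` ({0..1} \<times> model N) \<inter> model_plus M = {}"
    and A: "continuous_map (Euclidean_space (hu N)) (Euclidean_space (hu N)) A"
    and h1: "\<forall>p q. (p, q) \<in> model N \<longrightarrow> h (1, (p, q)) = (A p, (\<lambda>_. 0))"
    and Ao: "A ` unit_sphere (hu N) \<inter> unit_ball (hu N) = {}"
    and deg: "ball_degree (hu N) A \<noteq> 0"
    by - (elim conjE, assumption)+
  have inter: "(coord_space (hu N) \<times> coord_space (hs N)) \<inter> model N = model N"
    using model_subset[of N] by blast
  have "continuous_map (top_of_set ({0..1::real} \<times> model N)) (top_of_set (coord_space (hu M) \<times> coord_space (hs M))) h"
    using h by (simp add: model_space_top_of_set subtopology_subtopology inter)
  then have hc: "continuous_on ({0..1::real} \<times> model N) h"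
    and hr: "h ` ({0..1::real} \<times> model N) \<subseteq> coord_space (hu M) \<times> coord_space (hs M)"
    by (simp_all add: continuous_map_in_subtopology image_subset_iff_funcset)
  have "reaches (hu M) (hs M) (\<lambda>p' q'. \<exists>p\<in>unit_ball (hu M). \<exists>q\<in>unit_ball (hs N).
      (\<exists>x\<in>hsupp N. hchart N x = (p, q) \<and> S x) \<and> h (0, (p, q)) = (p', q'))"
  proof (rule reaches_step[where h = h and A = A])
    show "reaches (hu M) (hs N) (\<lambda>p q. \<exists>x\<in>hsupp N. hchart N x = (p, q) \<and> S x)"
      using Q hu by simp
    show "continuous_on ({0..1} \<times> unit_ball (hu M) \<times> unit_ball (hs N)) h"
      using hc hu by (simp add: model_def)
    show "continuous_on (coord_space (hu M)) A" "A ` coord_space (hu M) \<subseteq> coord_space (hu M)"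
      using A hu by (auto simp: Euclidean_space_coord_space continuous_map_in_subtopology)
    show "h (t, w) \<in> coord_space (hu M) \<times> coord_space (hs M)"
      if "0 \<le> t" "t \<le> 1" "w \<in> unit_ball (hu M) \<times> unit_ball (hs N)" for t w
    proof -
      have "(t, w) \<in> {0..1} \<times> model N" using that hu by (auto simp: model_def)
      then show ?thesis using hr[unfolded image_subset_iff, rule_format] by blast
    qed
    show "h (t, w) \<notin> unit_ball (hu M) \<times> unit_ball (hs M)"
      if "0 \<le> t" "t \<le> 1" "w \<in> unit_sphere (hu M) \<times> unit_ball (hs N)" for t w
    proof -
      have "(t, w) \<in> {0..1} \<times> model_minus N" using that hu by (auto simp: model_minus_def)
      from hm[unfolded disjoint_iff, rule_format, OF imageI[OF this]] show ?thesis
        by (simp only: model_def not_False_eq_True)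
    qed
    show "h (t, w) \<notin> unit_ball (hu M) \<times> unit_sphere (hs M)"
      if "0 \<le> t" "t \<le> 1" "w \<in> unit_ball (hu M) \<times> unit_ball (hs N)" for t w
    proof -
      have "(t, w) \<in> {0..1} \<times> model N" using that hu by (auto simp: model_def)
      from hp[unfolded disjoint_iff, rule_format, OF imageI[OF this]] show ?thesis
        by (simp only: model_plus_def not_False_eq_True)
    qed
    show "h (1, (p, q)) = (A p, zvec)" if "p \<in> unit_ball (hu M)" "q \<in> unit_ball (hs N)" for p q
      using h1 that hu by (simp add: model_def)
  qed (use Ao deg hu in auto)
  then show ?thesis
  proof (rule reaches_mono)
    fix p' q' assume "\<exists>p\<in>unit_ball (hu M). \<exists>q\<in>unit_ball (hs N).
      (\<exists>x\<in>hsupp N. hchart N x = (p, q) \<and> S x) \<and> h (0, (p, q)) = (p', q')"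
    then obtain p q x where x: "x \<in> hsupp N" "hchart N x = (p, q)" "S x" and hpq: "h (0, (p, q)) = (p', q')"
      by blast
    have "(p, q) \<in> model N" using x N by force
    then have "in_charts N M F (p, q) = (p', q')" using h0 hpq by force
    moreover have "inv_into (hsupp N) (hchart N) (p, q) = x"
      using inv_into_f_f[OF N(1) x(1)] x(2) by simp
    ultimately show "\<exists>x\<in>hsupp N. S x \<and> hchart M (F x) = (p', q')"
      using x by (auto simp: in_charts_def)
  qed
qed

text \<open>
  A point of the domain of a chart whose coordinates lie in the model lies in the h-set, because the
  chart is injective on its whole domain.
\<close>

lemma reaches_covers_chain:
  assumes H: "\<And>i. i \<le> m \<Longrightarrow> is_hset (H i)"
    and cov: "\<And>i. i < m \<Longrightarrow> covers (F i) (H i) (H (Suc i))" and last: "covers (F m) (H m) M"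
  shows "reaches (hu M) (hs M) (\<lambda>p q. \<exists>w. (\<forall>j\<le>m. w j \<in> hsupp (H j)) \<and>
           (\<forall>j<m. w (Suc j) = F j (w j)) \<and> hchart M (F m (w m)) = (p, q))"
proof -
  define S where "S i x \<longleftrightarrow> (\<exists>w. w i = x \<and> (\<forall>j\<le>i. w j \<in> hsupp (H j)) \<and> (\<forall>j<i. w (Suc j) = F j (w j)))" for i x
  have inj: "inj_on (hchart (H i)) (hsupp (H i))" "hchart (H i) ` hsupp (H i) = model (H i)"
    "hsupp (H i) \<subseteq> hdom (H i)" if "i \<le> m" for i
    using H[OF that] is_hset_inj_on[OF H[OF that]] by (auto simp: is_hset_def intro: inj_on_subset)
  have "i \<le> m \<Longrightarrow> reaches (hu (H i)) (hs (H i)) (\<lambda>p q. \<exists>x\<in>hsupp (H i). hchart (H i) x = (p, q) \<and> S i x)" for i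
  proof (induction i)
    case 0
    show ?case
    proof (rule reaches_start)
      fix p assume "p \<in> unit_ball (hu (H 0))"
      then have "(p, zvec) \<in> hchart (H 0) ` hsupp (H 0)"
        unfolding inj(2)[OF 0] by (simp add: model_def unit_ball_iff)
      then obtain x where x: "x \<in> hsupp (H 0)" "hchart (H 0) x = (p, zvec)" by force
      then have "S 0 x" unfolding S_def by (intro exI[of _ "\<lambda>_. x"]) auto
      then show "\<exists>x\<in>hsupp (H 0). hchart (H 0) x = (p, zvec) \<and> S 0 x" using x by blast
    qed
  next
    case (Suc i)
    then have i: "i < m" "i \<le> m" by auto
    have "reaches (hu (H (Suc i))) (hs (H (Suc i)))
        (\<lambda>p q. \<exists>x\<in>hsupp (H i). S i x \<and> hchart (H (Suc i)) (F i x) = (p, q))"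
      by (rule reaches_covers[OF cov[OF i(1)] inj(1,2)[OF i(2)] Suc.IH[OF i(2)]])
    then show ?case
    proof (rule reaches_mono)
      fix p q assume pq: "p \<in> unit_ball (hu (H (Suc i)))" "q \<in> unit_ball (hs (H (Suc i)))"
        and "\<exists>x\<in>hsupp (H i). S i x \<and> hchart (H (Suc i)) (F i x) = (p, q)"
      then obtain x where x: "x \<in> hsupp (H i)" "S i x" "hchart (H (Suc i)) (F i x) = (p, q)" by blast
      from x(2) obtain w where w: "w i = x" "\<forall>j\<le>i. w j \<in> hsupp (H j)" "\<forall>j<i. w (Suc j) = F j (w j)"
        unfolding S_def by blast
      have "(p, q) \<in> hchart (H (Suc i)) ` hsupp (H (Suc i))"
        unfolding inj(2)[OF Suc.prems] using pq by (simp add: model_def)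
      then obtain y where y: "y \<in> hsupp (H (Suc i))" "hchart (H (Suc i)) y = (p, q)" by force
      have fx: "F i x \<in> hdom (H (Suc i))"
      proof -
        have "F i ` hsupp (H i) \<subseteq> hdom (H (Suc i))"
          using cov[OF i(1)] unfolding covers_def by (elim conjE)
        then show ?thesis using x(1) by blast
      qed
      have "F i x = y"
        by (rule inj_onD[OF is_hset_inj_on[OF H[OF Suc.prems]]])
           (use fx y inj(3)[OF Suc.prems] x(3) in auto)
      then have "S (Suc i) y"
        unfolding S_def
      proof (intro exI[of _ "w(Suc i := y)"] conjI allI impI)
        fix j assume "j \<le> Suc i"
        then show "(w(Suc i := y)) j \<in> hsupp (H j)" using w(2) y(1) by (cases "j = Suc i") auto
      next
        fix j assume "j < Suc i"
        then show "(w(Suc i := y)) (Suc j) = F j ((w(Suc i := y)) j)"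
          using w \<open>F i x = y\<close> by (cases "j = i") auto
      qed simp
      then show "\<exists>x\<in>hsupp (H (Suc i)). hchart (H (Suc i)) x = (p, q) \<and> S (Suc i) x"
        using y by blast
    qed
  qed
  then have "reaches (hu M) (hs M) (\<lambda>p q. \<exists>x\<in>hsupp (H m). S m x \<and> hchart M (F m x) = (p, q))"
    by (intro reaches_covers[OF last inj(1,2)[OF order_refl]]) simp
  then show ?thesis
    by (rule reaches_mono) (auto simp: S_def)
qed

section \<open>Flows with parameters\<close>

lemma integral_exp_bound:
  fixes L :: real assumes "L > 0" "0 \<le> t"
  shows "(\<lambda>s. exp (2 * L * s)) integrable_on {0..t}"
    "integral {0..t} (\<lambda>s. exp (2 * L * s)) \<le> exp (2 * L * t) / (2 * L)"
proof -
  have "((\<lambda>s. exp (2 * L * s)) has_integral (exp (2 * L * t) / (2 * L) - exp (2 * L * 0) / (2 * L))) {0..t}"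
    using assms by (intro fundamental_theorem_of_calculus)
      (auto intro!: derivative_eq_intros simp: has_real_derivative_iff_has_vector_derivative[symmetric])
  then show "(\<lambda>s. exp (2 * L * s)) integrable_on {0..t}"
    "integral {0..t} (\<lambda>s. exp (2 * L * s)) \<le> exp (2 * L * t) / (2 * L)"
    using assms by (auto simp: has_integral_iff)
qed

text \<open>
  Picard iteration. Measured with the weight \<open>exp (2 L t)\<close>, successive iterates approach each other by
  the factor \<open>1/2\<close>, so they converge uniformly on every bounded time interval at once. Joint
  continuity in time and parameter passes from the iterates to the limit.
\<close>

lemma global_flow_with_parameters:
  fixes G :: "'a::euclidean_space \<times> 'b::metric_space \<Rightarrow> 'a" and init :: "'b \<Rightarrow> 'a"
  assumes G: "continuous_on (UNIV \<times> W) G" and init: "continuous_on W init"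
    and B: "\<And>x w. w \<in> W \<Longrightarrow> norm (G (x, w)) \<le> B"
    and L: "L > 0" "\<And>x y w. w \<in> W \<Longrightarrow> norm (G (x, w) - G (y, w)) \<le> L * norm (x - y)"
  obtains \<psi> :: "real \<Rightarrow> 'b \<Rightarrow> 'a" where
    "\<And>T. continuous_on ({0..T} \<times> W) (\<lambda>(t, w). \<psi> t w)"
    "\<And>w. w \<in> W \<Longrightarrow> \<psi> 0 w = init w"
    "\<And>w T t. w \<in> W \<Longrightarrow> 0 \<le> t \<Longrightarrow> t \<le> T \<Longrightarrow>
       ((\<lambda>t. \<psi> t w) has_vector_derivative G (\<psi> t w, w)) (at t within {0..T})"
proof -
  define step where "step X = (\<lambda>(t, w). init w + integral {0..t} (\<lambda>s. G (X (s, w), w)))" for X :: "real \<times> 'b \<Rightarrow> 'a"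
  define X where "X n = (step ^^ n) (\<lambda>(t, w). init w)" for n
  have X0: "X 0 = (\<lambda>(t, w). init w)" and XS: "X (Suc n) = step (X n)" for n by (auto simp: X_def)
  have c0: "continuous_on ({0..T} \<times> W) (X n)" for T n
  proof (induction n)
    case 0
    show ?case unfolding X0 case_prod_unfold
      by (rule continuous_on_compose2[OF init continuous_on_snd[OF continuous_on_id]]) auto
  next
    case (Suc n)
    show ?case
    proof (cases "0 \<le> T")
      case True
      \<comment> \<open>substitute \<open>s = t r\<close>, so that the interval of integration does not move with \<open>t\<close>\<close>
      have "continuous_on (({0..T} \<times> W) \<times> cbox 0 (1::real)) (\<lambda>z. G (X n (snd z * fst (fst z), snd (fst z)), snd (fst z)))"
      proof (rule continuous_on_compose2[OF G])
        show "continuous_on (({0..T} \<times> W) \<times> cbox 0 (1::real)) (\<lambda>z. (X n (snd z * fst (fst z), snd (fst z)), snd (fst z)))"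
          by (intro continuous_intros continuous_on_compose2[OF Suc.IH])
             (auto intro: mult_nonneg_nonneg order_trans[OF mult_left_le_one_le])
      qed auto
      then have "continuous_on ({0..T} \<times> W) (\<lambda>z. integral (cbox 0 1) (\<lambda>s. G (X n (s * fst z, snd z), snd z)))"
        using integral_continuous_on_param[of "{0..T} \<times> W" 0 1 "\<lambda>z s. G (X n (s * fst z, snd z), snd z)"]
        by (simp add: case_prod_unfold)
      then have *: "continuous_on ({0..T} \<times> W) (\<lambda>z. init (snd z) + fst z *\<^sub>R integral (cbox 0 1) (\<lambda>s. G (X n (s * fst z, snd z), snd z)))"
        by (intro continuous_intros continuous_on_compose2[OF init]) auto
      show ?thesis
      proof (rule continuous_on_eq[OF *])
        fix z assume z: "z \<in> {0..T} \<times> W"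
        obtain t w where tw: "z = (t, w)" "0 \<le> t" "t \<le> T" "w \<in> W" using z by auto
        have "integral {0..t} (\<lambda>s. G (X n (s, w), w)) = t *\<^sub>R integral {0..1} (\<lambda>s. G (X n (s * t, w), w))"
        proof (cases "t = 0")
          case False
          then have t: "t > 0" using tw by simp
          have "continuous_on {0..t} (\<lambda>s. G (X n (s, w), w))"
          proof (rule continuous_on_compose2[OF G])
            show "continuous_on {0..t} (\<lambda>s. (X n (s, w), w))"
              by (intro continuous_intros continuous_on_compose2[OF Suc.IH]) (use tw in auto)
          qed (use tw in auto)
          then have "(\<lambda>s. G (X n (s, w), w)) integrable_on cbox 0 t"
            by (simp add: integrable_continuous_interval)
          then have "((\<lambda>s. G (X n (s, w), w)) has_integral integral {0..t} (\<lambda>s. G (X n (s, w), w))) (cbox 0 t)"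
            by (simp add: integrable_integral)
          from has_integral_affinity[OF this, of t 0] t
          have "((\<lambda>s. G (X n (t * s, w), w)) has_integral (1 / t) *\<^sub>R integral {0..t} (\<lambda>s. G (X n (s, w), w))) {0..1}"
            by (simp add: field_simps)
          then have "integral {0..1} (\<lambda>s. G (X n (s * t, w), w)) = (1 / t) *\<^sub>R integral {0..t} (\<lambda>s. G (X n (s, w), w))"
            by (simp add: integral_unique mult.commute)
          then show ?thesis using t by simp
        qed simp
        then show "init (snd z) + fst z *\<^sub>R integral (cbox 0 1) (\<lambda>s. G (X n (s * fst z, snd z), snd z)) = X (Suc n) z"
          by (simp add: XS step_def tw)
      qed
    qed simp
  qed
  have cs: "continuous_on {0..t} (\<lambda>s. G (X n (s, w), w))" if "w \<in> W" for t n w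
  proof (rule continuous_on_compose2[OF G])
    show "continuous_on {0..t} (\<lambda>s. (X n (s, w), w))"
      by (intro continuous_intros continuous_on_compose2[OF c0[of t]]) (use that in auto)
  qed (use that in auto)
  have int: "(\<lambda>s. G (X n (s, w), w)) integrable_on {0..t}" if "w \<in> W" for t n w
    by (rule integrable_continuous_interval[OF cs[OF that]])
  have B0: "0 \<le> B" if "w \<in> W" for w using B[OF that, of undefined] norm_ge_zero order_trans by blast
  define C where "C = B / L"
  have bound: "norm (X (Suc n) (t, w) - X n (t, w)) \<le> C * exp (2 * L * t) * (1/2) ^ n"
    if w: "w \<in> W" and t: "0 \<le> t" for n t w
    using t
  proof (induction n arbitrary: t)
    case 0
    have "norm (X (Suc 0) (t, w) - X 0 (t, w)) = norm (integral {0..t} (\<lambda>s. G (X 0 (s, w), w)))"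
      by (simp add: XS X0 step_def)
    also have "\<dots> \<le> integral {0..t} (\<lambda>s. B)"
      by (rule integral_norm_bound_integral) (use int[OF w] B[OF w] in auto)
    also have "\<dots> = C * (L * t)" using 0 L by (simp add: C_def)
    also have "\<dots> \<le> C * exp (2 * L * t)"
    proof (rule mult_left_mono)
      have "L * t \<le> 2 * L * t" using L 0 by simp
      also have "\<dots> \<le> exp (2 * L * t)" using exp_ge_add_one_self[of "2 * L * t"] by linarith
      finally show "L * t \<le> exp (2 * L * t)" .
      show "0 \<le> C" using B0[OF w] L by (simp add: C_def)
    qed
    finally show ?case by simp
  next
    case (Suc n)
    have C: "0 \<le> C" using B0[OF w] L by (simp add: C_def)
    have "X (Suc (Suc n)) (t, w) - X (Suc n) (t, w)
        = integral {0..t} (\<lambda>s. G (X (Suc n) (s, w), w)) - integral {0..t} (\<lambda>s. G (X n (s, w), w))"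
      by (simp only: XS step_def) simp
    also have "\<dots> = integral {0..t} (\<lambda>s. G (X (Suc n) (s, w), w) - G (X n (s, w), w))"
      by (rule integral_diff[symmetric, OF int[OF w] int[OF w]])
    also have "norm \<dots> \<le> integral {0..t} (\<lambda>s. (L * C * (1/2) ^ n) * exp (2 * L * s))"
    proof (rule integral_norm_bound_integral)
      show "(\<lambda>s. G (X (Suc n) (s, w), w) - G (X n (s, w), w)) integrable_on {0..t}"
        by (intro integrable_diff int w)
      show "(\<lambda>s. (L * C * (1/2) ^ n) * exp (2 * L * s)) integrable_on {0..t}"
        by (intro integrable_on_mult_right integral_exp_bound L Suc.prems)
      fix s assume "s \<in> {0..t}"
      then have "L * norm (X (Suc n) (s, w) - X n (s, w)) \<le> L * (C * exp (2 * L * s) * (1/2) ^ n)"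
        using Suc.IH[of s] L by (intro mult_left_mono) auto
      then show "norm (G (X (Suc n) (s, w), w) - G (X n (s, w), w)) \<le> (L * C * (1/2) ^ n) * exp (2 * L * s)"
        using L(2)[OF w, of "X (Suc n) (s, w)" "X n (s, w)"] by (simp add: algebra_simps)
    qed
    also have "\<dots> = (L * C * (1/2) ^ n) * integral {0..t} (\<lambda>s. exp (2 * L * s))"
      by simp
    also have "\<dots> \<le> (L * C * (1/2) ^ n) * (exp (2 * L * t) / (2 * L))"
      using integral_exp_bound(2)[OF L(1) Suc.prems] C L by (intro mult_left_mono) auto
    also have "\<dots> = C * exp (2 * L * t) * (1/2) ^ Suc n"
      using L by simp
    finally show ?case .
  qed
  define D where "D n z = X (Suc n) z - X n z" for n z
  have Xsum: "X n z = X 0 z + (\<Sum>i<n. D i z)" for n z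
    by (induction n) (auto simp: D_def)
  define \<psi> where "\<psi> t w = X 0 (t, w) + suminf (\<lambda>i. D i (t, w))" for t w
  have ul: "uniform_limit ({0..T} \<times> W) X (\<lambda>(t, w). \<psi> t w) sequentially" if T: "0 \<le> T" for T
  proof -
    have "uniform_limit ({0..T} \<times> W) (\<lambda>n z. \<Sum>i<n. D i z) (\<lambda>z. suminf (\<lambda>i. D i z)) sequentially"
    proof (rule Weierstrass_m_test)
      fix n z assume "z \<in> {0..T} \<times> W"
      then obtain t w where z: "z = (t, w)" "0 \<le> t" "t \<le> T" "w \<in> W" by auto
      have C: "0 \<le> C" using B0[OF z(4)] L by (simp add: C_def)
      have "norm (D n z) \<le> C * exp (2 * L * t) * (1/2) ^ n"
        using bound[OF z(4,2)] by (simp add: D_def z)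
      also have "\<dots> \<le> C * exp (2 * L * T) * (1/2) ^ n"
        using z L C by (intro mult_right_mono mult_left_mono) auto
      finally show "norm (D n z) \<le> C * exp (2 * L * T) * (1/2) ^ n" .
    next
      show "summable (\<lambda>n. C * exp (2 * L * T) * (1/2) ^ n)"
        by (intro summable_mult summable_geometric) simp
    qed
    then have "uniform_limit ({0..T} \<times> W) (\<lambda>n z. X 0 z + (\<Sum>i<n. D i z)) (\<lambda>z. X 0 z + suminf (\<lambda>i. D i z)) sequentially"
      by (intro uniform_limit_intros)
    then show ?thesis
      by (simp add: Xsum[symmetric] \<psi>_def case_prod_unfold)
  qed
  have cont: "continuous_on ({0..T} \<times> W) (\<lambda>(t, w). \<psi> t w)" for T
  proof (cases "0 \<le> T")
    case True
    show ?thesis by (rule uniform_limit_theorem[OF _ ul[OF True]]) (auto simp: c0)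
  qed simp
  have cw: "continuous_on {0..T} (\<lambda>t. \<psi> t w)" if "w \<in> W" for w T
  proof -
    have "(\<lambda>t. (t, w)) ` {0..T} \<subseteq> {0..T} \<times> W" using that by auto
    from continuous_on_compose2[OF cont[of T] continuous_on_Pair[OF continuous_on_id continuous_on_const] this]
    show ?thesis by simp
  qed
  have cG: "continuous_on {0..T} (\<lambda>t. G (\<psi> t w, w))" if "w \<in> W" for w T
    by (rule continuous_on_compose2[OF G]) (use that cw in \<open>auto intro!: continuous_intros\<close>)
  have inteq: "\<psi> t w = init w + integral {0..t} (\<lambda>s. G (\<psi> s w, w))" if w: "w \<in> W" and t: "0 \<le> t" for t w
  proof -
    have lim: "(\<lambda>n. X n (s, w)) \<longlonglongrightarrow> \<psi> s w" if "0 \<le> s" for s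
      using tendsto_uniform_limitI[OF ul[OF that], of "(s, w)"] w that by simp
    have "uniform_limit {0..t} (\<lambda>n s. G (X n (s, w), w)) (\<lambda>s. G (\<psi> s w, w)) sequentially"
    proof (rule uniform_limitI)
      fix e :: real assume e: "e > 0"
      have "\<forall>\<^sub>F n in sequentially. \<forall>z\<in>{0..t} \<times> W. dist (X n z) (case z of (t, w) \<Rightarrow> \<psi> t w) < e / L"
        using uniform_limitD[OF ul[OF t], of "e / L"] e L by simp
      then show "\<forall>\<^sub>F n in sequentially. \<forall>s\<in>{0..t}. dist (G (X n (s, w), w)) (G (\<psi> s w, w)) < e"
      proof eventually_elim
        case (elim n)
        show ?case
        proof
          fix s assume "s \<in> {0..t}"
          then have "dist (X n (s, w)) (\<psi> s w) < e / L" using elim w by force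
          then have "L * norm (X n (s, w) - \<psi> s w) < e" using L by (simp add: dist_norm field_simps)
          then show "dist (G (X n (s, w), w)) (G (\<psi> s w, w)) < e"
            using L(2)[OF w, of "X n (s, w)" "\<psi> s w"] by (simp add: dist_norm)
        qed
      qed
    qed
    then have "(\<lambda>n. integral {0..t} (\<lambda>s. G (X n (s, w), w))) \<longlonglongrightarrow> integral {0..t} (\<lambda>s. G (\<psi> s w, w))"
    proof (rule uniform_limit_integral[OF _ cs[OF w] sequentially_bot])
      fix I J
      assume I: "\<And>n. ((\<lambda>s. G (X n (s, w), w)) has_integral I n) {0..t}"
        and J: "((\<lambda>s. G (\<psi> s w, w)) has_integral J) {0..t}" "I \<longlonglongrightarrow> J"
      have "(\<lambda>n. integral {0..t} (\<lambda>s. G (X n (s, w), w))) = I"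
        by (intro ext integral_unique I)
      then show ?thesis using J by (simp add: integral_unique)
    qed
    then have "(\<lambda>n. X (Suc n) (t, w)) \<longlonglongrightarrow> init w + integral {0..t} (\<lambda>s. G (\<psi> s w, w))"
      by (simp add: XS step_def tendsto_add)
    with LIMSEQ_Suc[OF lim[OF t]] show ?thesis by (rule LIMSEQ_unique)
  qed
  show ?thesis
  proof (rule that[OF cont])
    show "\<psi> 0 w = init w" if "w \<in> W" for w using inteq[OF that, of 0] by simp
    fix t T :: real and w :: 'b assume w: "w \<in> W" and t: "0 \<le> t" "t \<le> T"
    have "((\<lambda>u. integral {0..u} (\<lambda>s. G (\<psi> s w, w))) has_vector_derivative G (\<psi> t w, w)) (at t within {0..T})"
      using integral_has_vector_derivative[OF cG[OF w], of t] t by simp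
    then have "((\<lambda>u. init w + integral {0..u} (\<lambda>s. G (\<psi> s w, w))) has_vector_derivative G (\<psi> t w, w)) (at t within {0..T})"
      using has_vector_derivative_add[OF has_vector_derivative_const] by fastforce
    then show "((\<lambda>t. \<psi> t w) has_vector_derivative G (\<psi> t w, w)) (at t within {0..T})"
      by (rule has_vector_derivative_transform[rotated 2]) (use t inteq[OF w] in auto)
  qed
qed

section \<open>Barriers on the line\<close>

lemma increase_at_least:
  fixes f :: "real \<Rightarrow> real"
  assumes "a \<le> b" and der: "\<And>t. a \<le> t \<Longrightarrow> t \<le> b \<Longrightarrow> (f has_real_derivative f' t) (at t within {a..b})"
    and k: "\<And>t. a \<le> t \<Longrightarrow> t \<le> b \<Longrightarrow> k \<le> f' t"
  shows "f a + k * (b - a) \<le> f b"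
proof -
  obtain t where t: "t \<in> {a..b}" "f b - f a = f' t * (b - a)"
    using mvt_very_simple[of a b f "\<lambda>t h. f' t * h"] assms(1) der by (auto simp: has_field_derivative_def)
  have "k * (b - a) \<le> f' t * (b - a)"
    using k[of t] t assms(1) by (intro mult_right_mono) auto
  then show ?thesis using t by linarith
qed

lemma first_crossing:
  fixes f :: "real \<Rightarrow> real"
  assumes cont: "continuous_on {a..b} f" and ab: "a \<le> b" and fa: "k < f a" and fb: "f b \<le> k"
  obtains s where "a < s" "s \<le> b" "f s = k" "\<And>u. a \<le> u \<Longrightarrow> u < s \<Longrightarrow> k < f u"
proof -
  define S where "S = {x \<in> {a..b}. f x = k}"
  have "closed S"
    unfolding S_def by (rule continuous_closed_preimage_constant[OF cont]) simp
  then have "compact ({a..b} \<inter> S)" by (rule compact_Int_closed[OF compact_Icc])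
  moreover have "{a..b} \<inter> S = S" by (auto simp: S_def)
  ultimately have "compact S" by simp
  moreover have "S \<noteq> {}"
    using IVT2'[of f b k a] fa fb ab cont by (auto simp: S_def)
  ultimately obtain s where s: "s \<in> S" "\<And>x. x \<in> S \<Longrightarrow> s \<le> x"
    using compact_attains_inf by metis
  have "k < f u" if u: "a \<le> u" "u < s" for u
  proof (rule ccontr)
    assume "\<not> k < f u"
    then obtain x where "a \<le> x" "x \<le> u" "f x = k"
      using IVT2'[of f u k a] fa u s(1) continuous_on_subset[OF cont, of "{a..u}"] by (auto simp: S_def)
    then have "x \<in> S" using u s(1) by (auto simp: S_def)
    then show False using s(2) \<open>x \<le> u\<close> u by force
  qed
  moreover have "a < s" using s(1) fa by (cases "a = s") (auto simp: S_def)
  ultimately show thesis using s(1) that[of s] by (auto simp: S_def)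
qed

text \<open>
  After the last time at level \<open>k\<close> the function would be below \<open>k\<close>, although its derivative is positive
  there.
\<close>

lemma barrier_above:
  fixes f :: "real \<Rightarrow> real"
  assumes ab: "a \<le> t" "t \<le> b" and fa: "k \<le> f a"
    and der: "\<And>t. a \<le> t \<Longrightarrow> t \<le> b \<Longrightarrow> (f has_real_derivative f' t) (at t within {a..b})"
    and pos: "\<And>t. a \<le> t \<Longrightarrow> t \<le> b \<Longrightarrow> f t = k \<Longrightarrow> 0 < f' t"
  shows "k \<le> f t"
proof (rule ccontr)
  assume lt: "\<not> k \<le> f t"
  have cont: "continuous_on {a..b} f"
    using der by (intro DERIV_continuous_on) auto
  have "continuous_on {a..t} (\<lambda>x. - f (a + t - x))"
    by (intro continuous_intros continuous_on_compose2[OF cont]) (use ab in auto)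
  then obtain s where s: "a < s" "s \<le> t" "- f (a + t - s) = - k"
    and less: "\<And>u. a \<le> u \<Longrightarrow> u < s \<Longrightarrow> - k < - f (a + t - u)"
    by (rule first_crossing[of a t "\<lambda>x. - f (a + t - x)" "- k"]) (use lt fa ab in auto)
  define r where "r = a + t - s"
  have r: "a \<le> r" "r < t" "f r = k" using s by (auto simp: r_def)
  obtain d where d: "d > 0" "\<And>h. 0 < h \<Longrightarrow> r + h \<in> {a..b} \<Longrightarrow> h < d \<Longrightarrow> f r < f (r + h)"
    using has_real_derivative_pos_inc_right[OF der pos] r ab by (metis less_le_trans less_imp_le)
  define h where "h = min (d / 2) (t - r)"
  have h: "0 < h" "h < d" "r + h \<le> t" using d r by (auto simp: h_def min_def)
  then have "f r < f (r + h)" using d r ab by auto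
  moreover have "f (r + h) < k"
    using less[of "s - h"] h r by (auto simp: r_def algebra_simps)
  ultimately show False using r by simp
qed

section \<open>Uniqueness and the flow property\<close>

definition locally_lipschitz :: "('a::euclidean_space \<Rightarrow> 'a) \<Rightarrow> bool" where
  "locally_lipschitz X \<longleftrightarrow> (\<forall>C. compact C \<longrightarrow> (\<exists>L. \<forall>x\<in>C. \<forall>y\<in>C. norm (X x - X y) \<le> L * norm (x - y)))"

lemma solves_continuous_on: "solves X \<sigma> S \<Longrightarrow> continuous_on S \<sigma>"
  unfolding solves_def continuous_on_eq_continuous_within
  using has_vector_derivative_continuous by blast

lemma solves_subset: "solves X \<sigma> S \<Longrightarrow> T \<subseteq> S \<Longrightarrow> solves X \<sigma> T"
  unfolding solves_def using has_vector_derivative_within_subset by blast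

lemma solves_cong:
  assumes "solves X \<sigma> S" "\<And>t. t \<in> S \<Longrightarrow> \<sigma> t = \<rho> t"
  shows "solves X \<rho> S"
  unfolding solves_def
proof
  fix t assume t: "t \<in> S"
  have "(\<sigma> has_vector_derivative X (\<sigma> t)) (at t within S)" using assms t by (auto simp: solves_def)
  then show "(\<rho> has_vector_derivative X (\<rho> t)) (at t within S)"
    unfolding assms(2)[OF t]
    by (rule has_vector_derivative_transform[OF t, rotated]) (use assms(2) in auto)
qed

lemma has_real_derivative_norm_square:
  fixes \<sigma> :: "real \<Rightarrow> 'a::euclidean_space"
  assumes "(\<sigma> has_vector_derivative v) (at t within S)"
  shows "((\<lambda>t. (norm (\<sigma> t))\<^sup>2) has_real_derivative 2 * (\<sigma> t \<bullet> v)) (at t within S)"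
proof -
  have "((\<lambda>t. \<sigma> t \<bullet> \<sigma> t) has_derivative (\<lambda>h. \<sigma> t \<bullet> (h *\<^sub>R v) + (h *\<^sub>R v) \<bullet> \<sigma> t)) (at t within S)"
    using assms unfolding has_vector_derivative_def by (intro has_derivative_inner)
  then have "((\<lambda>t. \<sigma> t \<bullet> \<sigma> t) has_derivative (*) (2 * (\<sigma> t \<bullet> v))) (at t within S)"
    by (rule has_derivative_eq_rhs) (auto simp: fun_eq_iff inner_commute)
  then show ?thesis
    by (simp add: has_field_derivative_def power2_norm_eq_inner)
qed

text \<open>
  With \<open>D\<close> the squared distance, \<open>D exp (- 2 L t)\<close> decreases and \<open>D exp (2 L t)\<close> increases; this gives
  uniqueness in both directions of time. Backwards, it shows that an equilibrium is never reached in
  finite time.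
\<close>

lemma solves_unique:
  fixes X :: "'a::euclidean_space \<Rightarrow> 'a"
  assumes lip: "locally_lipschitz X" and 1: "solves X \<sigma> {0..T}" and 2: "solves X \<rho> {0..T}"
    and s: "s \<in> {0..T}" "\<sigma> s = \<rho> s" and t: "t \<in> {0..T}"
  shows "\<sigma> t = \<rho> t"
proof -
  have c: "compact (\<sigma> ` {0..T} \<union> \<rho> ` {0..T})"
    using solves_continuous_on[OF 1] solves_continuous_on[OF 2]
    by (intro compact_Un compact_continuous_image) auto
  then obtain L where L: "\<And>x y. x \<in> \<sigma> ` {0..T} \<union> \<rho> ` {0..T} \<Longrightarrow> y \<in> \<sigma> ` {0..T} \<union> \<rho> ` {0..T} \<Longrightarrow>
      norm (X x - X y) \<le> L * norm (x - y)"
    using lip unfolding locally_lipschitz_def by metis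
  define D where "D t = (norm (\<sigma> t - \<rho> t))\<^sup>2" for t
  define D' where "D' t = 2 * ((\<sigma> t - \<rho> t) \<bullet> (X (\<sigma> t) - X (\<rho> t)))" for t
  have D: "(D has_real_derivative D' t) (at t within {a..b})"
    if "t \<in> {a..b}" "0 \<le> a" "b \<le> T" for t a b
  proof -
    have "{a..b} \<subseteq> {0..T}" using that by auto
    then have "solves X \<sigma> {a..b}" "solves X \<rho> {a..b}" using 1 2 solves_subset by blast+
    then have "((\<lambda>t. \<sigma> t - \<rho> t) has_vector_derivative X (\<sigma> t) - X (\<rho> t)) (at t within {a..b})"
      using that unfolding solves_def by (intro has_vector_derivative_diff) auto
    from has_real_derivative_norm_square[OF this] show ?thesis by (simp add: D_def[abs_def] D'_def)
  qed
  have D': "\<bar>D' t\<bar> \<le> 2 * L * D t" if "t \<in> {0..T}" for t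
  proof -
    have "\<bar>(\<sigma> t - \<rho> t) \<bullet> (X (\<sigma> t) - X (\<rho> t))\<bar> \<le> norm (\<sigma> t - \<rho> t) * norm (X (\<sigma> t) - X (\<rho> t))"
      by (rule Cauchy_Schwarz_ineq2)
    also have "\<dots> \<le> norm (\<sigma> t - \<rho> t) * (L * norm (\<sigma> t - \<rho> t))"
      using that by (intro mult_left_mono L) auto
    finally show ?thesis by (simp add: D'_def D_def power2_eq_square algebra_simps abs_mult)
  qed
  have D0: "D s = 0" using s by (simp add: D_def)
  have "D t \<le> 0"
  proof (cases "s \<le> t")
    case True
    have "- (D s * exp (- (2 * L * s))) + 0 * (t - s) \<le> - (D t * exp (- (2 * L * t)))"
    proof (rule increase_at_least[OF True])
      fix u assume u: "s \<le> u" "u \<le> t"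
      show "((\<lambda>u. - (D u * exp (- (2 * L * u)))) has_real_derivative
             exp (- (2 * L * u)) * (2 * L * D u - D' u)) (at u within {s..t})"
        using u s t by (auto intro!: derivative_eq_intros D simp: algebra_simps)
      have "D' u \<le> 2 * L * D u" using D'[of u] u s t by auto
      then show "0 \<le> exp (- (2 * L * u)) * (2 * L * D u - D' u)" by simp
    qed
    then show ?thesis by (simp add: D0 mult_le_0_iff)
  next
    case False
    then have ts: "t \<le> s" by simp
    have "D t * exp (2 * L * t) + 0 * (s - t) \<le> D s * exp (2 * L * s)"
    proof (rule increase_at_least[OF ts])
      fix u assume u: "t \<le> u" "u \<le> s"
      show "((\<lambda>u. D u * exp (2 * L * u)) has_real_derivative
             exp (2 * L * u) * (2 * L * D u + D' u)) (at u within {t..s})"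
        using u s t by (auto intro!: derivative_eq_intros D simp: algebra_simps)
      have "- D' u \<le> 2 * L * D u" using D'[of u] u s t by auto
      then show "0 \<le> exp (2 * L * u) * (2 * L * D u + D' u)" by simp
    qed
    then show ?thesis by (simp add: D0 mult_le_0_iff)
  qed
  then show ?thesis by (simp add: D_def)
qed

lemma flow_eq:
  assumes lip: "locally_lipschitz X" and \<sigma>: "\<sigma> 0 = x" "solves X \<sigma> {0..T}" and t: "0 \<le> t" "t \<le> T"
  shows "flow X t x = \<sigma> t" "flow_defined X t x"
proof -
  have st: "solves X \<sigma> {0..t}" using \<sigma>(2) t by (rule_tac solves_subset) auto
  show "flow_defined X t x" unfolding flow_defined_def using st \<sigma> t by blast
  show "flow X t x = \<sigma> t"
    unfolding flow_def
  proof (rule the_equality)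
    show "\<exists>\<rho>. \<rho> 0 = x \<and> solves X \<rho> {0..t} \<and> \<rho> t = \<sigma> t" using st \<sigma> by blast
    fix y assume "\<exists>\<rho>. \<rho> 0 = x \<and> solves X \<rho> {0..t} \<and> \<rho> t = y"
    then show "y = \<sigma> t" using solves_unique[OF lip _ st, of _ 0 t] \<sigma> t by auto
  qed
qed

lemma flow_defined_solves:
  assumes lip: "locally_lipschitz X" and fd: "flow_defined X T x"
  shows "solves X (\<lambda>t. flow X t x) {0..T}" "flow X 0 x = x"
proof -
  obtain \<sigma> where \<sigma>: "\<sigma> 0 = x" "solves X \<sigma> {0..T}" and T: "0 \<le> T" using fd by (auto simp: flow_defined_def)
  show "solves X (\<lambda>t. flow X t x) {0..T}"
    by (rule solves_cong[OF \<sigma>(2)]) (use flow_eq(1)[OF lip \<sigma>] in auto)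
  show "flow X 0 x = x" using flow_eq(1)[OF lip \<sigma>, of 0] T \<sigma> by simp
qed

lemma flow_add:
  assumes lip: "locally_lipschitz X" and 1: "flow_defined X s x" and 2: "flow_defined X t (flow X s x)"
  shows "flow_defined X (s + t) x" "flow X (s + t) x = flow X t (flow X s x)"
proof -
  have s: "0 \<le> s" and t: "0 \<le> t" using 1 2 by (auto simp: flow_defined_def)
  note S1 = flow_defined_solves[OF lip 1] and S2 = flow_defined_solves[OF lip 2]
  define \<sigma> where "\<sigma> u = (if u \<in> {0..s} then flow X u x else flow X (u - s) (flow X s x))" for u
  have "solves X \<sigma> {0..s + t}"
    unfolding solves_def
  proof
    fix u assume u: "u \<in> {0..s + t}"
    have cl: "closure {0..s} \<inter> closure {s..s + t} = {s}" using s t by auto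
    have sh: "((\<lambda>u. flow X (u - s) (flow X s x)) has_vector_derivative X (flow X (u - s) (flow X s x))) (at u within {s..s + t})"
      if "u \<in> {s..s + t}"
    proof -
      have "((\<lambda>v. flow X v (flow X s x)) has_vector_derivative X (flow X (u - s) (flow X s x))) (at (u - s) within {0..t})"
        using S2 that by (auto simp: solves_def)
      moreover have "((\<lambda>u. u - s) has_vector_derivative 1) (at u within {s..s + t})"
        by (auto intro!: derivative_eq_intros)
      moreover have "(\<lambda>u. u - s) ` {s..s + t} \<subseteq> {0..t}" by auto
      ultimately show ?thesis
        using vector_diff_chain_within[of "\<lambda>u. u - s" 1 u "{s..s + t}" "\<lambda>v. flow X v (flow X s x)"]
          has_vector_derivative_within_subset by (fastforce simp: o_def)
    qed
    have "(\<sigma> has_vector_derivative (if u \<in> {0..s} then X (flow X u x) else X (flow X (u - s) (flow X s x))))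
        (at u within {0..s + t})"
      unfolding \<sigma>_def
    proof (rule has_vector_derivative_If_within_closures[where T = "{s..s + t}"])
      show "u \<in> {0..s} \<union> {s..s + t}" "{0..s + t} = {0..s} \<union> {s..s + t}" using u s t by auto
      show "((\<lambda>u. flow X u x) has_vector_derivative X (flow X u x)) (at u within {0..s} \<union> closure {0..s} \<inter> closure {s..s + t})"
        if "u \<in> {0..s} \<union> closure {0..s} \<inter> closure {s..s + t}"
        using that S1 s unfolding cl by (auto simp: solves_def insert_absorb)
      show "((\<lambda>u. flow X (u - s) (flow X s x)) has_vector_derivative X (flow X (u - s) (flow X s x)))
          (at u within {s..s + t} \<union> closure {0..s} \<inter> closure {s..s + t})"
        if "u \<in> {s..s + t} \<union> closure {0..s} \<inter> closure {s..s + t}"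
        using that sh t unfolding cl by (auto simp: insert_absorb)
    qed (use S2 in auto)
    moreover have "X (\<sigma> u) = (if u \<in> {0..s} then X (flow X u x) else X (flow X (u - s) (flow X s x)))"
      by (simp add: \<sigma>_def)
    ultimately show "(\<sigma> has_vector_derivative X (\<sigma> u)) (at u within {0..s + t})" by simp
  qed
  moreover have "\<sigma> 0 = x" using S1 s by (simp add: \<sigma>_def)
  moreover have "\<sigma> (s + t) = flow X t (flow X s x)"
    using S2 t s by (cases "t = 0") (auto simp: \<sigma>_def)
  ultimately show "flow_defined X (s + t) x" "flow X (s + t) x = flow X t (flow X s x)"
    using flow_eq[OF lip, of \<sigma> x "s + t" "s + t"] s t by auto
qed

lemma flow_shift:
  assumes lip: "locally_lipschitz X" and fd: "flow_defined X (s + t) x" and st: "0 \<le> s" "0 \<le> t"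
  shows "flow_defined X t (flow X s x)" "flow X t (flow X s x) = flow X (s + t) x"
proof -
  note S = flow_defined_solves[OF lip fd]
  have "solves X (\<lambda>u. flow X (s + u) x) {0..t}"
    unfolding solves_def
  proof
    fix u assume u: "u \<in> {0..t}"
    have "(flow X \<circ> (+) s) = (\<lambda>u. flow X (s + u))" by (simp add: o_def)
    have "((\<lambda>v. flow X v x) has_vector_derivative X (flow X (s + u) x)) (at (s + u) within {0..s + t})"
      using S(1) u st by (auto simp: solves_def)
    then have "((\<lambda>v. flow X v x) has_vector_derivative X (flow X (s + u) x)) (at (s + u) within (+) s ` {0..t})"
      by (rule has_vector_derivative_within_subset) (use st in auto)
    moreover have "((+) s has_vector_derivative 1) (at u within {0..t})"
      by (auto intro!: derivative_eq_intros)
    ultimately show "((\<lambda>u. flow X (s + u) x) has_vector_derivative X (flow X (s + u) x)) (at u within {0..t})"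
      using vector_diff_chain_within[of "(+) s" 1 u "{0..t}" "\<lambda>v. flow X v x"] by (simp add: o_def)
  qed
  from flow_eq[OF lip _ this, of "flow X s x" t] st
  show "flow_defined X t (flow X s x)" "flow X t (flow X s x) = flow X (s + t) x" by auto
qed

lemma flow_defined_mono: "flow_defined X T x \<Longrightarrow> 0 \<le> t \<Longrightarrow> t \<le> T \<Longrightarrow> flow_defined X t x"
  unfolding flow_defined_def using solves_subset by (metis atLeastatMost_subset_iff order_refl)

lemma local_stable_set_forward:
  assumes lip: "locally_lipschitz X" and x: "x \<in> local_stable_set X N p" and s: "0 \<le> s"
  shows "flow X s x \<in> local_stable_set X N p"
proof -
  have fd: "flow_defined X t x" "flow X t x \<in> N" if "0 \<le> t" for t
    using x that by (auto simp: local_stable_set_def)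
  have sh: "flow_defined X t (flow X s x)" "flow X t (flow X s x) = flow X (s + t) x" if "0 \<le> t" for t
    using flow_shift[OF lip fd(1) s that] s that by auto
  have "filterlim (\<lambda>t. flow X t x) (nhds p) at_top" using x by (simp add: local_stable_set_def)
  then have "filterlim (\<lambda>t. flow X (s + t) x) (nhds p) at_top"
    by (rule filterlim_compose) (rule filterlim_tendsto_add_at_top[OF tendsto_const filterlim_ident])
  then have "filterlim (\<lambda>t. flow X t (flow X s x)) (nhds p) at_top"
    by (rule filterlim_cong[THEN iffD1, OF refl refl, rotated])
       (use sh(2) in \<open>auto simp: eventually_at_top_linorder intro!: exI[of _ 0]\<close>)
  then show ?thesis using sh fd s by (auto simp: local_stable_set_def)
qed

section \<open>Dynamics in the block\<close>

lemma linear_part: "linear (part S)"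
  by (auto simp: linear_iff part_def vec_eq_iff)

lemma bounded_linear_part: "bounded_linear (part S)"
  by (rule linear_conv_bounded_linear[THEN iffD1, OF linear_part])

lemma part_add_compl: "part U z + part (- U) z = z"
  by (simp add: part_def vec_eq_iff)

lemma part_part [simp]: "part S (part S z) = part S z"
  by (simp add: part_def vec_eq_iff)

lemma part_part_compl [simp]: "part S (part (- S) z) = 0" "part (- S) (part S z) = 0"
  by (simp_all add: part_def vec_eq_iff)

lemma part_scaleR: "part S (c *\<^sub>R z) = c *\<^sub>R part S z"
  by (simp add: part_def vec_eq_iff)

lemma part_add: "part S (x + y) = part S x + part S y"
  by (simp add: part_def vec_eq_iff)

lemma part_diff: "part S (x - y) = part S x - part S y"
  by (simp add: part_def vec_eq_iff)

lemma inner_part: "part S x \<bullet> part S y = part S x \<bullet> y"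
  by (auto simp: part_def inner_vec_def intro!: sum.cong)

lemma inner_part_compl: "part S x \<bullet> part (- S) y = 0"
  by (auto simp: part_def inner_vec_def intro!: sum.neutral)

lemma norm_square_parts: "(norm z)\<^sup>2 = (norm (part U z))\<^sup>2 + (norm (part (- U) z))\<^sup>2"
proof -
  have "(norm (part U z + part (- U) z))\<^sup>2 = (norm (part U z))\<^sup>2 + (norm (part (- U) z))\<^sup>2"
    by (rule norm_add_Pythagorean) (simp add: orthogonal_def inner_part_compl)
  then show ?thesis by (simp add: part_add_compl)
qed

lemma norm_part_le: "norm (part S z) \<le> norm z"
proof -
  have "(norm (part S z))\<^sup>2 \<le> (norm z)\<^sup>2" unfolding norm_square_parts[of z S] by simp
  then show ?thesis by (rule power2_le_imp_le) simp
qed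

definition unit_clip :: "'a::real_normed_vector \<Rightarrow> 'a" where
  "unit_clip x = inverse (max 1 (norm x)) *\<^sub>R x"

lemma unit_clip_lipschitz: "norm (unit_clip x - unit_clip y) \<le> 2 * norm (x - y)"
proof -
  let ?m = "max 1 (norm x)" and ?n = "max 1 (norm y)"
  have "unit_clip x - unit_clip y = inverse ?m *\<^sub>R (x - y) + (inverse ?m - inverse ?n) *\<^sub>R y"
    by (simp add: unit_clip_def algebra_simps)
  then have "norm (unit_clip x - unit_clip y) \<le> norm (inverse ?m *\<^sub>R (x - y)) + norm ((inverse ?m - inverse ?n) *\<^sub>R y)"
    using norm_triangle_ineq by metis
  moreover have "norm (inverse ?m *\<^sub>R (x - y)) \<le> norm (x - y)"
    by (simp add: mult_left_le_one_le inverse_le_1_iff)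
  moreover have "norm ((inverse ?m - inverse ?n) *\<^sub>R y) \<le> norm (x - y)"
  proof -
    have "inverse ?m - inverse ?n = (?n - ?m) / (?m * ?n)" by (simp add: field_simps)
    then have "norm ((inverse ?m - inverse ?n) *\<^sub>R y) = \<bar>?n - ?m\<bar> * (norm y / (?m * ?n))"
      by (simp add: abs_mult)
    also have "\<dots> \<le> \<bar>?n - ?m\<bar> * 1"
    proof (rule mult_left_mono)
      have "norm y \<le> 1 * ?n" by simp
      also have "\<dots> \<le> ?m * ?n" by (rule mult_right_mono) auto
      finally show "norm y / (?m * ?n) \<le> 1" by (simp add: divide_le_eq)
    qed simp
    also have "\<dots> \<le> norm (x - y)" using norm_triangle_ineq3[of x y] by (auto simp: max_def abs_if split: if_splits)
    finally show ?thesis .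
  qed
  ultimately show ?thesis by simp
qed

lemma norm_unit_clip: "norm (unit_clip x) = min 1 (norm x)"
  by (cases "x = 0") (auto simp: unit_clip_def max_def min_def)

lemma unit_clip_id: "norm x \<le> 1 \<Longrightarrow> unit_clip x = x"
  by (simp add: unit_clip_def max_def)

text \<open>
  Clipping \<open>a\<close> and \<open>b\<close> separately keeps the direction of each of them, so the sign of \<open>a \<bullet> f\<^sup>a\<close> and of
  \<open>b \<bullet> f\<^sup>b\<close> on the faces of the box persists outside.
\<close>

definition box_retract :: "'n::finite set \<Rightarrow> real^'n \<Rightarrow> real^'n" where
  "box_retract U z = unit_clip (part U z) + unit_clip (part (- U) z)"

lemma part_unit_clip: "part S (unit_clip x) = unit_clip x" if "part S x = x"
  using that by (simp add: unit_clip_def part_scaleR)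

lemma part_box_retract:
  "part U (box_retract U z) = unit_clip (part U z)" "part (- U) (box_retract U z) = unit_clip (part (- U) z)"
proof -
  have "part U (unit_clip (part (- U) z)) = 0" "part (- U) (unit_clip (part U z)) = 0"
    by (simp_all add: unit_clip_def part_scaleR)
  then show "part U (box_retract U z) = unit_clip (part U z)"
    "part (- U) (box_retract U z) = unit_clip (part (- U) z)"
    by (simp_all add: box_retract_def part_add part_unit_clip)
qed

lemma box_retract_in_box: "box_retract U z \<in> box_ab U"
  by (simp add: box_ab_def part_box_retract norm_unit_clip)

lemma box_retract_id: "z \<in> box_ab U \<Longrightarrow> box_retract U z = z"
  by (simp add: box_ab_def box_retract_def unit_clip_id part_add_compl)

lemma box_retract_lipschitz: "norm (box_retract U x - box_retract U y) \<le> 4 * norm (x - y)"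
proof -
  have "norm (box_retract U x - box_retract U y) \<le>
      norm (unit_clip (part U x) - unit_clip (part U y)) + norm (unit_clip (part (- U) x) - unit_clip (part (- U) y))"
    unfolding box_retract_def by (metis add_diff_add norm_triangle_ineq)
  also have "\<dots> \<le> 2 * norm (part U (x - y)) + 2 * norm (part (- U) (x - y))"
    unfolding part_diff by (intro add_mono unit_clip_lipschitz)
  also have "\<dots> \<le> 4 * norm (x - y)"
    using norm_part_le[of U "x - y"] norm_part_le[of "- U" "x - y"] by simp
  finally show ?thesis .
qed

lemma continuous_on_box_retract: "continuous_on S (box_retract U)"
proof (rule continuous_on_subset[OF _ subset_UNIV])
  show "continuous_on UNIV (box_retract U)"
    by (rule lipschitz_on_continuous_on[of 4])
       (auto intro!: lipschitz_onI simp: dist_norm box_retract_lipschitz)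
qed

lemma compact_box_ab: "compact (box_ab U)"
proof -
  have "closed {z. norm (part U z) \<le> 1 \<and> norm (part (- U) z) \<le> 1}"
    by (intro closed_Collect_conj closed_Collect_le continuous_on_norm continuous_on_const
          linear_continuous_on bounded_linear_part)
  moreover have "bounded (box_ab U)"
  proof (rule boundedI)
    fix z assume "z \<in> box_ab U"
    then show "norm z \<le> 2"
      using norm_triangle_ineq[of "part U z" "part (- U) z"] by (simp add: box_ab_def part_add_compl)
  qed
  ultimately show ?thesis by (simp add: box_ab_def compact_eq_bounded_closed)
qed

lemma convex_box_ab:
  fixes U :: "'n::finite set"
  shows "convex (box_ab U)"
proof -
  have "box_ab U = {z. norm (part U z) \<le> 1} \<inter> {z. norm (part (- U) z) \<le> 1}" by (auto simp: box_ab_def)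
  moreover have "convex {z. norm (part S z) \<le> 1}" for S :: "'n set"
  proof -
    have "{z. norm (part S z) \<le> 1} = part S -` cball 0 1" by auto
    then show ?thesis using convex_linear_vimage[OF linear_part convex_cball] by metis
  qed
  ultimately show ?thesis by (simp add: convex_Int)
qed

lemma has_real_derivative_norm_part:
  assumes "(z has_vector_derivative v) (at t within S)"
  shows "((\<lambda>t. (norm (part U (z t)))\<^sup>2) has_real_derivative 2 * (part U (z t) \<bullet> v)) (at t within S)"
  using has_real_derivative_norm_square[OF bounded_linear.has_vector_derivative[OF bounded_linear_part assms]]
  by (simp add: inner_part)

text \<open>
  The flow of the field composed with the retraction. On \<open>|a| = 1\<close> the expansion estimate applies, since
  \<open>|b| \<le> 1 \<le> M |a|\<close> after clipping, and \<open>|a|\<close> increases; on \<open>|b| = 1\<close>, symmetrically, \<open>|b|\<close>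
  decreases. So the box is left only through \<open>|a| = 1\<close>, and never reentered.
\<close>

lemma block_flow:
  fixes F :: "(real^'n::finite) \<times> (real^'k::finite) \<Rightarrow> real^'n" and U :: "'n set"
  assumes K: "compact K" and contF: "continuous_on (box_ab U \<times> K) F"
    and lipF: "\<And>\<mu> x y. \<mu> \<in> K \<Longrightarrow> x \<in> box_ab U \<Longrightarrow> y \<in> box_ab U \<Longrightarrow> norm (F (x, \<mu>) - F (y, \<mu>)) \<le> L * norm (x - y)"
    and c: "0 < c" and M: "1 \<le> M"
    and expand: "\<And>\<mu> z. \<mu> \<in> K \<Longrightarrow> z \<in> box_ab U \<Longrightarrow> norm (part (- U) z) \<le> M * norm (part U z) \<Longrightarrow>
      c * (norm (part U z))\<^sup>2 \<le> part U z \<bullet> F (z, \<mu>)"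
    and contract: "\<And>\<mu> z. \<mu> \<in> K \<Longrightarrow> z \<in> box_ab U \<Longrightarrow> norm (part U z) \<le> M * norm (part (- U) z) \<Longrightarrow>
      part (- U) z \<bullet> F (z, \<mu>) \<le> - c * (norm (part (- U) z))\<^sup>2"
  obtains \<psi> :: "real \<Rightarrow> (real^'n) \<times> (real^'k) \<Rightarrow> real^'n" where
    "\<And>T. continuous_on ({0..T} \<times> (box_ab U \<times> K)) (\<lambda>(t, w). \<psi> t w)"
    "\<And>z \<mu>. z \<in> box_ab U \<Longrightarrow> \<mu> \<in> K \<Longrightarrow> \<psi> 0 (z, \<mu>) = z"
    "\<And>z \<mu> s t. z \<in> box_ab U \<Longrightarrow> \<mu> \<in> K \<Longrightarrow> 0 \<le> s \<Longrightarrow> s \<le> t \<Longrightarrow>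
       1 \<le> norm (part U (\<psi> s (z, \<mu>))) \<Longrightarrow> 1 \<le> norm (part U (\<psi> t (z, \<mu>)))"
    "\<And>z \<mu> t. z \<in> box_ab U \<Longrightarrow> \<mu> \<in> K \<Longrightarrow> 0 \<le> t \<Longrightarrow> norm (part (- U) (\<psi> t (z, \<mu>))) \<le> 1"
    "\<And>z \<mu> t T. z \<in> box_ab U \<Longrightarrow> \<mu> \<in> K \<Longrightarrow> 0 \<le> t \<Longrightarrow> t \<le> T \<Longrightarrow> \<psi> t (z, \<mu>) \<in> box_ab U \<Longrightarrow>
       ((\<lambda>t. \<psi> t (z, \<mu>)) has_vector_derivative F (\<psi> t (z, \<mu>), \<mu>)) (at t within {0..T})"
proof -
  define W where "W = box_ab U \<times> K"
  define G where "G = (\<lambda>(x, w :: (real^'n) \<times> (real^'k)). F (box_retract U x, snd w))"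
  have contG: "continuous_on (UNIV \<times> W) G"
    unfolding G_def case_prod_unfold
    by (intro continuous_on_compose2[OF contF] continuous_intros continuous_on_compose2[OF continuous_on_box_retract[of UNIV]])
       (auto simp: box_retract_in_box W_def)
  have "compact (F ` (box_ab U \<times> K))"
    by (intro compact_continuous_image contF compact_Times compact_box_ab K)
  then obtain B where B: "\<And>x. x \<in> F ` (box_ab U \<times> K) \<Longrightarrow> norm x \<le> B"
    using compact_imp_bounded bounded_iff by metis
  have boundG: "norm (G (x, w)) \<le> B" if "w \<in> W" for x w
    using that by (intro B) (auto simp: G_def W_def box_retract_in_box)
  have lipG: "norm (G (x, w) - G (y, w)) \<le> (4 * \<bar>L\<bar> + 1) * norm (x - y)" if "w \<in> W" for x y w
  proof -
    have "norm (G (x, w) - G (y, w)) \<le> L * norm (box_retract U x - box_retract U y)"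
      using that by (auto simp: G_def W_def intro!: lipF box_retract_in_box)
    also have "\<dots> \<le> \<bar>L\<bar> * (4 * norm (x - y))"
      by (intro mult_mono box_retract_lipschitz) auto
    also have "\<dots> \<le> (4 * \<bar>L\<bar> + 1) * norm (x - y)" by (simp add: algebra_simps)
    finally show ?thesis .
  qed
  obtain \<psi> :: "real \<Rightarrow> (real^'n) \<times> (real^'k) \<Rightarrow> real^'n" where
    cont: "\<And>T. continuous_on ({0..T} \<times> W) (\<lambda>(t, w). \<psi> t w)"
    and init: "\<And>w. w \<in> W \<Longrightarrow> \<psi> 0 w = fst w"
    and der: "\<And>w T t. w \<in> W \<Longrightarrow> 0 \<le> t \<Longrightarrow> t \<le> T \<Longrightarrow>
       ((\<lambda>t. \<psi> t w) has_vector_derivative G (\<psi> t w, w)) (at t within {0..T})"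
    by (rule global_flow_with_parameters[OF contG continuous_on_fst[OF continuous_on_id] boundG _ lipG]) auto
  have Wi: "(z, \<mu>) \<in> W" if "z \<in> box_ab U" "\<mu> \<in> K" for z \<mu> using that by (simp add: W_def)
  have der': "((\<lambda>t. \<psi> t (z, \<mu>)) has_vector_derivative F (box_retract U (\<psi> t (z, \<mu>)), \<mu>)) (at t within {s..T})"
    if "z \<in> box_ab U" "\<mu> \<in> K" "0 \<le> s" "s \<le> t" "t \<le> T" for z \<mu> s t T
    using has_vector_derivative_within_subset[OF der[OF Wi[OF that(1,2)], of t T], of "{s..T}"] that
    by (simp add: G_def)
  show thesis
  proof (rule that[of \<psi>])
    show "continuous_on ({0..T} \<times> box_ab U \<times> K) (\<lambda>(t, w). \<psi> t w)" for T
      using cont by (simp add: W_def)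
    fix z \<mu> assume z: "z \<in> box_ab U" "\<mu> \<in> K"
    show "\<psi> 0 (z, \<mu>) = z" using init[OF Wi[OF z]] by simp
    show "1 \<le> norm (part U (\<psi> t (z, \<mu>)))"
      if st: "0 \<le> s" "s \<le> t" and 1: "1 \<le> norm (part U (\<psi> s (z, \<mu>)))" for s t
    proof -
      have "1 \<le> (norm (part U (\<psi> t (z, \<mu>))))\<^sup>2"
      proof (rule barrier_above[OF st(2) order_refl])
        show "1 \<le> (norm (part U (\<psi> s (z, \<mu>))))\<^sup>2" using 1 by simp
        fix u assume u: "s \<le> u" "u \<le> t"
        let ?a = "part U (\<psi> u (z, \<mu>))" and ?r = "box_retract U (\<psi> u (z, \<mu>))"
        show "((\<lambda>t. (norm (part U (\<psi> t (z, \<mu>))))\<^sup>2) has_real_derivative 2 * (?a \<bullet> F (?r, \<mu>))) (at u within {s..t})"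
          by (rule has_real_derivative_norm_part[OF der'[OF z st(1) u]])
        assume "(norm ?a)\<^sup>2 = 1"
        then have na: "norm ?a = 1" using norm_ge_zero[of ?a] by (auto simp: power2_eq_1_iff)
        then have pr: "part U ?r = ?a" by (simp add: part_box_retract unit_clip_id)
        have "norm (part (- U) ?r) \<le> M * norm (part U ?r)"
          using M na unfolding pr by (simp add: part_box_retract norm_unit_clip)
        from expand[OF z(2) box_retract_in_box this] show "0 < 2 * (?a \<bullet> F (?r, \<mu>))"
          using c na unfolding pr by simp
      qed
      then show ?thesis by (simp add: abs_le_square_iff[of 1 "norm _", simplified])
    qed
    show "norm (part (- U) (\<psi> t (z, \<mu>))) \<le> 1" if t: "0 \<le> t" for t
    proof -
      have "- 1 \<le> - (norm (part (- U) (\<psi> t (z, \<mu>))))\<^sup>2"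
      proof (rule barrier_above[OF t order_refl])
        show "- 1 \<le> - (norm (part (- U) (\<psi> 0 (z, \<mu>))))\<^sup>2"
          using z init[OF Wi[OF z]] by (simp add: box_ab_def power_le_one)
        fix u assume u: "0 \<le> u" "u \<le> t"
        let ?a = "part (- U) (\<psi> u (z, \<mu>))" and ?r = "box_retract U (\<psi> u (z, \<mu>))"
        show "((\<lambda>t. - (norm (part (- U) (\<psi> t (z, \<mu>))))\<^sup>2) has_real_derivative - (2 * (?a \<bullet> F (?r, \<mu>)))) (at u within {0..t})"
          by (rule DERIV_minus[OF has_real_derivative_norm_part[OF der'[OF z order_refl u]]])
        assume "- (norm ?a)\<^sup>2 = - 1"
        then have na: "norm ?a = 1" using norm_ge_zero[of ?a] by (auto simp: power2_eq_1_iff)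
        then have pr: "part (- U) ?r = ?a" by (simp add: part_box_retract unit_clip_id)
        have "norm (part U ?r) \<le> M * norm (part (- U) ?r)"
          using M na unfolding pr by (simp add: part_box_retract norm_unit_clip)
        from contract[OF z(2) box_retract_in_box this] show "0 < - (2 * (?a \<bullet> F (?r, \<mu>)))"
          using c na unfolding pr by simp
      qed
      then show ?thesis by (simp add: abs_square_le_1)
    qed
    show "((\<lambda>t. \<psi> t (z, \<mu>)) has_vector_derivative F (\<psi> t (z, \<mu>), \<mu>)) (at t within {0..T})"
      if "0 \<le> t" "t \<le> T" "\<psi> t (z, \<mu>) \<in> box_ab U" for t T
      using der'[OF z order_refl that(1,2)] box_retract_id[OF that(3)] by simp
  qed
qed

text \<open>
  Outside the cone \<open>|b| < M |a|\<close> both \<open>|a| \<le> |b|\<close> and exponential decay of \<open>|b|\<close> hold.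
\<close>

lemma trapped_orbit_converges:
  fixes z :: "real \<Rightarrow> real^'n::finite" and f :: "real^'n \<Rightarrow> real^'n"
  assumes inbox: "\<And>t. 0 \<le> t \<Longrightarrow> z t \<in> box_ab U"
    and der: "\<And>t T. 0 \<le> t \<Longrightarrow> t \<le> T \<Longrightarrow> (z has_vector_derivative f (z t)) (at t within {0..T})"
    and c: "0 < c" and M: "1 \<le> M"
    and expand: "\<And>z. z \<in> box_ab U \<Longrightarrow> norm (part (- U) z) \<le> M * norm (part U z) \<Longrightarrow>
      c * (norm (part U z))\<^sup>2 \<le> part U z \<bullet> f z"
    and contract: "\<And>z. z \<in> box_ab U \<Longrightarrow> norm (part U z) \<le> M * norm (part (- U) z) \<Longrightarrow>
      part (- U) z \<bullet> f z \<le> - c * (norm (part (- U) z))\<^sup>2"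
  shows "filterlim z (nhds 0) at_top"
proof -
  define a where "a t = norm (part U (z t))" for t
  define b where "b t = norm (part (- U) (z t))" for t
  have a0: "0 \<le> a t" and b0: "0 \<le> b t" for t by (auto simp: a_def b_def)
  have a1: "a t \<le> 1" and b1: "b t \<le> 1" if "0 \<le> t" for t
    using inbox[OF that] by (auto simp: a_def b_def box_ab_def)
  define a' where "a' t = 2 * (part U (z t) \<bullet> f (z t))" for t
  define b' where "b' t = 2 * (part (- U) (z t) \<bullet> f (z t))" for t
  have sub: "(z has_vector_derivative f (z t)) (at t within {s..T})" if "0 \<le> s" "s \<le> t" "t \<le> T" for s t T
    using has_vector_derivative_within_subset[OF der[of t T], of "{s..T}"] that by auto
  have da: "((\<lambda>t. (a t)\<^sup>2) has_real_derivative a' t) (at t within {s..T})" if "0 \<le> s" "s \<le> t" "t \<le> T" for s t T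
    unfolding a_def a'_def by (rule has_real_derivative_norm_part[OF sub[OF that]])
  have db: "((\<lambda>t. (b t)\<^sup>2) has_real_derivative b' t) (at t within {s..T})" if "0 \<le> s" "s \<le> t" "t \<le> T" for s t T
    unfolding b_def b'_def by (rule has_real_derivative_norm_part[OF sub[OF that]])
  have a': "2 * c * (a t)\<^sup>2 \<le> a' t" if "0 \<le> t" "b t \<le> M * a t" for t
    using expand[OF inbox[OF that(1)]] that(2) by (simp add: a_def b_def a'_def)
  have b': "b' t \<le> - (2 * c * (b t)\<^sup>2)" if "0 \<le> t" "a t \<le> M * b t" for t
    using contract[OF inbox[OF that(1)]] that(2) by (simp add: a_def b_def b'_def)
  \<comment> \<open>In the cone \<open>b < M a\<close> the orbit would stay, because \<open>M\<^sup>2 a\<^sup>2 - b\<^sup>2\<close> increases on its boundary,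
    and \<open>a\<close> would grow past \<open>1\<close>.\<close>
  have cone: "M * a t \<le> b t" if t0: "0 \<le> t" for t
  proof (rule ccontr)
    assume "\<not> M * a t \<le> b t"
    then have lt: "b t < M * a t" by simp
    then have at: "a t > 0" using M b0[of t] a0[of t] by (cases "a t = 0") auto
    define cn where "cn s = M\<^sup>2 * (a s)\<^sup>2 - (b s)\<^sup>2" for s
    have cn_iff: "0 < cn s \<longleftrightarrow> b s < M * a s" "cn s = 0 \<longleftrightarrow> b s = M * a s" for s
      using abs_square_less_1 a0[of s] b0[of s] M
      by (auto simp: cn_def power_mult_distrib[symmetric] abs_le_square_iff[symmetric] power2_eq_iff_nonneg
          power_strict_mono dest: power_less_imp_less_base)
    have stay: "b s < M * a s" if s: "t \<le> s" for s
    proof (rule ccontr)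
      assume "\<not> b s < M * a s"
      then have "cn s \<le> 0" using cn_iff(1)[of s] by linarith
      moreover have dcn: "(cn has_real_derivative M\<^sup>2 * a' u - b' u) (at u within {t..s})" if "t \<le> u" "u \<le> s" for u
        unfolding cn_def[abs_def] using that t0 by (intro DERIV_diff DERIV_cmult da db) auto
      then have "continuous_on {t..s} cn" by (intro DERIV_continuous_on) auto
      ultimately obtain r where r: "t < r" "r \<le> s" "cn r = 0" and pos: "\<And>u. t \<le> u \<Longrightarrow> u < r \<Longrightarrow> 0 < cn u"
        using first_crossing[of t s cn 0] s lt cn_iff(1)[of t] by metis
      have "(a t)\<^sup>2 + 0 * (r - t) \<le> (a r)\<^sup>2"
      proof (rule increase_at_least[where f' = a'])
        fix u assume u: "t \<le> u" "u \<le> r"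
        have "b u \<le> M * a u" using pos[of u] r(3) u cn_iff[of u] by (cases "u = r") auto
        then have "2 * c * (a u)\<^sup>2 \<le> a' u" using u t0 by (intro a') auto
        then show "0 \<le> a' u" using c by (smt (verit) mult_nonneg_nonneg zero_le_power2)
      qed (use r t0 da in auto)
      then have ar: "0 < a r" using at a0[of r] by (cases "a r = 0") auto
      have br: "b r = M * a r" using r cn_iff by blast
      have "a r \<le> M * (M * a r)"
        using M ar mult_mono[of 1 M 1 M] by (simp add: mult.assoc[symmetric])
      then have "b' r \<le> - (2 * c * (b r)\<^sup>2)" using br r t0 by (intro b') auto
      moreover have "2 * c * (a r)\<^sup>2 \<le> a' r" using br r t0 by (intro a') auto
      then have "0 < a' r" using c ar by (smt (verit) mult_pos_pos zero_less_power)
      ultimately have "0 < M\<^sup>2 * a' r - b' r"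
        using c M by (smt (verit) mult_nonneg_nonneg mult_pos_pos zero_le_power2 zero_less_power)
      from has_real_derivative_pos_inc_left[OF dcn this]
      obtain d where d: "d > 0" "\<And>h. 0 < h \<Longrightarrow> r - h \<in> {t..s} \<Longrightarrow> h < d \<Longrightarrow> cn (r - h) < cn r"
        using r by auto
      define h where "h = min (d / 2) (r - t)"
      have h: "0 < h" "h < d" "t \<le> r - h" using d r by (auto simp: h_def min_def)
      then have "cn (r - h) < 0" using d(2)[of h] r by auto
      moreover have "0 < cn (r - h)" using pos h by auto
      ultimately show False by simp
    qed
    define k where "k = 2 * c * (a t)\<^sup>2"
    have k: "0 < k" using c at by (simp add: k_def)
    have grow: "(a t)\<^sup>2 \<le> (a s)\<^sup>2" if "t \<le> s" for s
    proof -
      have "(a t)\<^sup>2 + 0 * (s - t) \<le> (a s)\<^sup>2"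
      proof (rule increase_at_least[where f' = a', OF that])
        fix u assume u: "t \<le> u" "u \<le> s"
        have "2 * c * (a u)\<^sup>2 \<le> a' u" using u t0 stay[of u] by (intro a') auto
        then show "0 \<le> a' u" using c by (smt (verit) mult_nonneg_nonneg zero_le_power2)
      qed (use t0 da in auto)
      then show ?thesis by simp
    qed
    define s where "s = t + 2 / k"
    have s: "t \<le> s" using k by (simp add: s_def)
    have "(a t)\<^sup>2 + k * (s - t) \<le> (a s)\<^sup>2"
    proof (rule increase_at_least[where f' = a', OF s])
      fix u assume u: "t \<le> u" "u \<le> s"
      have "2 * c * (a u)\<^sup>2 \<le> a' u" using u t0 stay[of u] by (intro a') auto
      moreover have "k \<le> 2 * c * (a u)\<^sup>2" using grow[OF u(1)] c by (simp add: k_def)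
      ultimately show "k \<le> a' u" by linarith
    qed (use t0 da in auto)
    moreover have "k * (s - t) = 2" using k by (simp add: s_def)
    moreover have "(a s)\<^sup>2 \<le> 1" using a0[of s] a1[of s] s t0 by (simp add: power_le_one)
    ultimately show False using zero_le_power2[of "a t"] by linarith
  qed
  have ab: "a t \<le> b t" if "0 \<le> t" for t
  proof -
    have "1 * a t \<le> M * a t" using M a0 by (intro mult_right_mono) auto
    then show ?thesis using cone[OF that] by linarith
  qed
  have decay: "(b t)\<^sup>2 \<le> exp (- (2 * c * t))" if t: "0 \<le> t" for t
  proof -
    have "- ((b 0)\<^sup>2 * exp (2 * c * 0)) + 0 * (t - 0) \<le> - ((b t)\<^sup>2 * exp (2 * c * t))"
    proof (rule increase_at_least[OF t])
      fix u assume u: "0 \<le> u" "u \<le> t"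
      show "((\<lambda>u. - ((b u)\<^sup>2 * exp (2 * c * u))) has_real_derivative
             exp (2 * c * u) * (- (2 * c * (b u)\<^sup>2) - b' u)) (at u within {0..t})"
      proof -
        have "((\<lambda>u. exp (2 * c * u)) has_real_derivative 2 * c * exp (2 * c * u)) (at u within {0..t})"
          by (auto intro!: derivative_eq_intros)
        from DERIV_minus[OF DERIV_mult[OF db[OF order_refl u] this]] show ?thesis
          by (rule DERIV_cong) (simp add: algebra_simps)
      qed
      have "b u \<le> M * b u" using M b0[of u] mult_right_mono[of 1 M "b u"] by simp
      then have "b' u \<le> - (2 * c * (b u)\<^sup>2)" using u ab[of u] by (intro b') auto
      then show "0 \<le> exp (2 * c * u) * (- (2 * c * (b u)\<^sup>2) - b' u)" by simp
    qed
    then have "(b t)\<^sup>2 * exp (2 * c * t) \<le> (b 0)\<^sup>2" by simp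
    also have "\<dots> \<le> 1" using b0[of 0] b1[of 0] by (simp add: power_le_one)
    finally have "(b t)\<^sup>2 * exp (2 * c * t) * exp (- (2 * c * t)) \<le> 1 * exp (- (2 * c * t))"
      by (intro mult_right_mono) auto
    then show ?thesis by (simp add: mult.assoc flip: exp_add)
  qed
  have bound: "(norm (z t))\<^sup>2 \<le> 2 * exp (- (2 * c * t))" if t: "0 \<le> t" for t
  proof -
    have "(a t)\<^sup>2 \<le> (b t)\<^sup>2" using ab[OF t] a0[of t] by (intro power_mono)
    then show ?thesis
      using norm_square_parts[of "z t" U] decay[OF t] unfolding a_def b_def by linarith
  qed
  have "filterlim (\<lambda>t. 2 * exp (- (2 * c * t))) (nhds 0) at_top"
  proof -
    have "filterlim (\<lambda>t. (2 * c) * t) at_top at_top"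
      by (rule filterlim_tendsto_pos_mult_at_top[OF tendsto_const _ filterlim_ident]) (use c in auto)
    then have "filterlim (\<lambda>t. - (2 * c * t)) at_bot at_top"
      by (simp add: filterlim_uminus_at_bot)
    then have "filterlim (\<lambda>t. exp (- (2 * c * t))) (nhds 0) at_top"
      by (rule filterlim_compose[OF exp_at_bot])
    from tendsto_mult_right_zero[OF this, of 2] show ?thesis by simp
  qed
  then have "filterlim (\<lambda>t. (norm (z t))\<^sup>2) (nhds 0) at_top"
    by (rule Lim_null_comparison[rotated]) (use bound in \<open>auto simp: eventually_at_top_linorder intro!: exI[of _ 0]\<close>)
  then have "filterlim (\<lambda>t. sqrt ((norm (z t))\<^sup>2)) (nhds (sqrt 0)) at_top"
    by (rule tendsto_real_sqrt)
  then show ?thesis by (simp add: tendsto_norm_zero_iff)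
qed

section \<open>Continuously differentiable maps\<close>

definition C1_on :: "'a::euclidean_space set \<Rightarrow> ('a \<Rightarrow> 'b::euclidean_space) \<Rightarrow> bool" where
  "C1_on S f \<longleftrightarrow> (\<forall>x\<in>S. f differentiable at x) \<and> (\<forall>v. continuous_on S (\<lambda>x. frechet_derivative f (at x) v))"

lemma C1_on_Ck: "C1_on S f \<longleftrightarrow> Ck_on (Suc 0) S f"
  by (simp add: C1_on_def)

lemma C1_onI:
  assumes "\<And>x. x \<in> S \<Longrightarrow> (f has_derivative f' x) (at x)" "\<And>v. continuous_on S (\<lambda>x. f' x v)"
  shows "C1_on S f"
proof -
  have "f' x = frechet_derivative f (at x)" if "x \<in> S" for x
    by (rule frechet_derivative_at[OF assms(1)[OF that]])
  then have "continuous_on S (\<lambda>x. frechet_derivative f (at x) v)" for v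
    using assms(2)[of v] by (auto cong: continuous_on_cong)
  then show ?thesis using assms(1) by (auto simp: C1_on_def differentiable_def)
qed

lemma C1_on_has_derivative: "C1_on S f \<Longrightarrow> x \<in> S \<Longrightarrow> (f has_derivative frechet_derivative f (at x)) (at x)"
  by (simp add: C1_on_def frechet_derivative_works)

lemma C1_on_continuous_derivative: "C1_on S f \<Longrightarrow> continuous_on S (\<lambda>x. frechet_derivative f (at x) v)"
  by (simp add: C1_on_def)

lemma C1_on_continuous: "C1_on S f \<Longrightarrow> continuous_on S f"
  by (meson C1_on_def continuous_at_imp_continuous_on differentiable_imp_continuous_within)

lemma C1_on_cong:
  assumes "open S" "C1_on S f" "\<And>x. x \<in> S \<Longrightarrow> f x = g x"
  shows "C1_on S g"
  by (rule C1_onI[OF has_derivative_transform_within_open[OF C1_on_has_derivative[OF assms(2)] assms(1)]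
        C1_on_continuous_derivative[OF assms(2)]])
     (use assms(3) in auto)

lemma C1_on_bounded_linear:
  assumes "bounded_linear L" "C1_on S f"
  shows "C1_on S (\<lambda>x. L (f x))"
  by (rule C1_onI[OF bounded_linear.has_derivative[OF assms(1) C1_on_has_derivative[OF assms(2)]]
        bounded_linear.continuous_on[OF assms(1) C1_on_continuous_derivative[OF assms(2)]]])

lemma C1_on_const: "C1_on S (\<lambda>x. c)"
  by (rule C1_onI[where f' = "\<lambda>x v. 0"]) auto

lemma C1_on_add: "C1_on S f \<Longrightarrow> C1_on S g \<Longrightarrow> C1_on S (\<lambda>x. f x + g x)"
  by (rule C1_onI[OF has_derivative_add[OF C1_on_has_derivative C1_on_has_derivative]
      continuous_on_add[OF C1_on_continuous_derivative C1_on_continuous_derivative]])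

lemma C1_on_sum: "(\<And>i. i \<in> I \<Longrightarrow> C1_on S (f i)) \<Longrightarrow> C1_on S (\<lambda>x. \<Sum>i\<in>I. f i x)"
  by (induction I rule: infinite_finite_induct) (auto intro: C1_on_const C1_on_add)

lemma C1_on_mult:
  fixes f g :: "'a::euclidean_space \<Rightarrow> real"
  assumes "C1_on S f" "C1_on S g"
  shows "C1_on S (\<lambda>x. f x * g x)"
  by (rule C1_onI[OF has_derivative_mult[OF C1_on_has_derivative[OF assms(1)] C1_on_has_derivative[OF assms(2)]]])
     (assumption | intro continuous_on_add continuous_on_mult C1_on_continuous[OF assms(1)] C1_on_continuous[OF assms(2)]
        C1_on_continuous_derivative[OF assms(1)] C1_on_continuous_derivative[OF assms(2)])+

lemma C1_on_prod:
  fixes f :: "'i \<Rightarrow> 'a::euclidean_space \<Rightarrow> real"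
  shows "(\<And>i. i \<in> I \<Longrightarrow> C1_on S (f i)) \<Longrightarrow> C1_on S (\<lambda>x. \<Prod>i\<in>I. f i x)"
  by (induction I rule: infinite_finite_induct) (auto intro: C1_on_const C1_on_mult)

lemma C1_on_inverse:
  fixes f :: "'a::euclidean_space \<Rightarrow> real"
  assumes f: "C1_on S f" and nz: "\<And>x. x \<in> S \<Longrightarrow> f x \<noteq> 0"
  shows "C1_on S (\<lambda>x. inverse (f x))"
proof (rule C1_onI)
  fix x assume x: "x \<in> S"
  show "((\<lambda>x. inverse (f x)) has_derivative
      (\<lambda>v. - (inverse (f x) * frechet_derivative f (at x) v * inverse (f x)))) (at x)"
    by (rule Deriv.has_derivative_inverse[OF nz[OF x] C1_on_has_derivative[OF f x]])
next
  have "continuous_on S (\<lambda>x. inverse (f x))"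
    using nz by (intro continuous_on_inverse C1_on_continuous[OF f]) auto
  then show "continuous_on S (\<lambda>x. - (inverse (f x) * frechet_derivative f (at x) v * inverse (f x)))" for v
    by (intro continuous_on_minus continuous_on_mult C1_on_continuous_derivative[OF f])
qed

lemma derivative_basis_expansion:
  fixes f :: "'a::euclidean_space \<Rightarrow> 'b::euclidean_space"
  assumes "f differentiable at x"
  shows "frechet_derivative f (at x) v = (\<Sum>b\<in>Basis. (v \<bullet> b) *\<^sub>R frechet_derivative f (at x) b)"
proof -
  have "linear (frechet_derivative f (at x))" using assms by (rule linear_frechet_derivative)
  then have "frechet_derivative f (at x) (\<Sum>b\<in>Basis. (v \<bullet> b) *\<^sub>R b)
      = (\<Sum>b\<in>Basis. (v \<bullet> b) *\<^sub>R frechet_derivative f (at x) b)"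
    by (simp add: linear_sum linear_cmul)
  then show ?thesis by (simp add: euclidean_representation)
qed

lemma C1_on_compose:
  assumes f: "C1_on S f" and g: "C1_on T g" and sub: "f ` S \<subseteq> T"
  shows "C1_on S (\<lambda>x. g (f x))"
proof (rule C1_onI)
  fix x assume x: "x \<in> S"
  show "((\<lambda>x. g (f x)) has_derivative (\<lambda>v. frechet_derivative g (at (f x)) (frechet_derivative f (at x) v))) (at x)"
    using has_derivative_compose[OF C1_on_has_derivative[OF f x] C1_on_has_derivative[OF g]] x sub by auto
next
  fix v
  have "continuous_on S (\<lambda>x. \<Sum>b\<in>Basis. (frechet_derivative f (at x) v \<bullet> b) *\<^sub>R frechet_derivative g (at (f x)) b)"
    by (intro continuous_on_sum continuous_on_scaleR continuous_on_inner continuous_on_const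
        C1_on_continuous_derivative[OF f]
        continuous_on_compose2[OF C1_on_continuous_derivative[OF g] C1_on_continuous[OF f] sub])
  moreover have "g differentiable at (f x)" if "x \<in> S" for x using g that sub by (auto simp: C1_on_def)
  ultimately show "continuous_on S (\<lambda>x. frechet_derivative g (at (f x)) (frechet_derivative f (at x) v))"
    by (subst continuous_on_cong[OF refl derivative_basis_expansion]) auto
qed

lemma C1_on_Pair:
  assumes "C1_on S f" "C1_on S g" shows "C1_on S (\<lambda>x. (f x, g x))"
  by (rule C1_onI[OF has_derivative_Pair[OF C1_on_has_derivative[OF assms(1)] C1_on_has_derivative[OF assms(2)]]
       continuous_on_Pair[OF C1_on_continuous_derivative[OF assms(1)] C1_on_continuous_derivative[OF assms(2)]]])

lemma C1_on_vec:
  fixes f :: "'a::euclidean_space \<Rightarrow> real^'n"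
  assumes "\<And>k. C1_on S (\<lambda>x. f x $ k)"
  shows "C1_on S f"
proof -
  have "C1_on S (\<lambda>x. \<Sum>k\<in>UNIV. f x $ k *\<^sub>R (axis k 1 :: real^'n))"
    by (intro C1_on_sum C1_on_bounded_linear[OF bounded_linear_scaleR_left] assms)
  moreover have "(\<Sum>k\<in>UNIV. f x $ k *\<^sub>R (axis k 1 :: real^'n)) = f x" for x
    by (simp add: vec_eq_iff axis_def if_distrib cong: if_cong)
  ultimately show ?thesis by simp
qed

lemma C1_on_det:
  fixes A :: "'a::euclidean_space \<Rightarrow> real^'n^'n"
  assumes "\<And>i j. C1_on S (\<lambda>x. A x $ i $ j)"
  shows "C1_on S (\<lambda>x. det (A x))"
  unfolding det_def by (intro C1_on_sum C1_on_mult C1_on_const C1_on_prod assms)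

text \<open>
  Asking for segments in \<open>C\<close>, not for a convex \<open>C\<close>, gives one constant for all slices of a product
  whose second factor is not convex.
\<close>

lemma C1_on_lipschitz:
  assumes f: "C1_on S f" and C: "compact C" "C \<subseteq> S"
  obtains L where "\<And>x y. closed_segment x y \<subseteq> C \<Longrightarrow> norm (f x - f y) \<le> L * norm (x - y)"
proof -
  have "\<exists>B. \<forall>x\<in>C. norm (frechet_derivative f (at x) b) \<le> B" for b
    using compact_imp_bounded[OF compact_continuous_image[OF
        continuous_on_subset[OF C1_on_continuous_derivative[OF f, of b] C(2)] C(1)]]
    by (auto simp: bounded_iff)
  then obtain B where B: "\<And>b x. x \<in> C \<Longrightarrow> norm (frechet_derivative f (at x) b) \<le> B b" by metis
  define L where "L = (\<Sum>b\<in>Basis. B b)"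
  have on: "onorm (frechet_derivative f (at x)) \<le> L" if x: "x \<in> C" for x
  proof (rule onorm_le)
    fix v
    have "norm (frechet_derivative f (at x) v) \<le> (\<Sum>b\<in>Basis. norm ((v \<bullet> b) *\<^sub>R frechet_derivative f (at x) b))"
    proof -
      have "f differentiable at x" using f C x by (auto simp: C1_on_def)
      then show ?thesis by (subst derivative_basis_expansion) (assumption, rule norm_sum)
    qed
    also have "\<dots> \<le> (\<Sum>b\<in>Basis. norm v * B b)"
      by (intro sum_mono) (auto intro!: mult_mono B x Basis_le_norm)
    finally show "norm (frechet_derivative f (at x) v) \<le> L * norm v"
      by (simp add: L_def sum_distrib_left mult.commute)
  qed
  show thesis
  proof (rule that[of L])
    fix x y assume seg: "closed_segment x y \<subseteq> C"
    show "norm (f x - f y) \<le> L * norm (x - y)"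
    proof (rule differentiable_bound[of "closed_segment x y"])
      show "(f has_derivative frechet_derivative f (at z)) (at z within closed_segment x y)"
        if "z \<in> closed_segment x y" for z
        using C1_on_has_derivative[OF f] that seg C by (blast intro: has_derivative_at_withinI)
    qed (use seg on in auto)
  qed
qed

lemma locally_lipschitz_slice:
  fixes g :: "'a::euclidean_space \<times> 'b::euclidean_space \<Rightarrow> 'a"
  assumes "C1_on UNIV g"
  shows "locally_lipschitz (\<lambda>x. g (x, \<mu>))"
  unfolding locally_lipschitz_def
proof (intro allI impI)
  fix C :: "'a set" assume "compact C"
  then have "compact ((convex hull C) \<times> {\<mu>})" by (intro compact_Times compact_convex_hull) auto
  then obtain L where L: "\<And>x y. closed_segment x y \<subseteq> (convex hull C) \<times> {\<mu>} \<Longrightarrow> norm (g x - g y) \<le> L * norm (x - y)"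
    by (rule C1_on_lipschitz[OF assms]) auto
  have "norm (g (x, \<mu>) - g (y, \<mu>)) \<le> L * norm (x - y)" if "x \<in> C" "y \<in> C" for x y
  proof -
    have "convex ((convex hull C) \<times> {\<mu>})" by (intro convex_Times convex_convex_hull convex_singleton)
    moreover have "(x, \<mu>) \<in> (convex hull C) \<times> {\<mu>}" "(y, \<mu>) \<in> (convex hull C) \<times> {\<mu>}"
      using that by (auto intro: hull_inc)
    ultimately have "closed_segment (x, \<mu>) (y, \<mu>) \<subseteq> (convex hull C) \<times> {\<mu>}"
      by (rule closed_segment_subset[rotated 2])
    from L[OF this] show ?thesis by (simp add: norm_Pair)
  qed
  then show "\<exists>L. \<forall>x\<in>C. \<forall>y\<in>C. norm (g (x, \<mu>) - g (y, \<mu>)) \<le> L * norm (x - y)" by blast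
qed

section \<open>The field in block coordinates\<close>

text \<open>
  By Cramer's rule the components of the field are quotients of determinants in the first derivatives
  of \<open>P\<close> and the components of \<open>g\<close>; this is why two derivatives of \<open>P\<close> are needed.
\<close>

lemma coord_field_C1:
  fixes P :: "(real^'n::finite) \<times> (real^'k::finite) \<Rightarrow> real^'n" and g :: "(real^'n) \<times> (real^'k) \<Rightarrow> real^'n"
  assumes V: "open V" and P: "Ck_on (Suc (Suc 0)) (UNIV \<times> V) P" and g: "C1_on UNIV g"
    and inj: "\<And>\<mu> z. \<mu> \<in> V \<Longrightarrow> inj (frechet_derivative (\<lambda>y. P (y, \<mu>)) (at z))"
  shows "C1_on (UNIV \<times> V) (coord_field P g)"
    and "\<And>\<mu> z. \<mu> \<in> V \<Longrightarrow> ((\<lambda>y. P (y, \<mu>)) has_derivative frechet_derivative (\<lambda>y. P (y, \<mu>)) (at z)) (at z)"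
    and "\<And>\<mu> z. \<mu> \<in> V \<Longrightarrow> frechet_derivative (\<lambda>y. P (y, \<mu>)) (at z) (coord_field P g (z, \<mu>)) = g (P (z, \<mu>), \<mu>)"
proof -
  have P2: "C1_on (UNIV \<times> V) (\<lambda>w. frechet_derivative P (at w) v)" for v
    using P unfolding Ck_on.simps(2)[of "Suc 0"] C1_on_Ck[symmetric] by blast
  have "\<forall>x\<in>UNIV \<times> V. P differentiable at x"
    using P unfolding Ck_on.simps(2)[of "Suc 0"] by blast
  then have P1: "C1_on (UNIV \<times> V) P"
    unfolding C1_on_def using C1_on_continuous[OF P2] by blast
  have D: "((\<lambda>y. P (y, \<mu>)) has_derivative (\<lambda>h. frechet_derivative P (at (z, \<mu>)) (h, 0))) (at z)"
    if "\<mu> \<in> V" for z \<mu>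
  proof -
    have "((\<lambda>y. (y, \<mu>)) has_derivative (\<lambda>h. (h, 0))) (at z)"
      by (auto intro!: derivative_eq_intros)
    from has_derivative_compose[OF this C1_on_has_derivative[OF P1]] that show ?thesis by simp
  qed
  have Deq: "frechet_derivative (\<lambda>y. P (y, \<mu>)) (at z) = (\<lambda>h. frechet_derivative P (at (z, \<mu>)) (h, 0))"
    if "\<mu> \<in> V" for z \<mu>
    using frechet_derivative_at[OF D[OF that]] by simp
  show der: "\<And>\<mu> z. \<mu> \<in> V \<Longrightarrow> ((\<lambda>y. P (y, \<mu>)) has_derivative frechet_derivative (\<lambda>y. P (y, \<mu>)) (at z)) (at z)"
    using D Deq by simp
  define A where "A w = (\<chi> i j. frechet_derivative P (at w) (axis j 1, 0) $ i)" for w :: "(real^'n) \<times> (real^'k)"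
  define b where "b w = g (P w, snd w)" for w
  have Av: "frechet_derivative (\<lambda>y. P (y, \<mu>)) (at z) v = A (z, \<mu>) *v v" if "\<mu> \<in> V" for z \<mu> v
  proof -
    have "A (z, \<mu>) = matrix (frechet_derivative (\<lambda>y. P (y, \<mu>)) (at z))"
      by (simp add: A_def matrix_def Deq[OF that])
    then show ?thesis
      using matrix_works[of "frechet_derivative (\<lambda>y. P (y, \<mu>)) (at z)" v] has_derivative_linear[OF der[OF that]]
      by (simp add: linear_matrix_vector_mul_eq)
  qed
  have det: "det (A (z, \<mu>)) \<noteq> 0" if "\<mu> \<in> V" for z \<mu>
  proof -
    have "inj ((*v) (A (z, \<mu>)))" using inj[OF that, of z] Av[OF that, of z] by (simp add: inj_on_def)
    then show ?thesis
      using det_nz_iff_inj[OF matrix_vector_mul_linear, of "A (z, \<mu>)"] by (simp add: matrix_of_matrix_vector_mul)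
  qed
  define Fk where "Fk w = (\<chi> k. det (\<chi> i j. if j = k then b w $ i else A w $ i $ j) / det (A w))" for w
  have FFk: "coord_field P g w = Fk w" if "w \<in> UNIV \<times> V" for w
  proof -
    obtain z \<mu> where w': "w = (z, \<mu>)" by (cases w)
    with that have w: "w = (z, \<mu>)" "\<mu> \<in> V" by auto
    have "frechet_derivative (\<lambda>y. P (y, \<mu>)) (at z) v = g (P (z, \<mu>), \<mu>) \<longleftrightarrow> v = Fk w" for v
      unfolding Av[OF w(2)] using cramer[OF det[OF w(2), of z], of v "b (z, \<mu>)"] by (simp add: w Fk_def b_def)
    then show ?thesis by (simp add: coord_field_def w)
  qed
  show "\<And>\<mu> z. \<mu> \<in> V \<Longrightarrow> frechet_derivative (\<lambda>y. P (y, \<mu>)) (at z) (coord_field P g (z, \<mu>)) = g (P (z, \<mu>), \<mu>)"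
  proof -
    fix \<mu> z assume mu: "\<mu> \<in> V"
    show "frechet_derivative (\<lambda>y. P (y, \<mu>)) (at z) (coord_field P g (z, \<mu>)) = g (P (z, \<mu>), \<mu>)"
      unfolding Av[OF mu] using FFk[of "(z, \<mu>)"] mu cramer[OF det[OF mu, of z], of _ "b (z, \<mu>)"]
      by (simp add: Fk_def b_def)
  qed
  have cA: "C1_on (UNIV \<times> V) (\<lambda>w. A w $ i $ j)" for i j
    unfolding A_def using C1_on_bounded_linear[OF bounded_linear_vec_nth P2] by simp
  have "C1_on (UNIV \<times> V) (\<lambda>w. (P w, snd w))"
    by (rule C1_on_Pair[OF P1 C1_onI[where f' = "\<lambda>w. snd"]]) (auto intro!: derivative_eq_intros)
  from C1_on_compose[OF this g] have cb: "C1_on (UNIV \<times> V) (\<lambda>w. b w $ i)" for i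
    unfolding b_def by (intro C1_on_bounded_linear[OF bounded_linear_vec_nth]) simp
  have "C1_on (UNIV \<times> V) Fk"
  proof (rule C1_on_vec)
    fix k
    have "C1_on (UNIV \<times> V) (\<lambda>w. det (\<chi> i j. if j = k then b w $ i else A w $ i $ j))"
    proof (rule C1_on_det)
      fix i j show "C1_on (UNIV \<times> V) (\<lambda>w. (\<chi> i j. if j = k then b w $ i else A w $ i $ j) $ i $ j)"
        using cA[of i j] cb[of i] by (cases "j = k") simp_all
    qed
    moreover have "C1_on (UNIV \<times> V) (\<lambda>w. inverse (det (A w)))"
      by (rule C1_on_inverse[OF C1_on_det[OF cA]]) (use det in auto)
    ultimately show "C1_on (UNIV \<times> V) (\<lambda>w. Fk w $ k)"
      unfolding Fk_def by (simp add: divide_inverse C1_on_mult)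
  qed
  then show "C1_on (UNIV \<times> V) (coord_field P g)"
    by (rule C1_on_cong[OF open_Times[OF open_UNIV V]]) (simp add: FFk)
qed

section \<open>Eigenvalues and quadratic forms\<close>

lemma linear_coefficient_zero:
  fixes p q :: real
  assumes "\<And>t. t * p + t\<^sup>2 * q \<le> 0"
  shows "p = 0"
proof (rule ccontr)
  assume p: "p \<noteq> 0"
  define m where "m = \<bar>q\<bar> + 1"
  define t where "t = p / m"
  have m: "m > 0" "m + q > 0" by (auto simp: m_def)
  then have "p = t * m" by (simp add: t_def)
  then have "t * p + t\<^sup>2 * q = t\<^sup>2 * (m + q)"
    by (simp add: power2_eq_square algebra_simps)
  moreover have "t\<^sup>2 * (m + q) > 0"
    using p m by (intro mult_pos_pos) (auto simp: t_def)
  ultimately show False using assms[of t] by simp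
qed

definition block_form :: "'n::finite set \<Rightarrow> real^'n^'n \<Rightarrow> real^'n \<Rightarrow> real^'n \<Rightarrow> real" where
  "block_form S J u v = (\<Sum>i\<in>S. \<Sum>j\<in>S. v $ i * J $ i $ j * u $ j)"

lemma block_form_bilinear:
  "block_form S J (x + t *\<^sub>R y) (x + t *\<^sub>R y)
     = block_form S J x x + t * (block_form S J x y + block_form S J y x) + t\<^sup>2 * block_form S J y y"
  by (simp add: block_form_def sum_distrib_left sum.distrib[symmetric] power2_eq_square algebra_simps)

text \<open>
  The maximum of the quadratic form on the unit sphere of the block is an eigenvalue of the symmetric
  part, since the form is stationary there.
\<close>

lemma rayleigh_max:
  fixes J :: "real^'n^'n"
  assumes r: "\<And>\<rho>. \<rho> \<in> sym_eigenvalues S J \<Longrightarrow> \<rho> \<le> r" and v: "part S v = v"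
  shows "block_form S J v v \<le> r * (norm v)\<^sup>2"
proof (cases "v = 0")
  case False
  define B where "B = {x. part S x = x \<and> norm x = 1}"
  have "closed {x. part S x = x \<and> norm x = (1::real)}"
    by (intro closed_Collect_conj closed_Collect_eq continuous_intros
          linear_continuous_on bounded_linear_part continuous_on_norm_id)
  then have "compact B"
    unfolding B_def by (auto simp: compact_eq_bounded_closed intro!: boundedI[of _ 1])
  moreover have "inverse (norm v) *\<^sub>R v \<in> B" using v False by (simp add: B_def part_scaleR)
  then have "B \<noteq> {}" by blast
  moreover have "continuous_on B (\<lambda>x. block_form S J x x)"
    unfolding block_form_def by (intro continuous_intros)
  ultimately obtain u where u: "u \<in> B" and max: "\<And>x. x \<in> B \<Longrightarrow> block_form S J x x \<le> block_form S J u u"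
    using continuous_attains_sup[of B "\<lambda>x. block_form S J x x"] by metis
  define l where "l = block_form S J u u"
  have up: "part S u = u" and un: "norm u = 1" using u by (auto simp: B_def)
  have bound: "block_form S J x x \<le> l * (norm x)\<^sup>2" if x: "part S x = x" for x
  proof (cases "x = 0")
    case False
    have "inverse (norm x) *\<^sub>R x \<in> B" using x False by (simp add: B_def part_scaleR)
    then have "block_form S J (inverse (norm x) *\<^sub>R x) (inverse (norm x) *\<^sub>R x) \<le> l"
      unfolding l_def by (rule max)
    moreover have "block_form S J (c *\<^sub>R x) (c *\<^sub>R x) = c\<^sup>2 * block_form S J x x" for c
      by (simp add: block_form_def sum_distrib_left power2_eq_square algebra_simps)
    ultimately show ?thesis using False by (simp add: field_simps power2_eq_square)
  qed (simp add: block_form_def)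
  \<comment> \<open>the first variation of \<open>block_form x x - l |x|\<^sup>2\<close> vanishes at its zero \<open>u\<close>\<close>
  have crit: "block_form S J u y + block_form S J y u = 2 * l * (u \<bullet> y)" if y: "part S y = y" for y
  proof -
    define p where "p = block_form S J u y + block_form S J y u - 2 * l * (u \<bullet> y)"
    have "t * p + t\<^sup>2 * (block_form S J y y - l * (norm y)\<^sup>2) \<le> 0" for t
    proof -
      have "block_form S J (u + t *\<^sub>R y) (u + t *\<^sub>R y) \<le> l * (norm (u + t *\<^sub>R y))\<^sup>2"
        by (rule bound) (simp add: part_add part_scaleR up y)
      moreover have "(norm (u + t *\<^sub>R y))\<^sup>2 = 1 + t * (2 * (u \<bullet> y)) + t\<^sup>2 * (norm y)\<^sup>2"
      proof -
        have "(norm (u + t *\<^sub>R y))\<^sup>2 = (norm u)\<^sup>2 + t * (2 * (u \<bullet> y)) + t\<^sup>2 * (norm y)\<^sup>2"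
          unfolding power2_norm_eq_inner
          by (simp add: inner_add_left inner_add_right inner_commute power2_eq_square)
        then show ?thesis using un by simp
      qed
      ultimately show ?thesis
        unfolding block_form_bilinear p_def l_def by (simp add: algebra_simps)
    qed
    then have "p = 0" by (rule linear_coefficient_zero)
    then show ?thesis by (simp add: p_def)
  qed
  have "l \<in> sym_eigenvalues S J"
    unfolding sym_eigenvalues_def
  proof (intro CollectI exI conjI ballI allI impI)
    show "u \<noteq> 0" using un by auto
    show "u $ i = 0" if "i \<notin> S" for i using that arg_cong[OF up, of "\<lambda>x. x $ i"] by (simp add: part_def)
    fix i assume i: "i \<in> S"
    have pa: "part S (axis i 1) = (axis i 1 :: real^'n)"
      using i by (auto simp: part_def vec_eq_iff axis_def)
    have fin: "finite S" by simp
    have e1: "block_form S J u (axis i 1) = (\<Sum>j\<in>S. J $ i $ j * u $ j)"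
    proof -
      have "block_form S J u (axis i 1) = (\<Sum>k\<in>S. if k = i then (\<Sum>j\<in>S. J $ k $ j * u $ j) else 0)"
        unfolding block_form_def by (intro sum.cong) (auto simp: axis_def)
      then show ?thesis using i by simp
    qed
    have e2: "block_form S J (axis i 1) u = (\<Sum>k\<in>S. J $ k $ i * u $ k)"
    proof -
      have "block_form S J (axis i 1) u = (\<Sum>k\<in>S. \<Sum>j\<in>S. if j = i then u $ k * J $ k $ j else 0)"
        unfolding block_form_def by (intro sum.cong) (auto simp: axis_def)
      then show ?thesis using i by (simp add: mult.commute)
    qed
    have "(\<Sum>j\<in>S. (J $ i $ j + J $ j $ i) / 2 * u $ j) = (block_form S J u (axis i 1) + block_form S J (axis i 1) u) / 2"
      unfolding e1 e2 by (simp add: sum.distrib[symmetric] sum_divide_distrib algebra_simps add_divide_distrib)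
    also have "\<dots> = l * u $ i" using crit[OF pa] by (simp add: inner_axis)
    finally show "(\<Sum>j\<in>S. (J $ i $ j + J $ j $ i) / 2 * u $ j) = l * u $ i" .
  qed
  then have "l \<le> r" by (rule r)
  have "block_form S J v v \<le> l * (norm v)\<^sup>2" by (rule bound[OF v])
  also have "\<dots> \<le> r * (norm v)\<^sup>2" using \<open>l \<le> r\<close> by (intro mult_right_mono) auto
  finally show ?thesis .
qed (simp add: block_form_def)

lemma rayleigh_min:
  fixes J :: "real^'n^'n"
  assumes r: "\<And>\<rho>. \<rho> \<in> sym_eigenvalues S J \<Longrightarrow> r \<le> \<rho>" and v: "part S v = v"
  shows "r * (norm v)\<^sup>2 \<le> block_form S J v v"
proof -
  have "block_form S (- J) v v \<le> (- r) * (norm v)\<^sup>2"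
  proof (rule rayleigh_max[OF _ v])
    fix \<rho> assume "\<rho> \<in> sym_eigenvalues S (- J)"
    then obtain x where x: "x \<noteq> 0" "\<forall>i. i \<notin> S \<longrightarrow> x $ i = 0"
      "\<forall>i\<in>S. (\<Sum>j\<in>S. ((- J) $ i $ j + (- J) $ j $ i) / 2 * x $ j) = \<rho> * x $ i"
      by (auto simp: sym_eigenvalues_def)
    have "(\<Sum>j\<in>S. (J $ i $ j + J $ j $ i) / 2 * x $ j) = (- \<rho>) * x $ i" if "i \<in> S" for i
    proof -
      have "(\<Sum>j\<in>S. (J $ i $ j + J $ j $ i) / 2 * x $ j) = - (\<Sum>j\<in>S. ((- J) $ i $ j + (- J) $ j $ i) / 2 * x $ j)"
        unfolding sum_negf[symmetric] by (intro sum.cong) (auto simp: field_simps)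
      then show ?thesis using x(3) that by simp
    qed
    then have "- \<rho> \<in> sym_eigenvalues S J" using x(1,2) unfolding sym_eigenvalues_def by blast
    then show "\<rho> \<le> - r" using r by force
  qed
  moreover have "block_form S (- J) v v = - block_form S J v v"
    by (simp add: block_form_def sum_negf)
  ultimately show ?thesis by simp
qed

lemma inner_derivative_block_form:
  fixes F :: "(real^'n::finite) \<times> (real^'k::finite) \<Rightarrow> real^'n"
  assumes F: "F differentiable at w" and v: "part S v = v"
  shows "v \<bullet> frechet_derivative F (at w) (v, 0) = block_form S (jac_z F w) v v"
proof -
  have lin: "linear (\<lambda>v. frechet_derivative F (at w) (v, 0))"
    using linear_compose[OF _ linear_frechet_derivative[OF F], of "\<lambda>v. (v, 0)"]
    by (auto simp: o_def linear_iff)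
  have zero: "v $ i = 0" if "i \<notin> S" for i
    using that arg_cong[OF v, of "\<lambda>x. x $ i"] by (simp add: part_def)
  have "frechet_derivative F (at w) (v, 0) = matrix (\<lambda>v. frechet_derivative F (at w) (v, 0)) *v v"
    using matrix_works[OF lin[unfolded linear_matrix_vector_mul_eq[symmetric]], of v] by (simp add: lin)
  also have "matrix (\<lambda>v. frechet_derivative F (at w) (v, 0)) = jac_z F w"
    by (simp add: matrix_def jac_z_def)
  finally have "v \<bullet> frechet_derivative F (at w) (v, 0) = (\<Sum>i\<in>UNIV. \<Sum>j\<in>UNIV. v $ i * jac_z F w $ i $ j * v $ j)"
    by (simp add: inner_vec_def matrix_vector_mult_def sum_distrib_left mult.assoc)
  also have "\<dots> = (\<Sum>i\<in>S. \<Sum>j\<in>UNIV. v $ i * jac_z F w $ i $ j * v $ j)"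
    by (intro sum.mono_neutral_right) (auto simp: zero)
  also have "\<dots> = block_form S (jac_z F w) v v"
    unfolding block_form_def by (intro sum.cong sum.mono_neutral_right) (auto simp: zero)
  finally show ?thesis .
qed

section \<open>The cone estimates\<close>

lemma bounded_linear_derivative_part:
  fixes F :: "(real^'n::finite) \<times> (real^'k::finite) \<Rightarrow> real^'n"
  assumes "F differentiable at w"
  shows "bounded_linear (\<lambda>(v, \<nu>). part R (frechet_derivative F (at w) (part S v, \<nu>)))"
proof -
  have "bounded_linear (\<lambda>x :: (real^'n) \<times> (real^'k). (part S (fst x), snd x))"
    by (intro bounded_linear_Pair bounded_linear_compose[OF bounded_linear_part] bounded_linear_fst bounded_linear_snd)
  moreover have "bounded_linear (frechet_derivative F (at w))"
    using linear_frechet_derivative[OF assms] by (simp add: linear_conv_bounded_linear)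
  ultimately show ?thesis
    using bounded_linear_compose[OF bounded_linear_part bounded_linear_compose, of "frechet_derivative F (at w)"]
    by (simp add: case_prod_unfold)
qed

lemma norm_dzmu_bound:
  fixes F :: "(real^'n::finite) \<times> (real^'k::finite) \<Rightarrow> real^'n"
  assumes "F differentiable at w"
  shows "norm (part R (frechet_derivative F (at w) (part S v, 0))) \<le> norm_dzmu R S F w * norm (part S v)"
    and "0 \<le> norm_dzmu R S F w"
  using onorm[OF bounded_linear_derivative_part[OF assms, of R S], of "(part S v, 0)"]
    onorm_pos_le[OF bounded_linear_derivative_part[OF assms, of R S]]
  by (simp_all add: norm_dzmu_def norm_Pair)

text \<open>
  A real number strictly between the supremum and \<open>0\<close> serves as the rate; the supremum itself is \<open>-\<infinity>\<close>
  when there is no contracting direction.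
\<close>

lemma contraction_rate:
  fixes F :: "(real^'n::finite) \<times> (real^'k::finite) \<Rightarrow> real^'n"
  assumes "mu_s U M F D < 0"
  obtains c where "0 < c" "\<And>w \<rho>. w \<in> D \<Longrightarrow> \<rho> \<in> sym_eigenvalues (- U) (jac_z F w) \<Longrightarrow>
    \<rho> + M * norm_dzmu (- U) U F w \<le> - c"
proof -
  obtain r where r: "mu_s U M F D < ereal r" "ereal r < 0"
    using ereal_dense2[OF assms] by blast
  show thesis
  proof (rule that[of "- r"])
    show "0 < - r" using r by (simp add: zero_ereal_def)
    fix w \<rho> assume w: "w \<in> D" and \<rho>: "\<rho> \<in> sym_eigenvalues (- U) (jac_z F w)"
    have "ereal \<rho> + ereal (M * norm_dzmu (- U) U F w) \<le> l_max (- U) (jac_z F w) + ereal (M * norm_dzmu (- U) U F w)"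
      unfolding l_max_def by (intro add_right_mono SUP_upper \<rho>)
    also have "\<dots> \<le> mu_s U M F D" unfolding mu_s_def by (intro SUP_upper w)
    also have "\<dots> \<le> ereal r" using r by simp
    finally show "\<rho> + M * norm_dzmu (- U) U F w \<le> - (- r)" by simp
  qed
qed

text \<open>
  If some eigenvalue exists, the infimum and the supremum in \<open>xi_u\<close> are both finite: an infinite
  supremum would make the difference \<open>-\<infinity>\<close>. Without eigenvalues the claim is vacuous.
\<close>

lemma expansion_rate:
  fixes F :: "(real^'n::finite) \<times> (real^'k::finite) \<Rightarrow> real^'n"
  assumes xi: "0 < xi_u U M F D" and M: "0 < M"
    and nn: "\<And>w. w \<in> D \<Longrightarrow> 0 \<le> norm_dzmu U (- U) F w"
  obtains c where "0 < c" "\<And>w \<rho>. w \<in> D \<Longrightarrow> \<rho> \<in> sym_eigenvalues U (jac_z F w) \<Longrightarrow>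
    c + M * norm_dzmu U (- U) F w \<le> \<rho>"
proof (cases "\<exists>w\<in>D. sym_eigenvalues U (jac_z F w) \<noteq> {}")
  case False
  then show thesis by (intro that[of 1]) auto
next
  case True
  then obtain w0 \<rho>0 where w0: "w0 \<in> D" "\<rho>0 \<in> sym_eigenvalues U (jac_z F w0)" by blast
  define I where "I = (INF w\<in>D. l_min U (jac_z F w))"
  define S where "S = (SUP w\<in>D. ereal (norm_dzmu U (- U) F w))"
  have I: "I \<le> ereal \<rho>" if "w \<in> D" "\<rho> \<in> sym_eigenvalues U (jac_z F w)" for w \<rho>
  proof -
    have "I \<le> l_min U (jac_z F w)" unfolding I_def by (intro INF_lower that)
    also have "\<dots> \<le> ereal \<rho>" unfolding l_min_def by (intro INF_lower that)
    finally show ?thesis .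
  qed
  have S: "ereal (norm_dzmu U (- U) F w) \<le> S" if "w \<in> D" for w
    unfolding S_def by (intro SUP_upper that)
  have pos: "0 < I - ereal M * S" using xi by (simp add: xi_u_def I_def S_def)
  have "0 \<le> S" using S[OF w0(1)] nn[OF w0(1)] by (metis ereal_less_eq(5) order_trans zero_ereal_def)
  moreover have Ifin: "I \<noteq> \<infinity>" using I[OF w0] by auto
  ultimately obtain s where s: "S = ereal s" using pos M by (cases S) (cases I; simp)+
  then obtain i where i: "I = ereal i" using pos Ifin by (cases I) auto
  show thesis
  proof (rule that[of "i - M * s"])
    show "0 < i - M * s" using pos by (simp add: i s)
    fix w \<rho> assume w: "w \<in> D" and \<rho>: "\<rho> \<in> sym_eigenvalues U (jac_z F w)"
    have "norm_dzmu U (- U) F w \<le> s" using S[OF w] by (simp add: s)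
    then have "M * norm_dzmu U (- U) F w \<le> M * s" using M by (intro mult_left_mono) auto
    moreover have "i \<le> \<rho>" using I[OF w \<rho>] by (simp add: i)
    ultimately show "i - M * s + M * norm_dzmu U (- U) F w \<le> \<rho>" by linarith
  qed
qed

lemma box_ab_scale: "z \<in> box_ab U \<Longrightarrow> 0 \<le> s \<Longrightarrow> s \<le> 1 \<Longrightarrow> s *\<^sub>R z \<in> box_ab U"
  by (auto simp: box_ab_def part_scaleR mult_le_one)

text \<open>
  The mean value theorem along the ray from the equilibrium \<open>0\<close>.
\<close>

lemma ray_mean_value:
  fixes F :: "(real^'n::finite) \<times> (real^'k::finite) \<Rightarrow> real^'n"
  assumes F: "\<And>y. y \<in> box_ab U \<Longrightarrow> F differentiable at (y, \<mu>)" and F0: "F (0, \<mu>) = 0"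
    and z: "z \<in> box_ab U"
  obtains y where "y \<in> box_ab U" "v \<bullet> F (z, \<mu>) = v \<bullet> frechet_derivative F (at (y, \<mu>)) (z, 0)"
proof -
  define \<phi> where "\<phi> s = v \<bullet> F (s *\<^sub>R z, \<mu>)" for s
  have der: "(\<phi> has_derivative (\<lambda>h. v \<bullet> frechet_derivative F (at (s *\<^sub>R z, \<mu>)) (h *\<^sub>R z, 0))) (at s within {0..1})"
    if "0 \<le> s" "s \<le> 1" for s
  proof -
    have d: "((\<lambda>s. (s *\<^sub>R z, \<mu>)) has_derivative (\<lambda>h. (h *\<^sub>R z, 0))) (at s within {0..1})"
      by (auto intro!: derivative_eq_intros)
    have "(F has_derivative frechet_derivative F (at (s *\<^sub>R z, \<mu>))) (at (s *\<^sub>R z, \<mu>))"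
      using F[OF box_ab_scale[OF z that]] by (simp add: frechet_derivative_works)
    from has_derivative_compose[OF d this] show ?thesis
      unfolding \<phi>_def[abs_def] by (rule has_derivative_inner_right)
  qed
  obtain s where s: "s \<in> {0<..<1}" "\<phi> 1 - \<phi> 0 = v \<bullet> frechet_derivative F (at (s *\<^sub>R z, \<mu>)) ((1 - 0) *\<^sub>R z, 0)"
    using mvt_simple[of 0 1 \<phi>, OF _ der] by auto
  show thesis
    by (rule that[of "s *\<^sub>R z"]) (use s box_ab_scale[OF z] F0 in \<open>auto simp: \<phi>_def\<close>)
qed

text \<open>
  In the cone the cross term is at most \<open>M\<close> times the operator norm, which is what the cone condition
  reserves for it.
\<close>

lemma cone_estimates:
  fixes F :: "(real^'n::finite) \<times> (real^'k::finite) \<Rightarrow> real^'n"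
  assumes cone: "cone_condition U M F (box_ab U \<times> K)"
    and F: "\<And>z \<mu>. z \<in> box_ab U \<Longrightarrow> \<mu> \<in> K \<Longrightarrow> F differentiable at (z, \<mu>)"
    and F0: "\<And>\<mu>. \<mu> \<in> K \<Longrightarrow> F (0, \<mu>) = 0"
  obtains c where "0 < c"
    "\<And>\<mu> z. \<mu> \<in> K \<Longrightarrow> z \<in> box_ab U \<Longrightarrow> norm (part (- U) z) \<le> M * norm (part U z) \<Longrightarrow>
      c * (norm (part U z))\<^sup>2 \<le> part U z \<bullet> F (z, \<mu>)"
    "\<And>\<mu> z. \<mu> \<in> K \<Longrightarrow> z \<in> box_ab U \<Longrightarrow> norm (part U z) \<le> M * norm (part (- U) z) \<Longrightarrow>
      part (- U) z \<bullet> F (z, \<mu>) \<le> - c * (norm (part (- U) z))\<^sup>2"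
proof -
  from cone have M: "1 < M" and mu: "mu_s U M F (box_ab U \<times> K) < 0" and xi: "0 < xi_u U M F (box_ab U \<times> K)"
    by (auto simp: cone_condition_def)
  obtain c1 where c1: "0 < c1" "\<And>w \<rho>. w \<in> box_ab U \<times> K \<Longrightarrow> \<rho> \<in> sym_eigenvalues (- U) (jac_z F w) \<Longrightarrow>
    \<rho> + M * norm_dzmu (- U) U F w \<le> - c1" using contraction_rate[OF mu] by blast
  obtain c2 where c2: "0 < c2" "\<And>w \<rho>. w \<in> box_ab U \<times> K \<Longrightarrow> \<rho> \<in> sym_eigenvalues U (jac_z F w) \<Longrightarrow>
    c2 + M * norm_dzmu U (- U) F w \<le> \<rho>"
  proof (rule expansion_rate[OF xi])
    show "0 < M" using M by simp
    show "0 \<le> norm_dzmu U (- U) F w" if "w \<in> box_ab U \<times> K" for w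
      using that F by (intro norm_dzmu_bound(2)) auto
  qed (rule that)
  define c where "c = min c1 c2"
  \<comment> \<open>a diagonal block, controlled by the eigenvalues, and a cross term, controlled by the operator norm\<close>
  have split: "part S z \<bullet> frechet_derivative F (at w) (z, 0)
      = block_form S (jac_z F w) (part S z) (part S z)
        + part S z \<bullet> part S (frechet_derivative F (at w) (part (- S) z, 0))"
    if w: "F differentiable at w" for S w and z :: "real^'n"
  proof -
    have "(z, 0) = (part S z, 0) + (part (- S) z, 0 :: real^'k)" by (simp add: part_add_compl)
    then have "frechet_derivative F (at w) (z, 0)
        = frechet_derivative F (at w) (part S z, 0) + frechet_derivative F (at w) (part (- S) z, 0)"
      using linear_add[OF linear_frechet_derivative[OF w]] by metis
    then show ?thesis
      using inner_derivative_block_form[OF w part_part, of S z] by (simp add: inner_add_right inner_part)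
  qed
  have cross: "\<bar>part S z \<bullet> part S (frechet_derivative F (at w) (part (- S) z, 0))\<bar>
      \<le> norm (part S z) * (norm_dzmu S (- S) F w * norm (part (- S) z))"
    if w: "F differentiable at w" for S w and z :: "real^'n"
    by (rule order_trans[OF Cauchy_Schwarz_ineq2 mult_left_mono[OF norm_dzmu_bound(1)[OF w]]]) simp
  show thesis
  proof (rule that[of c])
    show "0 < c" using c1 c2 by (simp add: c_def)
    fix \<mu> z assume \<mu>: "\<mu> \<in> K" and z: "z \<in> box_ab U"
    let ?a = "norm (part U z)" and ?b = "norm (part (- U) z)"
    show "c * ?a\<^sup>2 \<le> part U z \<bullet> F (z, \<mu>)" if le: "?b \<le> M * ?a"
    proof -
      obtain y where y: "y \<in> box_ab U"
        "part U z \<bullet> F (z, \<mu>) = part U z \<bullet> frechet_derivative F (at (y, \<mu>)) (z, 0)"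
        by (rule ray_mean_value[where v = "part U z" and F = F and \<mu> = \<mu> and U = U and z = z])
           (use F F0 \<mu> z in auto)
      define n where "n = norm_dzmu U (- U) F (y, \<mu>)"
      have Fy: "F differentiable at (y, \<mu>)" by (rule F[OF y(1) \<mu>])
      have n: "0 \<le> n" unfolding n_def by (rule norm_dzmu_bound(2)[OF Fy])
      have "(c2 + M * n) * ?a\<^sup>2 \<le> block_form U (jac_z F (y, \<mu>)) (part U z) (part U z)"
        by (rule rayleigh_min) (use c2(2) y(1) \<mu> in \<open>auto simp: n_def\<close>)
      moreover have "?a * (n * ?b) \<le> ?a * (n * (M * ?a))"
        using le n by (intro mult_left_mono) auto
      ultimately have "c2 * ?a\<^sup>2 \<le> part U z \<bullet> F (z, \<mu>)"
        using cross[OF Fy, of U z] unfolding y(2) split[OF Fy] n_def[symmetric]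
        by (simp add: power2_eq_square algebra_simps)
      moreover have "c * ?a\<^sup>2 \<le> c2 * ?a\<^sup>2" by (intro mult_right_mono) (auto simp: c_def)
      ultimately show ?thesis by linarith
    qed
    show "part (- U) z \<bullet> F (z, \<mu>) \<le> - c * ?b\<^sup>2" if le: "?a \<le> M * ?b"
    proof -
      obtain y where y: "y \<in> box_ab U"
        "part (- U) z \<bullet> F (z, \<mu>) = part (- U) z \<bullet> frechet_derivative F (at (y, \<mu>)) (z, 0)"
        by (rule ray_mean_value[where v = "part (- U) z" and F = F and \<mu> = \<mu> and U = U and z = z])
           (use F F0 \<mu> z in auto)
      define n where "n = norm_dzmu (- U) U F (y, \<mu>)"
      have Fy: "F differentiable at (y, \<mu>)" by (rule F[OF y(1) \<mu>])
      have n: "0 \<le> n" unfolding n_def by (rule norm_dzmu_bound(2)[OF Fy])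
      have "block_form (- U) (jac_z F (y, \<mu>)) (part (- U) z) (part (- U) z) \<le> (- c1 - M * n) * ?b\<^sup>2"
      proof (rule rayleigh_max)
        fix \<rho> assume "\<rho> \<in> sym_eigenvalues (- U) (jac_z F (y, \<mu>))"
        then show "\<rho> \<le> - c1 - M * n" using c1(2)[of "(y, \<mu>)" \<rho>] y(1) \<mu> by (simp add: n_def)
      qed simp
      moreover have "?b * (n * ?a) \<le> ?b * (n * (M * ?b))"
        using le n by (intro mult_left_mono) auto
      ultimately have "part (- U) z \<bullet> F (z, \<mu>) \<le> - c1 * ?b\<^sup>2"
        using cross[OF Fy, of "- U" z] unfolding y(2) split[OF Fy] double_complement n_def[symmetric]
        by (simp add: power2_eq_square algebra_simps)
      moreover have "c * ?b\<^sup>2 \<le> c1 * ?b\<^sup>2" by (intro mult_right_mono) (auto simp: c_def)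
      ultimately show ?thesis by simp
    qed
  qed
qed

section \<open>Change of the time scale\<close>

lemma integral_atLeast_limit:
  fixes \<theta> :: "real \<Rightarrow> real"
  assumes int: "f integrable_on {0..}" and pos: "\<And>t. 0 \<le> t \<Longrightarrow> 0 \<le> f t"
    and \<theta>: "\<And>t. 0 \<le> t \<Longrightarrow> \<theta> t = integral {0..t} f"
  shows "(\<lambda>n. \<theta> (real n)) \<longlonglongrightarrow> integral {0..} f"
proof -
  have intn: "f integrable_on {0..real n}" for n
    by (rule integrable_on_subinterval[OF int]) auto
  have inter: "{0..real n} \<inter> {0..} = {0..real n}" for n by auto
  have "(\<lambda>n. integral {0..} (\<lambda>t. if t \<in> {0..real n} then f t else 0)) \<longlonglongrightarrow> integral {0..} f"
  proof (rule dominated_convergence(2)[where h = f])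
    show "(\<lambda>t. if t \<in> {0..real n} then f t else 0) integrable_on {0..}" for n
      unfolding integrable_restrict_Int inter by (rule intn)
    show "(\<lambda>n. if t \<in> {0..real n} then f t else 0) \<longlonglongrightarrow> f t" if "t \<in> {0..}" for t
    proof (rule tendsto_eventually)
      obtain k where "t \<le> real k" using real_arch_simple by blast
      then show "\<forall>\<^sub>F n in sequentially. (if t \<in> {0..real n} then f t else 0) = f t"
        using that by (auto simp: eventually_sequentially intro!: exI[of _ k])
    qed
  qed (use int pos in auto)
  moreover have "integral {0..} (\<lambda>t. if t \<in> {0..real n} then f t else 0) = \<theta> (real n)" for n
    unfolding integral_restrict_Int inter by (simp add: \<theta>)
  ultimately show ?thesis by simp
qed

text \<open>
  The new time is \<open>\<theta> t = \<integral> p (y s) ds\<close> over \<open>{0..t}\<close>, an increasing map onto \<open>{0..<tm}\<close>, and the new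
  solution is \<open>y\<close> composed with the inverse of \<open>\<theta>\<close>.
\<close>

lemma time_change:
  fixes y :: "real \<Rightarrow> 'a::real_normed_vector" and p :: "'a \<Rightarrow> real"
  assumes y: "\<And>T. solves X y {0..T}"
    and p: "continuous_on UNIV p" and pos: "\<And>t. 0 \<le> t \<Longrightarrow> 0 < p (y t)"
    and X: "\<And>x. 0 < p x \<Longrightarrow> X x = p x *\<^sub>R Y x"
    and int: "(\<lambda>t. p (y t)) integrable_on {0..}"
    and lim: "filterlim y (nhds l) at_top"
    and tm: "tm = integral {0..} (\<lambda>t. p (y t))"
  shows "0 < tm" "\<exists>x. x 0 = y 0 \<and> (\<forall>t\<in>{0..<tm}. 0 < p (x t)) \<and> solves Y x {0..<tm} \<and>
     filterlim x (nhds l) (at_left tm)"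
proof -
  have cy: "continuous_on {0..T} y" for T
    by (rule solves_continuous_on[OF y])
  \<comment> \<open>With \<open>p (y t)\<close> continued to negative times by its value at \<open>0\<close>, the clock \<open>\<theta>\<close> and its inverse have
    two-sided derivatives also at \<open>0\<close>.\<close>
  define q where "q t = p (y (max 0 t))" for t
  have qpos: "0 < q t" for t using pos by (simp add: q_def)
  have cq: "continuous_on {a..b} q" for a b
    unfolding q_def
    by (intro continuous_on_compose2[OF p] continuous_on_compose2[OF cy[of "max 0 b"]] continuous_intros) auto
  have qint: "q integrable_on {a..b}" for a b by (rule integrable_continuous_interval[OF cq])
  define \<theta> where "\<theta> t = integral {- 1..t} q - integral {- 1..0} q" for t
  have \<theta>0: "\<theta> 0 = 0" by (simp add: \<theta>_def)
  have \<theta>int: "\<theta> t = integral {0..t} (\<lambda>t. p (y t))" if "0 \<le> t" for t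
  proof -
    have "integral {- 1..0} q + integral {0..t} q = integral {- 1..t} q"
      by (rule Henstock_Kurzweil_Integration.integral_combine) (use that qint in auto)
    moreover have "integral {0..t} q = integral {0..t} (\<lambda>t. p (y t))"
      by (intro integral_cong) (simp add: q_def)
    ultimately show ?thesis by (simp add: \<theta>_def)
  qed
  have d\<theta>: "(\<theta> has_real_derivative q t) (at t)" if "- 1 < t" for t
  proof -
    have "((\<lambda>u. integral {- 1..u} q) has_real_derivative q t) (at t within {- 1..t + 1})"
      by (rule integral_has_real_derivative[OF cq]) (use that in auto)
    moreover have "at t within {- 1..t + 1} = at t"
      by (rule at_within_interior) (use that in auto)
    ultimately have "((\<lambda>u. integral {- 1..u} q) has_real_derivative q t) (at t)" by simp
    from DERIV_diff[OF this DERIV_const[of "integral {- 1..0} q"]] show ?thesis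
      by (simp add: \<theta>_def[abs_def])
  qed
  have mono: "\<theta> s < \<theta> t" if "- 1 < s" "s < t" for s t
  proof (rule DERIV_pos_imp_increasing[OF that(2)])
    fix x assume "s \<le> x"
    then have "- 1 < x" using that by simp
    then show "\<exists>y. DERIV \<theta> x :> y \<and> 0 < y" using d\<theta> qpos by blast
  qed
  have lim\<theta>: "(\<lambda>n. \<theta> (real n)) \<longlonglongrightarrow> tm"
    unfolding tm by (rule integral_atLeast_limit[OF int]) (auto simp: \<theta>int less_imp_le[OF pos])
  have le: "\<theta> t < tm" if t: "- 1 < t" for t
  proof -
    have "\<theta> (t + 1) \<le> tm"
    proof (rule LIMSEQ_le_const[OF lim\<theta>])
      obtain k where k: "t + 1 \<le> real k" using real_arch_simple by blast
      show "\<exists>N. \<forall>n\<ge>N. \<theta> (t + 1) \<le> \<theta> (real n)"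
      proof (intro exI allI impI)
        fix n assume "k \<le> n"
        then have "t + 1 \<le> real n" using k by linarith
        then show "\<theta> (t + 1) \<le> \<theta> (real n)" using mono[of "t + 1" "real n"] t by (cases "t + 1 = real n") auto
      qed
    qed
    then show ?thesis using mono[of t "t + 1"] t by simp
  qed
  show tm0: "0 < tm" using le[of 0] \<theta>0 by simp
  define m where "m = \<theta> (- (1/2))"
  have m: "m < 0" using mono[of "- (1/2)" 0] \<theta>0 by (simp add: m_def)
  have surj: "\<exists>t>- 1. \<theta> t = u" if u: "m < u" "u < tm" for u
  proof -
    obtain n where n: "u < \<theta> (real n)"
      using order_tendstoD(1)[OF lim\<theta> u(2)] by (auto simp: eventually_sequentially)
    have "continuous_on {- (1/2)..real n} \<theta>"
      by (rule DERIV_continuous_on[OF has_field_derivative_at_within[OF d\<theta>]]) auto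
    then have "\<exists>x\<ge>- (1/2). x \<le> real n \<and> \<theta> x = u"
      using IVT'[of \<theta> "- (1/2)" u "real n"] n u by (auto simp: m_def)
    then show ?thesis by force
  qed
  define s where "s u = (SOME t. - 1 < t \<and> \<theta> t = u)" for u
  have s: "- 1 < s u" "\<theta> (s u) = u" if "m < u" "u < tm" for u
    using someI_ex[of "\<lambda>t. - 1 < t \<and> \<theta> t = u"] surj[OF that] by (auto simp: s_def)
  have inj: "r = t" if "- 1 < r" "- 1 < t" "\<theta> r = \<theta> t" for r t
    using mono[of r t] mono[of t r] that by (cases r t rule: linorder_cases) auto
  have s\<theta>: "s (\<theta> t) = t" if "- 1 < t" for t
  proof -
    have "- 1 < s (\<theta> t) \<and> \<theta> (s (\<theta> t)) = \<theta> t"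
      unfolding s_def by (rule someI[of "\<lambda>r. - 1 < r \<and> \<theta> r = \<theta> t" t]) (simp add: that)
    then show ?thesis using inj[OF _ that] by blast
  qed
  have s0: "s 0 = 0" using s\<theta>[of 0] \<theta>0 by simp
  have smono: "s u < s v" if "m < u" "u < v" "v < tm" for u v
    using s[of u] s[of v] mono[of "s v" "s u"] that by (cases "s u" "s v" rule: linorder_cases) auto
  have snn: "0 \<le> s u" if "0 \<le> u" "u < tm" for u
    using smono[of 0 u] s0 m that by (cases "u = 0") auto
  have ds: "(s has_real_derivative inverse (q (s u))) (at u)" if u: "m < u" "u < tm" for u
  proof (rule DERIV_inverse_function[where a = m and b = tm and f = \<theta>])
    define d where "d = (s u + 1) / 2"
    have d: "0 < d" "- 1 < s u - d" using s(1)[OF u] by (auto simp: d_def field_simps)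
    have "isCont s (\<theta> (s u))"
    proof (rule isCont_inverse_function[where f = \<theta> and x = "s u", OF d(1)])
      fix z assume "\<bar>z - s u\<bar> \<le> d"
      then have "- 1 < z" using d by linarith
      then show "s (\<theta> z) = z" "isCont \<theta> z" using s\<theta> d\<theta> DERIV_isCont by blast+
    qed
    then show "isCont s u" using s[OF u] by simp
    show "q (s u) \<noteq> 0" using qpos[of "s u"] by simp
  qed (use u s d\<theta> in auto)
  show "\<exists>x. x 0 = y 0 \<and> (\<forall>t\<in>{0..<tm}. 0 < p (x t)) \<and> solves Y x {0..<tm} \<and>
     filterlim x (nhds l) (at_left tm)"
  proof (intro exI conjI ballI)
    show "y (s 0) = y 0" by (simp add: s0)
    show "0 < p (y (s t))" if "t \<in> {0..<tm}" for t using pos snn that by auto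
    show "solves Y (\<lambda>t. y (s t)) {0..<tm}"
      unfolding solves_def
    proof
      fix u assume "u \<in> {0..<tm}"
      then have u: "0 \<le> u" "u < tm" by auto
      define v where "v = (u + tm) / 2"
      have v: "u < v" "v < tm" "0 \<le> v" using u by (auto simp: v_def)
      have "(s has_vector_derivative inverse (q (s u))) (at u within {0..<v})"
        using ds[of u] u m by (auto simp: has_real_derivative_iff_has_vector_derivative intro: has_vector_derivative_at_within)
      moreover have "(y has_vector_derivative X (y (s u))) (at (s u) within s ` {0..<v})"
      proof (rule has_vector_derivative_within_subset)
        have "s u \<le> s v" using smono[of u v] u v m by simp
        then show "(y has_vector_derivative X (y (s u))) (at (s u) within {0..s v})"
          using y[of "s v"] snn[OF u] by (simp add: solves_def)
        show "s ` {0..<v} \<subseteq> {0..s v}"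
          using snn smono[of _ v] v m by (force intro: less_imp_le)
      qed
      ultimately have "((\<lambda>t. y (s t)) has_vector_derivative inverse (q (s u)) *\<^sub>R X (y (s u))) (at u within {0..<v})"
        using vector_diff_chain_within[of s "inverse (q (s u))" u "{0..<v}" y "X (y (s u))"] by (simp add: o_def)
      moreover have "inverse (q (s u)) *\<^sub>R X (y (s u)) = Y (y (s u))"
      proof -
        have "q (s u) = p (y (s u))" using snn[OF u] by (simp add: q_def)
        moreover have "0 < p (y (s u))" using pos snn[OF u] by simp
        ultimately show ?thesis using X by simp
      qed
      moreover have "at u within {0..<v} = at u within {0..<tm}"
        by (rule at_within_nhd[of u "{..<v}"]) (use u v in auto)
      ultimately show "((\<lambda>t. y (s t)) has_vector_derivative Y (y (s u))) (at u within {0..<tm})" by simp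
    qed
    have "filterlim s at_top (at_left tm)"
      unfolding filterlim_at_top
    proof
      fix Z :: real
      define z where "z = max 0 Z"
      have "\<forall>\<^sub>F u in at_left tm. \<theta> z < u"
        by (rule eventually_at_left_real[THEN eventually_mono]) (use le[of z] in \<open>auto simp: z_def\<close>)
      moreover have "\<forall>\<^sub>F u in at_left tm. u < tm"
        by (simp add: eventually_at_filter)
      ultimately show "\<forall>\<^sub>F u in at_left tm. Z \<le> s u"
      proof eventually_elim
        case (elim u)
        have "0 \<le> z" by (simp add: z_def)
        then have "0 \<le> \<theta> z" using mono[of 0 z] \<theta>0 by (cases "z = 0") auto
        then have "s (\<theta> z) < s u" using smono[of "\<theta> z" u] elim m by simp
        then show ?case using s\<theta>[of z] by (simp add: z_def)
      qed
    qed
    then show "filterlim (\<lambda>t. y (s t)) (nhds l) (at_left tm)"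
      by (rule filterlim_compose[OF lim])
  qed
qed

section \<open>Coordinates on the block times the parameters\<close>

lemma enum_part_coord_space: "enum_part S z \<in> coord_space (card S)"
  by (simp add: enum_part_def coord_space_def)

lemma to_nat_on_less: "finite S \<Longrightarrow> j \<in> S \<Longrightarrow> to_nat_on S j < card S"
  using to_nat_on_finite[of S] by (auto simp: bij_betw_def)

lemma to_nat_on_from_nat_into_finite: "finite S \<Longrightarrow> i < card S \<Longrightarrow> to_nat_on S (from_nat_into S i) = i"
  using to_nat_on_finite[of S] by (intro to_nat_on_from_nat_into) (auto simp: bij_betw_def)

lemma from_nat_into_less: "i < card S \<Longrightarrow> from_nat_into S i \<in> S"
  by (metis card.empty from_nat_into not_less_zero)

lemma enorm_enum_part:
  fixes S :: "'n::finite set"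
  shows "enorm (card S) (enum_part S z) = norm (part S z)"
proof -
  have "(enorm (card S) (enum_part S z))\<^sup>2 = (\<Sum>i\<in>{..<card S}. (z $ from_nat_into S i)\<^sup>2)"
    unfolding enorm_square by (simp add: enum_part_def)
  also have "\<dots> = (\<Sum>j\<in>S. (z $ j)\<^sup>2)"
    by (rule sum.reindex_bij_betw[OF bij_betw_from_nat_into_finite]) simp
  also have "\<dots> = (\<Sum>j\<in>UNIV. (part S z $ j)\<^sup>2)"
    by (simp add: part_def if_distrib[of "\<lambda>x. x\<^sup>2"] sum.If_cases cong: if_cong)
  also have "\<dots> = (norm (part S z))\<^sup>2"
    by (simp add: norm_vec_def L2_set_def sum_nonneg)
  finally show ?thesis by simp
qed

text \<open>
  The vector with given coordinates \<open>(a, b)\<close>: the inverse of \<open>enum_part\<close> on \<open>U\<close> and on its complement.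
\<close>

definition assemble :: "'n::finite set \<Rightarrow> (nat \<Rightarrow> real) \<Rightarrow> (nat \<Rightarrow> real) \<Rightarrow> real^'n" where
  "assemble U p y = (\<chi> j. if j \<in> U then p (to_nat_on U j) else y (to_nat_on (- U) j))"

lemma enum_part_assemble:
  fixes U :: "'n::finite set"
  assumes "p \<in> coord_space (card U)" "y \<in> coord_space (card (- U))"
  shows "enum_part U (assemble U p y) = p" "enum_part (- U) (assemble U p y) = y"
proof -
  show "enum_part U (assemble U p y) = p"
  proof
    fix i show "enum_part U (assemble U p y) i = p i"
      using assms(1) from_nat_into_less[of i U]
      by (auto simp: enum_part_def assemble_def to_nat_on_from_nat_into_finite coord_space_def)
  qed
  show "enum_part (- U) (assemble U p y) = y"
  proof
    fix i show "enum_part (- U) (assemble U p y) i = y i"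
      using assms(2) from_nat_into_less[of i "- U"]
      by (auto simp: enum_part_def assemble_def to_nat_on_from_nat_into_finite coord_space_def)
  qed
qed

lemma assemble_enum_part:
  fixes U :: "'n::finite set"
  shows "assemble U (enum_part U z) (enum_part (- U) z) = z"
  by (auto simp: vec_eq_iff assemble_def enum_part_def to_nat_on_less)

lemma continuous_on_assemble:
  assumes "continuous_on S p" "continuous_on S y"
  shows "continuous_on S (\<lambda>x. assemble U (p x) (y x))"
  unfolding assemble_def
proof (rule continuous_on_vec_lambda)
  fix j show "continuous_on S (\<lambda>x. if j \<in> U then p x (to_nat_on U j) else y x (to_nat_on (- U) j))"
    by (cases "j \<in> U") (simp_all add: continuous_on_coord[OF assms(1)] continuous_on_coord[OF assms(2)])
qed

text \<open>
  The inverse of \<open>round_off\<close>, with the two factors left joined. Both maps rescale radially, by inverse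
  ratios of the round norm and the norm whose unit ball is the product of the two balls.
\<close>

definition unround :: "nat \<Rightarrow> nat \<Rightarrow> (nat \<Rightarrow> real) \<Rightarrow> nat \<Rightarrow> real" where
  "unround s k q = (\<lambda>i. enorm (s + k) q / max (enorm s (take_vec s q)) (enorm k (drop_vec s q)) * q i)"

lemma unround_scale: "0 < c \<Longrightarrow> unround s k (\<lambda>i. c * q i) = (\<lambda>i. c * unround s k q i)"
proof -
  assume c: "0 < c"
  have "take_vec s (\<lambda>i. c * q i) = (\<lambda>i. c * take_vec s q i)" "drop_vec s (\<lambda>i. c * q i) = (\<lambda>i. c * drop_vec s q i)"
    by (auto simp: take_vec_def drop_vec_def)
  moreover have "max (c * x) (c * y) = c * max x y" for x y
    using c by (simp add: max_def)
  ultimately show ?thesis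
    using c by (intro ext) (simp add: unround_def enorm_scale)
qed

lemma round_off_scaled:
  "round_off s k y v = (\<lambda>i. max (enorm s y) (enorm k v) / enorm (s + k) (join_coords s y v) * join_coords s y v i)"
proof -
  have "sqrt ((enorm s y)\<^sup>2 + (enorm k v)\<^sup>2) = enorm (s + k) (join_coords s y v)"
    using enorm_join_coords[of s k y v] by (metis enorm_nonneg real_sqrt_abs abs_of_nonneg)
  then show ?thesis by (simp add: round_off_def)
qed

lemma unround_round_off:
  assumes y: "y \<in> coord_space s" and v: "v \<in> coord_space k"
  shows "unround s k (round_off s k y v) = join_coords s y v"
proof (cases "join_coords s y v = zvec")
  case True
  then have "join_coords s y v i = 0" for i by metis
  then show ?thesis by (simp add: round_off_scaled unround_def fun_eq_iff)
next
  case False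
  define J where "J = join_coords s y v"
  define c where "c = max (enorm s y) (enorm k v) / enorm (s + k) J"
  have J: "0 < enorm (s + k) J"
    using False enorm_eq_0[OF join_coords_coord_space[OF v], of s y] enorm_nonneg[of "s + k" J]
    by (simp add: J_def less_le)
  have m: "0 < max (enorm s y) (enorm k v)"
  proof (rule ccontr)
    assume "\<not> ?thesis"
    then have "enorm s y = 0" "enorm k v = 0" using enorm_nonneg[of s y] enorm_nonneg[of k v] by linarith+
    then show False using J enorm_join_coords[of s k y v] by (simp add: J_def)
  qed
  have tk: "take_vec s J = y" "drop_vec s J = v" using y by (simp_all add: J_def take_join_coords)
  have "unround s k (round_off s k y v) = unround s k (\<lambda>i. c * J i)"
    by (simp add: round_off_scaled c_def J_def)
  also have "\<dots> = (\<lambda>i. c * unround s k J i)"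
    by (rule unround_scale) (use m J in \<open>simp add: c_def\<close>)
  also have "\<dots> = J" using m J by (simp add: unround_def tk c_def)
  finally show ?thesis by (simp add: J_def)
qed

lemma unround_blocks:
  assumes q: "q \<in> unit_ball (s + k)"
  shows "take_vec s (unround s k q) \<in> unit_ball s" "drop_vec s (unround s k q) \<in> unit_ball k"
proof -
  let ?m = "max (enorm s (take_vec s q)) (enorm k (drop_vec s q))"
  let ?c = "enorm (s + k) q / ?m"
  have q': "q \<in> coord_space (s + k)" "enorm (s + k) q \<le> 1" using q by (auto simp: unit_ball_iff)
  have m0: "0 \<le> ?m" by (simp add: le_max_iff_disj)
  have le: "?c * x \<le> 1" if "0 \<le> x" "x \<le> ?m" for x
  proof (cases "?m = 0")
    case False
    then have "0 < ?m" using m0 by simp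
    then have "x / ?m \<le> 1" using that by (simp only: divide_le_eq_1_pos)
    then have "enorm (s + k) q * (x / ?m) \<le> 1 * 1"
      using q'(2) that m0 by (intro mult_mono) auto
    then show ?thesis by simp
  qed simp
  have eq: "take_vec s (unround s k q) = (\<lambda>i. ?c * take_vec s q i)"
    "drop_vec s (unround s k q) = (\<lambda>i. ?c * drop_vec s q i)"
    by (auto simp: unround_def take_vec_def drop_vec_def)
  have "\<bar>?c\<bar> = ?c" using m0 by simp
  then show "take_vec s (unround s k q) \<in> unit_ball s" "drop_vec s (unround s k q) \<in> unit_ball k"
    unfolding eq unit_ball_iff enorm_scale
    using le[of "enorm s (take_vec s q)"] le[of "enorm k (drop_vec s q)"]
    by (auto intro!: coord_space_scale[OF take_vec_coord_space] coord_space_scale[OF drop_vec_coord_space[OF q'(1)]]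
        simp del: times_divide_eq_left times_divide_eq_right)
qed

lemma continuous_on_unround: "continuous_on (coord_space (s + k)) (unround s k)"
proof (rule continuous_on_vec)
  fix i
  let ?m = "\<lambda>q. max (enorm s (take_vec s q)) (enorm k (drop_vec s q))"
  show "continuous_on (coord_space (s + k)) (\<lambda>q. unround s k q i)"
  proof (rule continuous_on_zero_extension)
    have "?m q \<noteq> 0" if "q \<in> coord_space (s + k) - {zvec}" for q
    proof
      assume "?m q = 0"
      then have "enorm s (take_vec s q) = 0" "enorm k (drop_vec s q) = 0"
        using enorm_nonneg[of s "take_vec s q"] enorm_nonneg[of k "drop_vec s q"] by linarith+
      then have "enorm (s + k) q = 0"
        using enorm_join_coords[of s k "take_vec s q" "drop_vec s q"] by simp
      then show False using that enorm_eq_0[of q "s + k"] by auto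
    qed
    then show "continuous_on (coord_space (s + k) - {zvec}) (\<lambda>q. unround s k q i)"
      unfolding unround_def
      by (intro continuous_on_mult continuous_on_divide continuous_on_max ballI
          continuous_on_enorm[OF continuous_on_id] continuous_on_enorm[OF continuous_on_take_vec[OF continuous_on_id]]
          continuous_on_enorm[OF continuous_on_drop_vec[OF continuous_on_id]] continuous_on_coord[OF continuous_on_id]) auto
    fix q :: "nat \<Rightarrow> real" assume q: "q \<in> coord_space (s + k)"
    have qi: "\<bar>q i\<bar> \<le> ?m q"
    proof (cases "i < s")
      case True
      then show ?thesis using coord_le_enorm[OF take_vec_coord_space, of s q i] by (simp add: take_vec_def le_max_iff_disj)
    next
      case False
      then show ?thesis using coord_le_enorm[OF drop_vec_coord_space[OF q], of "i - s"] by (simp add: drop_vec_def le_max_iff_disj)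
    qed
    show "\<bar>unround s k q i\<bar> \<le> enorm (s + k) q"
    proof (cases "?m q = 0")
      case False
      then have "0 < ?m q" using qi by linarith
      then have "\<bar>q i\<bar> / ?m q \<le> 1" using qi by (simp only: divide_le_eq_1_pos)
      then have "enorm (s + k) q * (\<bar>q i\<bar> / ?m q) \<le> enorm (s + k) q * 1"
        by (intro mult_left_mono) auto
      then show ?thesis using \<open>0 < ?m q\<close> by (simp add: unround_def abs_mult)
    qed (simp add: unround_def)
  qed
qed

text \<open>
  The inverse of the chart of \<open>N \<times> K\<close>, up to the map \<open>P\<close>.
\<close>

definition block_point :: "'n::finite set \<Rightarrow> nat \<Rightarrow> ((nat \<Rightarrow> real) \<Rightarrow> 'k) \<Rightarrow> (nat \<Rightarrow> real) \<Rightarrow> (nat \<Rightarrow> real) \<Rightarrow> (real^'n) \<times> 'k" where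
  "block_point U kt \<kappa>' p q = (let w = unround (card (- U)) kt q in
     (assemble U p (take_vec (card (- U)) w), \<kappa>' (drop_vec (card (- U)) w)))"

lemma block_point_in_block:
  fixes U :: "'n::finite set"
  assumes \<kappa>': "\<kappa>' ` unit_ball kt \<subseteq> K" and p: "p \<in> unit_ball (card U)" and q: "q \<in> unit_ball (card (- U) + kt)"
  shows "block_point U kt \<kappa>' p q \<in> box_ab U \<times> K" "enum_part U (fst (block_point U kt \<kappa>' p q)) = p"
proof -
  let ?w = "unround (card (- U)) kt q"
  note b = unround_blocks[OF q]
  have e: "enum_part U (assemble U p (take_vec (card (- U)) ?w)) = p"
    "enum_part (- U) (assemble U p (take_vec (card (- U)) ?w)) = take_vec (card (- U)) ?w"
    using enum_part_assemble[of p U "take_vec (card (- U)) ?w"] p b by (auto simp: unit_ball_iff)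
  then show "enum_part U (fst (block_point U kt \<kappa>' p q)) = p" by (simp add: block_point_def Let_def)
  show "block_point U kt \<kappa>' p q \<in> box_ab U \<times> K"
    using b \<kappa>' p by (auto simp: block_point_def Let_def box_ab_def enorm_enum_part[symmetric] e unit_ball_iff image_subset_iff)
qed

lemma block_point_chart:
  fixes U :: "'n::finite set"
  assumes "\<kappa>' (\<kappa> \<mu>) = \<mu>" "\<kappa> \<mu> \<in> coord_space kt"
  shows "block_point U kt \<kappa>' (enum_part U z) (round_off (card (- U)) kt (enum_part (- U) z) (\<kappa> \<mu>)) = (z, \<mu>)"
  using assms
  by (simp add: block_point_def unround_round_off enum_part_coord_space take_join_coords assemble_enum_part)

lemma continuous_on_block_point:
  fixes U :: "'n::finite set" and \<kappa>' :: "(nat \<Rightarrow> real) \<Rightarrow> 'k::topological_space"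
  assumes \<kappa>': "continuous_on (unit_ball kt) \<kappa>'"
  shows "continuous_on (unit_ball (card U) \<times> unit_ball (card (- U) + kt)) (\<lambda>(p, q). block_point U kt \<kappa>' p q)"
proof -
  let ?D = "unit_ball (card U) \<times> unit_ball (card (- U) + kt)" and ?s = "card (- U)"
  have un: "continuous_on ?D (\<lambda>z. unround ?s kt (snd z))"
    by (rule continuous_on_compose2[OF continuous_on_unround continuous_on_snd[OF continuous_on_id]])
       (auto simp: unit_ball_iff)
  have "continuous_on ?D (\<lambda>z. assemble U (fst z) (take_vec ?s (unround ?s kt (snd z))))"
    by (rule continuous_on_assemble[OF continuous_on_fst[OF continuous_on_id] continuous_on_take_vec[OF un]])
  moreover have "continuous_on ?D (\<lambda>z. \<kappa>' (drop_vec ?s (unround ?s kt (snd z))))"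
    by (rule continuous_on_compose2[OF \<kappa>' continuous_on_drop_vec[OF un]])
       (use unround_blocks in auto)
  ultimately show ?thesis
    by (simp add: block_point_def Let_def case_prod_unfold continuous_on_Pair)
qed

text \<open>
  The family \<open>\<alpha> r\<close> is the exit coordinate after time \<open>T r\<close>. It starts as \<open>p\<close> and does not vanish on
  the exit face, which no orbit leaves towards \<open>|a| < 1\<close>. Where \<open>\<alpha> 1\<close> vanishes, the orbit cannot have
  met \<open>|a| \<ge> 1\<close> before.
\<close>

lemma trapped_crossing:
  fixes \<psi> :: "real \<Rightarrow> (real^'n::finite) \<times> ('k::topological_space) \<Rightarrow> real^'n" and U :: "'n set"
  assumes reach: "reaches (card U) (card (- U) + kt) Q"
    and \<kappa>': "continuous_on (unit_ball kt) \<kappa>'" "\<kappa>' ` unit_ball kt \<subseteq> K"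
    and cont: "\<And>T. continuous_on ({0..T} \<times> (box_ab U \<times> K)) (\<lambda>(t, w). \<psi> t w)"
    and init: "\<And>z \<mu>. z \<in> box_ab U \<Longrightarrow> \<mu> \<in> K \<Longrightarrow> \<psi> 0 (z, \<mu>) = z"
    and exit: "\<And>z \<mu> s t. z \<in> box_ab U \<Longrightarrow> \<mu> \<in> K \<Longrightarrow> 0 \<le> s \<Longrightarrow> s \<le> t \<Longrightarrow>
       1 \<le> norm (part U (\<psi> s (z, \<mu>))) \<Longrightarrow> 1 \<le> norm (part U (\<psi> t (z, \<mu>)))"
    and entrance: "\<And>z \<mu> t. z \<in> box_ab U \<Longrightarrow> \<mu> \<in> K \<Longrightarrow> 0 \<le> t \<Longrightarrow> norm (part (- U) (\<psi> t (z, \<mu>))) \<le> 1"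
    and T: "0 \<le> T"
  shows "\<exists>p\<in>unit_ball (card U). \<exists>q\<in>unit_ball (card (- U) + kt). Q p q \<and>
    (\<forall>t\<in>{0..T}. \<psi> t (block_point U kt \<kappa>' p q) \<in> box_ab U)"
proof -
  let ?B = "unit_ball (card U)" and ?C = "unit_ball (card (- U) + kt)"
  note bp = block_point_in_block[OF \<kappa>'(2)]
  define \<alpha> where "\<alpha> r p q = enum_part U (\<psi> (T * r) (block_point U kt \<kappa>' p q))" for r p q
  have norm_\<alpha>: "enorm (card U) (\<alpha> r p q) = norm (part U (\<psi> (T * r) (block_point U kt \<kappa>' p q)))" for r p q
    by (simp add: \<alpha>_def enorm_enum_part)
  have "\<exists>p\<in>?B. \<exists>q\<in>?C. Q p q \<and> \<alpha> 1 p q = zvec"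
  proof (rule reaches_end[OF reach])
    have "continuous_on ({0..1::real} \<times> (?B \<times> ?C)) (\<lambda>z. (T * fst z, (\<lambda>(p, q). block_point U kt \<kappa>' p q) (snd z)))"
      by (intro continuous_on_Pair continuous_on_mult continuous_on_const continuous_on_fst continuous_on_id
          continuous_on_compose2[OF continuous_on_block_point[OF \<kappa>'(1)] continuous_on_snd[OF continuous_on_id]]) auto
    moreover have "(\<lambda>z. (T * fst z, (\<lambda>(p, q). block_point U kt \<kappa>' p q) (snd z))) ` ({0..1::real} \<times> (?B \<times> ?C))
        \<subseteq> {0..T} \<times> (box_ab U \<times> K)"
      using T bp(1) by (fastforce simp: mult_left_le)
    ultimately have "continuous_on ({0..1::real} \<times> (?B \<times> ?C))
        (\<lambda>z. (\<lambda>(t, w). \<psi> t w) (T * fst z, (\<lambda>(p, q). block_point U kt \<kappa>' p q) (snd z)))"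
      by (rule continuous_on_compose2[OF cont])
    then have c: "continuous_on ({0..1::real} \<times> (?B \<times> ?C)) (\<lambda>(r, p, q). \<psi> (T * r) (block_point U kt \<kappa>' p q))"
      by (simp add: case_prod_unfold)
    show "continuous_on ({0..1::real} \<times> (?B \<times> ?C)) (\<lambda>(r, p, q). \<alpha> r p q)"
    proof (rule continuous_on_vec)
      fix i show "continuous_on ({0..1::real} \<times> (?B \<times> ?C)) (\<lambda>z. (case z of (r, p, q) \<Rightarrow> \<alpha> r p q) i)"
        using continuous_on_component[OF c, of "from_nat_into U i"]
        by (cases "i < card U") (simp_all add: \<alpha>_def enum_part_def case_prod_unfold)
    qed
    show "\<alpha> r p q \<in> coord_space (card U)" for r p q
      by (simp add: \<alpha>_def enum_part_coord_space)
    show start: "\<alpha> 0 p q = p" if pq: "p \<in> ?B" "q \<in> ?C" for p q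
    proof -
      have "\<psi> 0 (fst (block_point U kt \<kappa>' p q), snd (block_point U kt \<kappa>' p q)) = fst (block_point U kt \<kappa>' p q)"
        using bp(1)[OF pq] by (intro init) (auto simp: mem_Times_iff)
      then show ?thesis using bp(2)[OF pq] by (simp add: \<alpha>_def)
    qed
    show "\<alpha> r p q \<noteq> zvec" if r: "0 \<le> r" and p: "p \<in> unit_sphere (card U)" and q: "q \<in> ?C" for r p q
    proof -
      have pB: "p \<in> ?B" using p by (simp add: unit_ball_iff unit_sphere_iff)
      obtain z \<mu> where z: "block_point U kt \<kappa>' p q = (z, \<mu>)" by (cases "block_point U kt \<kappa>' p q")
      then have zK: "z \<in> box_ab U" "\<mu> \<in> K" using bp(1)[OF pB q] by auto
      have "1 \<le> norm (part U (\<psi> 0 (z, \<mu>)))"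
        using norm_\<alpha>[of 0 p q] start[OF pB q] p by (simp add: z unit_sphere_iff)
      from exit[OF zK order_refl _ this, of "T * r"] T r have "1 \<le> enorm (card U) (\<alpha> r p q)"
        by (simp add: norm_\<alpha> z)
      then show ?thesis by auto
    qed
  qed
  then obtain p q where pq: "p \<in> ?B" "q \<in> ?C" "Q p q" "\<alpha> 1 p q = zvec" by blast
  obtain z \<mu> where z: "block_point U kt \<kappa>' p q = (z, \<mu>)" by (cases "block_point U kt \<kappa>' p q")
  then have zK: "z \<in> box_ab U" "\<mu> \<in> K" using bp(1)[OF pq(1,2)] by auto
  have end0: "norm (part U (\<psi> T (z, \<mu>))) = 0" using norm_\<alpha>[of 1 p q] pq(4) by (simp add: z)
  have "\<psi> t (z, \<mu>) \<in> box_ab U" if t: "t \<in> {0..T}" for t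
    using exit[OF zK, of t T] t end0 entrance[OF zK, of t] by (force simp: box_ab_def)
  then show ?thesis using pq z by (intro bexI[of _ p] bexI[of _ q]) auto
qed

section \<open>The connecting orbit\<close>

lemma chain_limit:
  fixes F :: "nat \<Rightarrow> 'a::metric_space \<Rightarrow> 'a" and w :: "nat \<Rightarrow> nat \<Rightarrow> 'a"
  assumes C: "\<And>j. j \<le> m \<Longrightarrow> compact (C j)" and F: "\<And>j. j \<le> m \<Longrightarrow> continuous_on (C j) (F j)"
    and w: "\<And>k j. j \<le> m \<Longrightarrow> w k j \<in> C j" "\<And>k j. j < m \<Longrightarrow> w k (Suc j) = F j (w k j)"
    and lim: "(\<lambda>k. w k 0) \<longlonglongrightarrow> v 0" and v: "\<And>j. v (Suc j) = F j (v j)"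
  shows "(\<forall>j\<le>m. v j \<in> C j) \<and> (\<lambda>k. F m (w k m)) \<longlonglongrightarrow> v (Suc m)"
proof -
  have mem: "v j \<in> C j" if "j \<le> m" "(\<lambda>k. w k j) \<longlonglongrightarrow> v j" for j
    using closed_sequentially[OF compact_imp_closed[OF C[OF that(1)]] _ that(2)] w(1)[OF that(1)] by blast
  have step: "(\<lambda>k. F j (w k j)) \<longlonglongrightarrow> v (Suc j)" if "j \<le> m" "(\<lambda>k. w k j) \<longlonglongrightarrow> v j" for j
    unfolding v
    by (rule continuous_on_tendsto_compose[OF F[OF that(1)] that(2) mem[OF that]]) (use w(1) that in auto)
  have conv: "j \<le> m \<Longrightarrow> (\<lambda>k. w k j) \<longlonglongrightarrow> v j" for j
  proof (induction j)
    case (Suc j)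
    then have "(\<lambda>k. F j (w k j)) \<longlonglongrightarrow> v (Suc j)" by (intro step) auto
    then show ?case using w(2)[of j] Suc.prems by simp
  qed (use lim in simp)
  then show ?thesis using mem step by blast
qed

text \<open>
  The maps of the chain leave the parameter fixed, so the chain lies on one orbit of one field.
\<close>

lemma chain_parameter:
  assumes lip: "\<And>\<mu>. locally_lipschitz (X \<mu>)"
    and \<Phi>: "\<And>t x \<mu>. \<Phi> t (x, \<mu>) = (flow (X \<mu>) t x, \<mu>)"
    and def: "\<And>i x \<mu>. i \<le> m \<Longrightarrow> (x, \<mu>) \<in> C i \<Longrightarrow> flow_defined (X \<mu>) (\<tau> i) x"
    and w: "\<And>i. i \<le> m \<Longrightarrow> v i \<in> C i" "\<And>i. v (Suc i) = \<Phi> (\<tau> i) (v i)"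
    and v0: "v 0 = (x0, \<mu>0)" and i: "i \<le> Suc m"
  shows "flow_defined (X \<mu>0) (\<Sum>j<i. \<tau> j) x0 \<and> v i = (flow (X \<mu>0) (\<Sum>j<i. \<tau> j) x0, \<mu>0)"
  using i
proof (induction i)
  case 0
  have "flow_defined (X \<mu>0) (\<tau> 0) x0" using def[of 0] w(1)[of 0] v0 by simp
  then have "flow_defined (X \<mu>0) 0 x0"
    by (rule flow_defined_mono) (use \<open>flow_defined (X \<mu>0) (\<tau> 0) x0\<close> in \<open>auto simp: flow_defined_def\<close>)
  then show ?case using flow_defined_solves(2)[OF lip] v0 by simp
next
  case (Suc i)
  then have IH: "flow_defined (X \<mu>0) (\<Sum>j<i. \<tau> j) x0" "v i = (flow (X \<mu>0) (\<Sum>j<i. \<tau> j) x0, \<mu>0)" and im: "i \<le> m"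
    by auto
  have "flow_defined (X \<mu>0) (\<tau> i) (flow (X \<mu>0) (\<Sum>j<i. \<tau> j) x0)"
    using def[OF im] w(1)[OF im] IH(2) by auto
  from flow_add[OF lip IH(1) this] show ?case
    using w(2)[of i] IH(2) by (simp add: \<Phi>)
qed

theorem theorem3p17:
  fixes f :: "real^'n \<Rightarrow> real^'k \<Rightarrow> real^'n"
    and Tinv :: "real^'n \<Rightarrow> real"
    and g :: "(real^'n) \<times> (real^'k) \<Rightarrow> real^'n"
    and K V :: "(real^'k) set" and kt :: nat and \<kappa> :: "real^'k \<Rightarrow> (nat \<Rightarrow> real)"
    and xs :: "real^'k \<Rightarrow> real^'n"
    and N :: "(real^'n) set" and U :: "'n set" and M :: real
    and P :: "(real^'n) \<times> (real^'k) \<Rightarrow> real^'n"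
    and m :: nat and H :: "nat \<Rightarrow> ((real^'n) \<times> (real^'k)) hset" and \<tau> :: "nat \<Rightarrow> real"
  defines "X \<equiv> \<lambda>\<mu> x. g (x, \<mu>)"
    and "\<Phi> \<equiv> \<lambda>t (x, \<mu>). (flow (\<lambda>y. g (y, \<mu>)) t x, \<mu>)"
    and "NK \<equiv> block_times_params U P N K kt \<kappa>"
    and "\<tau>bar \<equiv> \<Sum>j\<le>m. \<tau> j"
  \<comment> \<open>desingularization: \<open>Tinv\<close> is \<open>1/T\<close>, and \<open>g\<close> is the smooth extension of \<open>f/T\<close>\<close>
  assumes Tinv: "continuous_on UNIV Tinv" "\<And>x. 0 \<le> Tinv x"
    and g_smooth: "smooth_on UNIV g"
    and g_ext: "\<And>x \<mu>. 0 < Tinv x \<Longrightarrow> g (x, \<mu>) = Tinv x *\<^sub>R f x \<mu>"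
  \<comment> \<open>the parameter set\<close>
    and K: "compact K" "kt \<le> CARD('k)"
      "homeomorphic_map (top_of_set K) (subtopology (Euclidean_space kt) (unit_ball kt)) \<kappa>"
  \<comment> \<open>(1) equilibria, block, adapted coordinates, cones\<close>
    and xs: "\<And>\<mu>. \<mu> \<in> K \<Longrightarrow> Tinv (xs \<mu>) = 0" "\<And>\<mu>. \<mu> \<in> K \<Longrightarrow> g (xs \<mu>, \<mu>) = 0"
    and block: "\<And>\<mu>. \<mu> \<in> K \<Longrightarrow> isolating_block (X \<mu>) N" "\<And>\<mu>. \<mu> \<in> K \<Longrightarrow> xs \<mu> \<in> N"
    and P_smooth: "open V" "K \<subseteq> V" "smooth_on (UNIV \<times> V) P"
    and P_diffeo: "\<And>\<mu>. \<mu> \<in> V \<Longrightarrow> inj (\<lambda>z. P (z, \<mu>))"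
      "\<And>\<mu> z. \<mu> \<in> V \<Longrightarrow> inj (frechet_derivative (\<lambda>y. P (y, \<mu>)) (at z))"
    and P_block: "\<And>\<mu>. \<mu> \<in> K \<Longrightarrow> P (0, \<mu>) = xs \<mu>"
      "\<And>\<mu>. \<mu> \<in> K \<Longrightarrow> (\<lambda>z. P (z, \<mu>)) ` box_ab U = N"
    and cone: "cone_condition U M (coord_field P g) (box_ab U \<times> K)"
  \<comment> \<open>(2) chain of covering relations\<close>
    and H: "\<And>i. i \<le> m \<Longrightarrow> is_hset (H i)" "\<And>i. i \<le> m \<Longrightarrow> hu (H i) = card U"
      "\<And>i. i \<le> m \<Longrightarrow> snd ` hsupp (H i) = K"
    and \<tau>: "\<And>i. i \<le> m \<Longrightarrow> 0 < \<tau> i"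
    and \<Phi>_defined: "\<And>i x \<mu>. i \<le> m \<Longrightarrow> (x, \<mu>) \<in> hsupp (H i) \<Longrightarrow> flow_defined (X \<mu>) (\<tau> i) x"
    and cover: "\<And>i. i < m \<Longrightarrow> covers (\<Phi> (\<tau> i)) (H i) (H (Suc i))"
    and cover_last: "covers (\<Phi> (\<tau> m)) (H m) NK"
  \<comment> \<open>(3) identical sign of T and finiteness of the maximal time\<close>
    and sign_time: "\<And>x0 \<mu>0. \<lbrakk> (x0, \<mu>0) \<in> hsupp (H 0);
        \<And>i. i \<in> {1..m} \<Longrightarrow> flow_defined (X \<mu>0) (\<Sum>j<i. \<tau> j) x0 \<and>
                              \<Phi> (\<Sum>j<i. \<tau> j) (x0, \<mu>0) \<in> hsupp (H i);
        flow_defined (X \<mu>0) \<tau>bar x0;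
        flow (X \<mu>0) \<tau>bar x0 \<in> local_stable_set (X \<mu>0) N (xs \<mu>0) \<rbrakk>
      \<Longrightarrow> (\<forall>t\<in>{0..\<tau>bar}. 0 < Tinv (flow (X \<mu>0) t x0)) \<and>
          (\<forall>y\<in>local_stable_set (X \<mu>0) N (xs \<mu>0) - {xs \<mu>0}. 0 < Tinv y) \<and>
          (\<lambda>t. Tinv (flow (X \<mu>0) t x0)) integrable_on {0..}"
  shows "\<exists>x0 \<mu>0. (x0, \<mu>0) \<in> hsupp (H 0) \<and>
      (\<forall>t\<ge>0. flow_defined (X \<mu>0) t x0) \<and>
      (\<lambda>t. Tinv (flow (X \<mu>0) t x0)) integrable_on {0..} \<and>
      (let tmax = integral {0..} (\<lambda>t. Tinv (flow (X \<mu>0) t x0)) in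
        0 < tmax \<and>
        (\<exists>x. x 0 = x0 \<and>
          (\<forall>t\<in>{0..<tmax}. 0 < Tinv (x t)) \<and>
          solves (\<lambda>y. f y \<mu>0) x {0..<tmax} \<and>
          (x \<longlongrightarrow> xs \<mu>0) (at_left tmax)))"
proof -
  define F where "F = coord_field P g"
  have g1: "C1_on UNIV g" using g_smooth unfolding smooth_on_def C1_on_Ck by blast
  have P2: "Ck_on (Suc (Suc 0)) (UNIV \<times> V) P" and P1: "C1_on (UNIV \<times> V) P"
    using P_smooth(3) unfolding smooth_on_def C1_on_Ck by blast+
  have F1: "C1_on (UNIV \<times> V) F"
    unfolding F_def by (rule coord_field_C1(1)[OF P_smooth(1) P2 g1 P_diffeo(2)])
  have P_der: "((\<lambda>y. P (y, \<mu>)) has_derivative frechet_derivative (\<lambda>y. P (y, \<mu>)) (at z)) (at z)"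
    if "\<mu> \<in> V" for \<mu> z
    by (rule coord_field_C1(2)[OF P_smooth(1) P2 g1 P_diffeo(2) that])
  have F_eq: "frechet_derivative (\<lambda>y. P (y, \<mu>)) (at z) (F (z, \<mu>)) = g (P (z, \<mu>), \<mu>)" if "\<mu> \<in> V" for \<mu> z
    unfolding F_def by (rule coord_field_C1(3)[OF P_smooth(1) P2 g1 P_diffeo(2) that])
  have KV: "\<mu> \<in> V" if "\<mu> \<in> K" for \<mu> using that P_smooth(2) by blast
  have sub: "box_ab U \<times> K \<subseteq> UNIV \<times> V" using P_smooth(2) by auto
  have lipX: "locally_lipschitz (X \<mu>)" for \<mu>
    unfolding X_def by (rule locally_lipschitz_slice[OF g1])
  have \<Phi>_eq: "\<Phi> t (x, \<mu>) = (flow (X \<mu>) t x, \<mu>)" for t x \<mu> by (simp add: \<Phi>_def X_def)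
  \<comment> \<open>the field in block coordinates and its flow, extended off the box\<close>
  have F0: "F (0, \<mu>) = 0" if "\<mu> \<in> K" for \<mu>
  proof -
    let ?D = "frechet_derivative (\<lambda>y. P (y, \<mu>)) (at 0)"
    have "?D (F (0, \<mu>)) = 0"
      using F_eq[OF KV[OF that], of 0] P_block(1)[OF that] xs(2)[OF that] by simp
    also have "0 = ?D 0"
      using linear_0[OF has_derivative_linear[OF P_der[OF KV[OF that], of 0]]] by simp
    finally show ?thesis using P_diffeo(2)[OF KV[OF that], of 0] by (simp add: inj_eq)
  qed
  have Fdiff: "F differentiable at (z, \<mu>)" if "z \<in> box_ab U" "\<mu> \<in> K" for z \<mu>
    using F1 KV[OF that(2)] by (auto simp: C1_on_def)
  have Fcont: "continuous_on (box_ab U \<times> K) F"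
    by (rule continuous_on_subset[OF C1_on_continuous[OF F1] sub])
  obtain L where L: "\<And>x y. closed_segment x y \<subseteq> box_ab U \<times> K \<Longrightarrow> norm (F x - F y) \<le> L * norm (x - y)"
    by (rule C1_on_lipschitz[OF F1 compact_Times[OF compact_box_ab K(1)] sub]) blast
  have Flip: "norm (F (x, \<mu>) - F (y, \<mu>)) \<le> L * norm (x - y)" if "\<mu> \<in> K" "x \<in> box_ab U" "y \<in> box_ab U" for \<mu> x y
  proof -
    have "closed_segment (x, \<mu>) (y, \<mu>) \<subseteq> box_ab U \<times> {\<mu>}"
      by (rule closed_segment_subset[OF _ _ convex_Times[OF convex_box_ab convex_singleton]]) (use that in auto)
    then have "closed_segment (x, \<mu>) (y, \<mu>) \<subseteq> box_ab U \<times> K" using that(1) by blast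
    from L[OF this] show ?thesis by (simp add: norm_Pair)
  qed
  have M: "1 \<le> M" using cone by (simp add: cone_condition_def)
  obtain c where c: "0 < c"
    and expand: "\<And>\<mu> z. \<mu> \<in> K \<Longrightarrow> z \<in> box_ab U \<Longrightarrow> norm (part (- U) z) \<le> M * norm (part U z) \<Longrightarrow>
      c * (norm (part U z))\<^sup>2 \<le> part U z \<bullet> F (z, \<mu>)"
    and contract: "\<And>\<mu> z. \<mu> \<in> K \<Longrightarrow> z \<in> box_ab U \<Longrightarrow> norm (part U z) \<le> M * norm (part (- U) z) \<Longrightarrow>
      part (- U) z \<bullet> F (z, \<mu>) \<le> - c * (norm (part (- U) z))\<^sup>2"
    by (rule cone_estimates[OF cone[folded F_def] Fdiff F0]) blast+
  obtain \<psi> :: "real \<Rightarrow> (real^'n) \<times> (real^'k) \<Rightarrow> real^'n" where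
    \<psi>_cont: "\<And>T. continuous_on ({0..T} \<times> (box_ab U \<times> K)) (\<lambda>(t, w). \<psi> t w)"
    and \<psi>_init: "\<And>z \<mu>. z \<in> box_ab U \<Longrightarrow> \<mu> \<in> K \<Longrightarrow> \<psi> 0 (z, \<mu>) = z"
    and \<psi>_exit: "\<And>z \<mu> s t. z \<in> box_ab U \<Longrightarrow> \<mu> \<in> K \<Longrightarrow> 0 \<le> s \<Longrightarrow> s \<le> t \<Longrightarrow>
       1 \<le> norm (part U (\<psi> s (z, \<mu>))) \<Longrightarrow> 1 \<le> norm (part U (\<psi> t (z, \<mu>)))"
    and \<psi>_entrance: "\<And>z \<mu> t. z \<in> box_ab U \<Longrightarrow> \<mu> \<in> K \<Longrightarrow> 0 \<le> t \<Longrightarrow> norm (part (- U) (\<psi> t (z, \<mu>))) \<le> 1"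
    and \<psi>_der: "\<And>z \<mu> t T. z \<in> box_ab U \<Longrightarrow> \<mu> \<in> K \<Longrightarrow> 0 \<le> t \<Longrightarrow> t \<le> T \<Longrightarrow> \<psi> t (z, \<mu>) \<in> box_ab U \<Longrightarrow>
       ((\<lambda>t. \<psi> t (z, \<mu>)) has_vector_derivative F (\<psi> t (z, \<mu>), \<mu>)) (at t within {0..T})"
    by (rule block_flow[OF K(1) Fcont Flip c M expand contract]) (assumption | (rule that; assumption))+
  have \<kappa>_hom: "homeomorphic_map (top_of_set K) (top_of_set (unit_ball kt)) \<kappa>"
  proof -
    have "coord_space kt \<inter> unit_ball kt = unit_ball kt" by (auto simp: unit_ball_iff)
    then show ?thesis using K(3) by (simp add: Euclidean_space_coord_space subtopology_subtopology)
  qed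
  then obtain \<kappa>' where "homeomorphic_maps (top_of_set K) (top_of_set (unit_ball kt)) \<kappa> \<kappa>'"
    using homeomorphic_map_maps by blast
  then have \<kappa>': "continuous_on (unit_ball kt) \<kappa>'" "\<kappa>' ` unit_ball kt \<subseteq> K"
    and \<kappa>\<kappa>': "\<And>\<mu>. \<mu> \<in> K \<Longrightarrow> \<kappa>' (\<kappa> \<mu>) = \<mu>" "\<And>\<mu>. \<mu> \<in> K \<Longrightarrow> \<kappa> \<mu> \<in> unit_ball kt"
    by (auto simp: homeomorphic_maps_iff_homeomorphism homeomorphism_def)
  let ?s = "card (- U) + kt"
  have NK_hu: "hu NK = card U" "hs NK = ?s" by (simp_all add: NK_def block_times_params_def)
  have NK_hdom: "hdom NK = {(x, \<mu>). \<mu> \<in> K \<and> x \<in> range (\<lambda>z. P (z, \<mu>))}"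
    by (simp add: NK_def block_times_params_def)
  have NK_chart: "hchart NK (P (z, \<mu>), \<mu>) = (enum_part U z, round_off (card (- U)) kt (enum_part (- U) z) (\<kappa> \<mu>))"
    if "\<mu> \<in> K" for z \<mu>
    by (simp add: NK_def block_times_params_def inv_f_f[OF P_diffeo(1)[OF KV[OF that]]])
  \<comment> \<open>for every time bound there is a chain whose end stays in the block up to that time\<close>
  define Q where "Q p q \<longleftrightarrow> (\<exists>w. (\<forall>j\<le>m. w j \<in> hsupp (H j)) \<and>
      (\<forall>j<m. w (Suc j) = \<Phi> (\<tau> j) (w j)) \<and> hchart NK (\<Phi> (\<tau> m) (w m)) = (p, q))" for p q
  have reach: "reaches (card U) ?s Q"
    using reaches_covers_chain[of m H "\<lambda>j. \<Phi> (\<tau> j)" NK] H(1) cover cover_last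
    unfolding NK_hu Q_def by blast
  have end_dom: "\<Phi> (\<tau> m) x \<in> hdom NK" if "x \<in> hsupp (H m)" for x
  proof -
    have "\<Phi> (\<tau> m) ` hsupp (H m) \<subseteq> hdom NK"
      using cover_last unfolding covers_def by (elim conjE)
    then show ?thesis using that by blast
  qed
  have "\<exists>w z \<mu>. (\<forall>j\<le>m. w j \<in> hsupp (H j)) \<and> (\<forall>j<m. w (Suc j) = \<Phi> (\<tau> j) (w j)) \<and>
      \<Phi> (\<tau> m) (w m) = (P (z, \<mu>), \<mu>) \<and> z \<in> box_ab U \<and> \<mu> \<in> K \<and> (\<forall>t\<in>{0..real k}. \<psi> t (z, \<mu>) \<in> box_ab U)" for k
  proof -
    have "\<exists>p\<in>unit_ball (card U). \<exists>q\<in>unit_ball ?s. Q p q \<and>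
        (\<forall>t\<in>{0..real k}. \<psi> t (block_point U kt \<kappa>' p q) \<in> box_ab U)"
      by (rule trapped_crossing[OF reach \<kappa>' \<psi>_cont \<psi>_init])
         (fact \<psi>_exit \<psi>_entrance | rule \<psi>_exit, assumption+ | rule \<psi>_entrance, assumption+ | simp)+
    then obtain p q where pq: "p \<in> unit_ball (card U)" "q \<in> unit_ball ?s" "Q p q"
      and stay: "\<forall>t\<in>{0..real k}. \<psi> t (block_point U kt \<kappa>' p q) \<in> box_ab U"
      by blast
    from pq(3) obtain w where w: "\<forall>j\<le>m. w j \<in> hsupp (H j)" "\<forall>j<m. w (Suc j) = \<Phi> (\<tau> j) (w j)"
      "hchart NK (\<Phi> (\<tau> m) (w m)) = (p, q)" unfolding Q_def by blast
    have "w m \<in> hsupp (H m)" using w(1) by simp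
    from end_dom[OF this] obtain z \<mu> where z: "\<mu> \<in> K" "\<Phi> (\<tau> m) (w m) = (P (z, \<mu>), \<mu>)"
      unfolding NK_hdom by auto
    have "p = enum_part U z" "q = round_off (card (- U)) kt (enum_part (- U) z) (\<kappa> \<mu>)"
      using w(3) unfolding z(2) NK_chart[OF z(1)] by auto
    then have "block_point U kt \<kappa>' p q = (z, \<mu>)"
      using block_point_chart[of \<kappa>' \<kappa> \<mu> kt U z] \<kappa>\<kappa>'[OF z(1)] by (simp add: unit_ball_iff)
    then show ?thesis
      using w z stay block_point_in_block(1)[OF \<kappa>'(2) pq(1,2)] by auto
  qed
  then obtain w z \<mu> where w: "\<And>k j. j \<le> m \<Longrightarrow> w k j \<in> hsupp (H j)" "\<And>k j. j < m \<Longrightarrow> w k (Suc j) = \<Phi> (\<tau> j) (w k j)"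
    and wz: "\<And>k. \<Phi> (\<tau> m) (w k m) = (P (z k, \<mu> k), \<mu> k)" and z: "\<And>k. z k \<in> box_ab U" "\<And>k. \<mu> k \<in> K"
    and stay: "\<And>k t. 0 \<le> t \<Longrightarrow> t \<le> real k \<Longrightarrow> \<psi> t (z k, \<mu> k) \<in> box_ab U"
    by (atomize_elim, unfold atLeastAtMost_iff Ball_def) metis
  \<comment> \<open>A chain is determined by its first point, so a convergent subsequence of the first points and of the
    end points in block coordinates is enough.\<close>
  have cH: "compact (hsupp (H j))" if "j \<le> m" for j using H(1)[OF that] by (simp add: is_hset_def)
  have "compact (hsupp (H 0) \<times> (box_ab U \<times> K))"
    by (intro compact_Times cH compact_box_ab K) simp
  then have "seq_compact (hsupp (H 0) \<times> (box_ab U \<times> K))" by (rule compact_imp_seq_compact)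
  moreover have "\<forall>k. (w k 0, (z k, \<mu> k)) \<in> hsupp (H 0) \<times> (box_ab U \<times> K)" using w(1)[of 0] z by simp
  ultimately obtain l r where l: "l \<in> hsupp (H 0) \<times> (box_ab U \<times> K)" and r: "strict_mono r"
    and lim: "((\<lambda>k. (w k 0, (z k, \<mu> k))) \<circ> r) \<longlonglongrightarrow> l"
    by (rule seq_compactE) blast
  obtain v0 z0 \<mu>0 where l_eq: "l = (v0, (z0, \<mu>0))" by (metis prod.collapse)
  have z0: "z0 \<in> box_ab U" "\<mu>0 \<in> K" using l l_eq by auto
  have lims: "(\<lambda>k. w (r k) 0) \<longlonglongrightarrow> v0" "(\<lambda>k. (z (r k), \<mu> (r k))) \<longlonglongrightarrow> (z0, \<mu>0)"
    using tendsto_fst[OF lim] tendsto_snd[OF lim] by (simp_all add: l_eq o_def)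
  define v where "v = rec_nat v0 (\<lambda>j. \<Phi> (\<tau> j))"
  have v: "v 0 = v0" "\<And>j. v (Suc j) = \<Phi> (\<tau> j) (v j)" by (simp_all add: v_def)
  have \<Phi>_cont: "continuous_on (hsupp (H j)) (\<Phi> (\<tau> j))" if "j \<le> m" for j
  proof (cases "j = m")
    case True
    then show ?thesis using cover_last unfolding covers_def by (elim conjE) simp
  next
    case False
    then have "j < m" using that by simp
    from cover[OF this] show ?thesis unfolding covers_def by (elim conjE)
  qed
  have chain: "(\<forall>j\<le>m. v j \<in> hsupp (H j)) \<and> (\<lambda>k. \<Phi> (\<tau> m) (w (r k) m)) \<longlonglongrightarrow> v (Suc m)"
    by (rule chain_limit[where C = "\<lambda>j. hsupp (H j)" and F = "\<lambda>j. \<Phi> (\<tau> j)" and w = "\<lambda>k. w (r k)"])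
       (use cH \<Phi>_cont w lims(1) v in auto)
  have "(\<lambda>k. (P (z (r k), \<mu> (r k)), \<mu> (r k))) \<longlonglongrightarrow> (P (z0, \<mu>0), \<mu>0)"
  proof (rule tendsto_Pair)
    show "(\<lambda>k. P (z (r k), \<mu> (r k))) \<longlonglongrightarrow> P (z0, \<mu>0)"
      by (rule continuous_on_tendsto_compose[OF C1_on_continuous[OF P1] lims(2)]) (use KV z z0 in auto)
    show "(\<lambda>k. \<mu> (r k)) \<longlonglongrightarrow> \<mu>0" using tendsto_snd[OF lims(2)] by simp
  qed
  then have vend: "v (Suc m) = (P (z0, \<mu>0), \<mu>0)"
    using chain unfolding wz by (blast intro: LIMSEQ_unique)
  have trapped: "\<psi> t (z0, \<mu>0) \<in> box_ab U" if t: "0 \<le> t" for t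
  proof -
    have "(\<lambda>k. (\<lambda>(t, w). \<psi> t w) (t, (z (r k), \<mu> (r k)))) \<longlonglongrightarrow> (\<lambda>(t, w). \<psi> t w) (t, (z0, \<mu>0))"
      by (rule continuous_on_tendsto_compose[OF \<psi>_cont[of t] tendsto_Pair[OF tendsto_const lims(2)]])
         (use z z0 t in auto)
    then have conv: "(\<lambda>k. \<psi> t (z (r k), \<mu> (r k))) \<longlonglongrightarrow> \<psi> t (z0, \<mu>0)" by simp
    have ev: "\<forall>\<^sub>F k in sequentially. \<psi> t (z (r k), \<mu> (r k)) \<in> box_ab U"
    proof -
      obtain k0 where k0: "t \<le> real k0" using real_arch_simple by blast
      have "\<psi> t (z (r k), \<mu> (r k)) \<in> box_ab U" if "k0 \<le> k" for k
      proof (rule stay[OF t])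
        have "k0 \<le> r k" using that seq_suble[OF r, of k] by linarith
        then show "t \<le> real (r k)" using k0 by linarith
      qed
      then show ?thesis by (auto simp: eventually_sequentially)
    qed
    show ?thesis
      by (rule Lim_in_closed_set[OF compact_imp_closed[OF compact_box_ab] ev sequentially_bot conv])
  qed
  \<comment> \<open>the trapped orbit lies on the local stable set\<close>
  define y1 where "y1 t = P (\<psi> t (z0, \<mu>0), \<mu>0)" for t
  have y1_sol: "solves (X \<mu>0) y1 {0..T}" for T
    unfolding solves_def
  proof
    fix t assume t: "t \<in> {0..T}"
    have "((\<lambda>t. \<psi> t (z0, \<mu>0)) has_vector_derivative F (\<psi> t (z0, \<mu>0), \<mu>0)) (at t within {0..T})"
      using t trapped by (intro \<psi>_der z0) auto
    from vector_derivative_diff_chain_within[OF this has_derivative_at_withinI[OF P_der[OF KV[OF z0(2)]]]]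
    show "(y1 has_vector_derivative X \<mu>0 (y1 t)) (at t within {0..T})"
      using F_eq[OF KV[OF z0(2)], of "\<psi> t (z0, \<mu>0)"] by (simp add: o_def y1_def[abs_def] X_def)
  qed
  have y1_N: "y1 t \<in> N" if "0 \<le> t" for t
    unfolding y1_def P_block(2)[OF z0(2), symmetric] using trapped[OF that] by blast
  have "filterlim (\<lambda>t. \<psi> t (z0, \<mu>0)) (nhds 0) at_top"
    by (rule trapped_orbit_converges[where f = "\<lambda>z. F (z, \<mu>0)" and U = U, OF trapped _ c M])
       (use expand contract z0 \<psi>_der trapped in auto)
  moreover have "isCont (\<lambda>z. P (z, \<mu>0)) 0"
    using has_derivative_continuous[OF P_der[OF KV[OF z0(2)], of 0]] .
  ultimately have y1_lim: "filterlim y1 (nhds (xs \<mu>0)) at_top"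
    unfolding y1_def P_block(1)[OF z0(2), symmetric] by (rule isCont_tendsto_compose[rotated])
  define x1 where "x1 = P (z0, \<mu>0)"
  have y1_0: "y1 0 = x1" by (simp add: y1_def x1_def \<psi>_init[OF z0])
  have flow1: "flow (X \<mu>0) t x1 = y1 t" "flow_defined (X \<mu>0) t x1" if "0 \<le> t" for t
    using flow_eq[OF lipX y1_0 y1_sol that order_refl] .
  have "filterlim (\<lambda>t. flow (X \<mu>0) t x1) (nhds (xs \<mu>0)) at_top"
    by (rule filterlim_cong[THEN iffD1, OF refl refl _ y1_lim])
       (use flow1 in \<open>auto simp: eventually_at_top_linorder intro!: exI[of _ 0]\<close>)
  then have x1_stable: "x1 \<in> local_stable_set (X \<mu>0) N (xs \<mu>0)"
    using y1_N[of 0] y1_0 flow1 y1_N by (auto simp: local_stable_set_def)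
  \<comment> \<open>The orbit of the first point is the chain followed by the trapped orbit.\<close>
  obtain x0 \<mu>1 where v0_eq: "v0 = (x0, \<mu>1)" by (cases v0)
  have chain_flow: "flow_defined (X \<mu>1) (\<Sum>j<i. \<tau> j) x0 \<and> v i = (flow (X \<mu>1) (\<Sum>j<i. \<tau> j) x0, \<mu>1)" if "i \<le> Suc m" for i
    by (rule chain_parameter[where C = "\<lambda>j. hsupp (H j)" and m = m and \<Phi> = \<Phi> and X = X and \<tau> = \<tau> and v = v, OF lipX \<Phi>_eq \<Phi>_defined _ v(2) _ that])
       (use chain v(1) v0_eq in auto)
  have tb: "(\<Sum>j<Suc m. \<tau> j) = \<tau>bar" by (simp add: \<tau>bar_def lessThan_Suc_atMost)
  from chain_flow[of "Suc m"] vend have \<mu>1: "\<mu>1 = \<mu>0" and fd_bar: "flow_defined (X \<mu>0) \<tau>bar x0"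
    and fl_bar: "flow (X \<mu>0) \<tau>bar x0 = x1" unfolding tb by (auto simp: x1_def)
  have tb0: "0 \<le> \<tau>bar" using fd_bar by (simp add: flow_defined_def)
  have x0_H: "(x0, \<mu>0) \<in> hsupp (H 0)" using chain v(1) v0_eq \<mu>1 by force
  have sign: "(\<forall>t\<in>{0..\<tau>bar}. 0 < Tinv (flow (X \<mu>0) t x0)) \<and>
          (\<forall>y\<in>local_stable_set (X \<mu>0) N (xs \<mu>0) - {xs \<mu>0}. 0 < Tinv y) \<and>
          (\<lambda>t. Tinv (flow (X \<mu>0) t x0)) integrable_on {0..}"
  proof (rule sign_time[OF x0_H _ fd_bar])
    fix i assume i: "i \<in> {1..m}"
    have "v i \<in> hsupp (H i)" using chain i by auto
    then show "flow_defined (X \<mu>0) (\<Sum>j<i. \<tau> j) x0 \<and> \<Phi> (\<Sum>j<i. \<tau> j) (x0, \<mu>0) \<in> hsupp (H i)"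
      using chain_flow[of i] i \<mu>1 by (simp add: \<Phi>_eq)
  qed (simp add: fl_bar x1_stable)
  define y where "y t = flow (X \<mu>0) t x0" for t
  have fd: "flow_defined (X \<mu>0) t x0" and y_after: "\<tau>bar \<le> t \<Longrightarrow> y t = flow (X \<mu>0) (t - \<tau>bar) x1" if "0 \<le> t" for t
  proof -
    have *: "flow_defined (X \<mu>0) t x0 \<and> y t = flow (X \<mu>0) (t - \<tau>bar) x1" if "\<tau>bar \<le> t"
    proof -
      have "flow_defined (X \<mu>0) (t - \<tau>bar) (flow (X \<mu>0) \<tau>bar x0)"
        unfolding fl_bar by (rule flow1(2)) (use that in simp)
      from flow_add[OF lipX fd_bar this] show ?thesis by (simp add: y_def fl_bar)
    qed
    then show "\<tau>bar \<le> t \<Longrightarrow> y t = flow (X \<mu>0) (t - \<tau>bar) x1" by blast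
    show "flow_defined (X \<mu>0) t x0"
      using * flow_defined_mono[OF fd_bar \<open>0 \<le> t\<close>] by (cases "\<tau>bar \<le> t") auto
  qed
  have y_sol: "solves (X \<mu>0) y {0..T}" for T
  proof (cases "0 \<le> T")
    case True
    then show ?thesis unfolding y_def by (rule flow_defined_solves(1)[OF lipX fd])
  qed (simp add: solves_def)
  have y0: "y 0 = x0" unfolding y_def by (rule flow_defined_solves(2)[OF lipX fd_bar])
  have y_pos: "0 < Tinv (y t)" if t: "0 \<le> t" for t
  proof (cases "t \<le> \<tau>bar")
    case True
    then show ?thesis using sign t by (simp add: y_def)
  next
    case False
    have "y t \<in> local_stable_set (X \<mu>0) N (xs \<mu>0)"
      using local_stable_set_forward[OF lipX x1_stable, of "t - \<tau>bar"] y_after[OF t] False by simp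
    moreover have "y t \<noteq> xs \<mu>0"
    proof
      assume eq: "y t = xs \<mu>0"
      have "solves (X \<mu>0) (\<lambda>_. xs \<mu>0) {0..t}"
        using xs(2)[OF z0(2)] by (simp add: solves_def X_def)
      from solves_unique[OF lipX y_sol this _ eq, of \<tau>bar] have "y \<tau>bar = xs \<mu>0"
        using t tb0 False by simp
      moreover have "0 < Tinv (y \<tau>bar)" using sign tb0 by (simp add: y_def)
      ultimately show False using xs(1)[OF z0(2)] by simp
    qed
    ultimately show ?thesis using sign by blast
  qed
  have y_lim: "filterlim y (nhds (xs \<mu>0)) at_top"
  proof -
    have "filterlim (\<lambda>t. - \<tau>bar + t) at_top at_top"
      by (rule filterlim_tendsto_add_at_top[OF tendsto_const filterlim_ident])
    from filterlim_compose[OF y1_lim this]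
    show ?thesis
      by (rule filterlim_cong[THEN iffD1, OF refl refl, rotated])
         (use y_after flow1(1) tb0 in \<open>auto simp: eventually_at_top_linorder intro!: exI[of _ \<tau>bar]\<close>)
  qed
  have int: "(\<lambda>t. Tinv (y t)) integrable_on {0..}" using sign by (simp add: y_def)
  have ext: "X \<mu>0 x = Tinv x *\<^sub>R f x \<mu>0" if "0 < Tinv x" for x
    using g_ext[OF that] by (simp add: X_def)
  note tc = time_change[OF y_sol Tinv(1) y_pos ext int y_lim refl]
  show ?thesis
  proof (intro exI[of _ x0] exI[of _ \<mu>0] conjI)
    show "(x0, \<mu>0) \<in> hsupp (H 0)" by (rule x0_H)
    show "\<forall>t\<ge>0. flow_defined (X \<mu>0) t x0" using fd by simp
    show "(\<lambda>t. Tinv (flow (X \<mu>0) t x0)) integrable_on {0..}" using int by (simp only: y_def)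
    show "let tmax = integral {0..} (\<lambda>t. Tinv (flow (X \<mu>0) t x0)) in
        0 < tmax \<and>
        (\<exists>x. x 0 = x0 \<and>
          (\<forall>t\<in>{0..<tmax}. 0 < Tinv (x t)) \<and>
          solves (\<lambda>y. f y \<mu>0) x {0..<tmax} \<and>
          (x \<longlongrightarrow> xs \<mu>0) (at_left tmax))"
      unfolding Let_def y_def[symmetric] using tc(1) tc(2)[unfolded y0] by (rule conjI)
  qed
qed

end
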